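(* Let $d\ge 1$, $s\in(0,1)$, and let $K:\mathbb{R}^d\times\mathbb{R}^d\to[0,\infty)$ be measurable. Assume there exist $\lambda>0$ and $\mu\in(0,1)$ such that for every ball $B\subset\mathbb{R}^d$ and every $x\in B$, $$|\{z\in B: K(x,z)\ge \lambda |x-z|^{-d-2s}\}|\ge \mu |B|.$$ Then there is a constant $c>0$, depending on the dimension $d$ and $\mu$ only, such that for every (measurable) function $u:\mathbb{R}^d\to\mathbb{R}$, $$\int_{\mathbb{R}^d}\int_{\mathbb{R}^d}(u(x)-u(y))^2K(x,y)\,dy\,dx\ \ge\ c\,\lambda\,\|u\|_{\dot H^s(\mathbb{R}^d)}^2 .$$
   Context: The parameter $s\in(0,1)$ is fixed throughout. $|E|$ denotes Lebesgue measure of $E\subset\mathbb{R}^d$. $K$ is not assumed symmetric. The homogeneous fractional Sobolev seminorm is $$\|u\|_{\dot H^s(\mathbb{R}^d)}^2=c_{d,s}\iint_{\mathbb{R}^d\times\mathbb{R}^d}|u(x)-u(y)|^2|x-y|^{-d-2s}\,dx\,dy,$$ where $c_{d,s}>0$ is the normalization constant for which this equals $\int_{\mathbb{R}^d}|\hat u(\xi)|^2|\xi|^{2s}\,d\xi$. Both sides of the inequality may be $+\infty$. *)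

theory Defs
  imports "HOL-Analysis.Analysis"
begin

(* Unitary convention, so that Plancherel's identity holds without a constant. *)
definition fourier_transform :: "(real ^ 'n \<Rightarrow> real) \<Rightarrow> real ^ 'n \<Rightarrow> complex" where
  "fourier_transform u \<xi> =
     complex_of_real ((2 * pi) powr (- real CARD('n) / 2)) *
     (LINT x|lebesgue. cis (- (\<xi> \<bullet> x)) * complex_of_real (u x))"

(* On the diagonal the factor (u x - u y)^2 vanishes and "0 powr _" is 0, so the junk value is
   harmless. *)
definition double_integral_Hs :: "real \<Rightarrow> (real ^ 'n \<Rightarrow> real) \<Rightarrow> ennreal" where
  "double_integral_Hs s u =
     (\<integral>\<^sup>+ p. (case p of (x, y) \<Rightarrow>
        ennreal (\<bar>u x - u y\<bar>\<^sup>2 * norm (x - y) powr (- real CARD('n) - 2 * s))) \<partial>lebesgue)"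

(* The constant c_{d,s}; the type argument carries the dimension d = CARD('n).  The defining
   identity is required for all continuous u of compact support, for which the Fourier transform
   is a convergent integral; both sides are values in [0,\<infinity>].  A single u with finite
   nonzero double integral already determines c. *)
definition Hs_const :: "'n::finite itself \<Rightarrow> real \<Rightarrow> real" where
  "Hs_const T s =
     (THE c. c > 0 \<and>
       (\<forall>u :: real ^ 'n \<Rightarrow> real.
          continuous_on UNIV u \<and> compact (closure {x. u x \<noteq> 0}) \<longrightarrow>
          ennreal c * double_integral_Hs s u =
          (\<integral>\<^sup>+ \<xi>. ennreal ((cmod (fourier_transform u \<xi>))\<^sup>2 * norm \<xi> powr (2 * s)) \<partial>lebesgue)))"

definition Hs_seminorm_sq :: "real \<Rightarrow> (real ^ 'n \<Rightarrow> real) \<Rightarrow> ennreal" where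
  "Hs_seminorm_sq s u = ennreal (Hs_const TYPE('n) s) * double_integral_Hs s u"

end

theory Submission
  imports Defs "HOL-Probability.Characteristic_Functions"
begin

text \<open>
  Only the set \<open>E\<close> of pairs with \<open>K x y \<ge> lam * |x - y| powr (- d - 2 * s)\<close> matters, and the left hand
  side may be restricted to it. The hypothesis says that from every point of every ball \<open>B\<close> a fixed
  proportion of \<open>B\<close> can be reached through \<open>E\<close>. As that proportion may be below one half, two points
  of \<open>B\<close> need not have a common neighbour, so one cannot simply insert an intermediate point and
  apply the triangle inequality. What the hypothesis does give, because it holds at all places and
  scales, is an isoperimetric inequality.

  Let \<open>A \<subseteq> B\<close> fill at most half of \<open>B\<close>. Around almost every point of \<open>A\<close> there is a ball inside \<open>B\<close>
  which \<open>A\<close> almost fills: the complement of \<open>A\<close> takes up a proportion of it between \<open>\<mu> / 4\<close> and \<open>\<mu> / 2\<close>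
  (lemma \<open>balanced_subball\<close>). Points of the complement in that ball must have \<open>E\<close>-neighbours in \<open>A\<close>. By
  Vitali's covering lemma this bounds \<open>|A|\<close> by the integral of \<open>|x - y| powr (- d)\<close> over the pairs of
  \<open>E\<close> which enter \<open>A\<close>, and the same bound survives, up to an error \<open>|A' - A|\<close>, if the pairs must start
  outside a larger set \<open>A'\<close> (lemma \<open>isoperimetric\<close>). This gap is what turns the inequality for sets
  into one for functions in \<open>L\<^sup>2\<close>: take \<open>A = {f \<ge> t}\<close> and \<open>A' = {f \<ge> \<theta> * t}\<close>, integrate against
  \<open>2 * t\<close>, and absorb the error by choosing \<open>\<theta>\<close> close to \<open>1\<close>. Applied on both sides of a median, this is a
  Poincare inequality on \<open>B\<close> with the energy of \<open>E\<close> on the right (lemma \<open>local_poincare\<close>).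
  Integration over all centres and then over all radii gives the comparison of the two
  quadratic forms, with a constant of size \<open>1 / s\<close> (lemma \<open>coercivity_borel\<close>).

  The factor \<open>1 / s\<close> has to be made up for by the normalisation of the seminorm, so the constant
  \<open>c\<close> of the definition has to be shown to exist and to be at most a multiple of \<open>s\<close>.
  Plancherel's identity for differences \<open>u (x + h) - u x\<close> turns the double integral into
  \<open>\<integral> |\<xi>| powr (2 * s) * |u^(\<xi>)|\<^sup>2\<close> times the integral of \<open>(2 - 2 * cos (e \<bullet> h)) * |h| powr (- d - 2 * s)\<close>
  for a unit vector \<open>e\<close>. Writing the power of \<open>|h|\<close> as a superposition of Gaussians evaluates
  that integral, shows that it depends on \<open>\<xi>\<close> only through \<open>|\<xi>|\<close>, and shows that it is at least a
  multiple of \<open>1 / s\<close> (lemmas \<open>symbol_integral\<close> and \<open>symbol_const_lower\<close>).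
\<close>

section \<open>Almost every point is a density point\<close>

text \<open>
  For \<open>z\<close> in the ball with centre \<open>a\<close> and radius \<open>r\<close> this is the image of that ball under the homothety
  with centre \<open>z\<close> and ratio \<open>\<theta>\<close>. In contrast to balls centred at \<open>z\<close>, these sets never leave the
  original ball, and they increase with \<open>\<theta>\<close> up to the ball itself.
\<close>

definition shrink :: "'a::euclidean_space \<Rightarrow> real \<Rightarrow> 'a \<Rightarrow> real \<Rightarrow> 'a set" where
  "shrink a r z \<theta> = ball ((1 - \<theta>) *\<^sub>R z + \<theta> *\<^sub>R a) (\<theta> * r)"

lemma shrink_1 [simp]: "shrink a r z 1 = ball a r"
  by (simp add: shrink_def)

lemma mem_shrink:
  assumes "z \<in> ball a r" "0 < \<theta>"
  shows "z \<in> shrink a r z \<theta>"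
proof -
  have "(1 - \<theta>) *\<^sub>R z + \<theta> *\<^sub>R a - z = \<theta> *\<^sub>R (a - z)"
    by (simp add: algebra_simps)
  then have "dist ((1 - \<theta>) *\<^sub>R z + \<theta> *\<^sub>R a) z = \<theta> * dist a z"
    using assms by (simp add: dist_norm)
  then show ?thesis using assms by (simp add: shrink_def)
qed

lemma shrink_mono:
  assumes z: "z \<in> ball a r" and "\<theta>' \<le> \<theta>"
  shows "shrink a r z \<theta>' \<subseteq> shrink a r z \<theta>"
proof -
  have "((1 - \<theta>') *\<^sub>R z + \<theta>' *\<^sub>R a) - ((1 - \<theta>) *\<^sub>R z + \<theta> *\<^sub>R a) = (\<theta> - \<theta>') *\<^sub>R (z - a)"
    by (simp add: algebra_simps)
  then have "dist ((1 - \<theta>') *\<^sub>R z + \<theta>' *\<^sub>R a) ((1 - \<theta>) *\<^sub>R z + \<theta> *\<^sub>R a) = (\<theta> - \<theta>') * dist a z"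
    using assms by (simp add: dist_norm norm_minus_commute)
  also have "\<dots> \<le> (\<theta> - \<theta>') * r"
    using assms by (intro mult_left_mono) auto
  finally show ?thesis
    unfolding shrink_def by (simp add: ball_subset_ball_iff algebra_simps)
qed

lemma shrink_subset:
  assumes z: "z \<in> ball a r" and "\<theta> \<le> 1"
  shows "shrink a r z \<theta> \<subseteq> ball a r"
  using shrink_mono[OF assms] by simp

lemma shrink_subset_ball:
  assumes z: "z \<in> ball a r" and "0 < \<theta>"
  shows "shrink a r z \<theta> \<subseteq> ball z (2 * \<theta> * r)"
proof
  fix y assume "y \<in> shrink a r z \<theta>"
  then have "dist ((1 - \<theta>) *\<^sub>R z + \<theta> *\<^sub>R a) y < \<theta> * r"
    by (simp add: shrink_def)
  moreover have "dist z ((1 - \<theta>) *\<^sub>R z + \<theta> *\<^sub>R a) < \<theta> * r"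
    using mem_shrink[OF assms] by (simp add: shrink_def dist_commute)
  ultimately show "y \<in> ball z (2 * \<theta> * r)"
    using dist_triangle[of z y "(1 - \<theta>) *\<^sub>R z + \<theta> *\<^sub>R a"] by simp
qed

text \<open>
  A one-sided Lebesgue density theorem along the sets \<open>shrink a r z (\<kappa>^k)\<close>. For an open \<open>U \<supseteq> A\<close>, Vitali's
  theorem covers almost all of the set in question by disjoint sets of this form inside \<open>U\<close>. Each of
  them has at least the proportion \<open>\<eta>\<close> of its measure in \<open>U - A\<close>, so together they have measure at
  most \<open>|U - A| / \<eta>\<close>, and \<open>|U - A|\<close> can be made arbitrarily small.
\<close>

lemma negligible_if_everywhere_thin:
  fixes A :: "'a::euclidean_space set"
  assumes A: "A \<in> sets borel" and AB: "A \<subseteq> ball a r" and \<kappa>: "0 < \<kappa>" "\<kappa> < 1" and \<eta>: "0 < \<eta>"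
  shows "negligible {z \<in> A. \<forall>k::nat. \<eta> * measure lborel (shrink a r z (\<kappa>^k)) \<le> measure lborel (shrink a r z (\<kappa>^k) - A)}"
    (is "negligible ?N")
proof (cases "r > 0")
  case False
  then have "ball a r = {}" by simp
  then have "?N = {}" using AB by blast
  then show ?thesis by (simp only: negligible_empty)
next
  case r: True
  define N where "N = ?N"
  have NA: "N \<subseteq> A" unfolding N_def by blast
  have Nle: "\<forall>k. \<eta> * measure lborel (shrink a r z (\<kappa>^k)) \<le> measure lborel (shrink a r z (\<kappa>^k) - A)" if "z \<in> N" for z
    using that unfolding N_def by blast
  have "negligible N"
  proof (subst negligible_outer_le, intro allI impI)
    fix e :: real assume e: "e > 0"
    have "\<eta> * e > 0" using \<eta> e by simp
    from outer_regular_lborel[OF A this] obtain U where U: "open U" "A \<subseteq> U" "emeasure lborel (U - A) < ennreal (\<eta> * e)"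
      by blast
    define K where "K = {(z, k::nat). z \<in> N \<and> shrink a r z (\<kappa>^k) \<subseteq> U}"
    define ce where "ce = (\<lambda>(z, k::nat). (1 - \<kappa>^k) *\<^sub>R z + (\<kappa>^k) *\<^sub>R a)"
    define ra where "ra = (\<lambda>(z::'a, k::nat). \<kappa>^k * r)"
    have sh: "ball (ce i) (ra i) = shrink a r (fst i) (\<kappa>^snd i)" for i
      by (cases i) (simp add: ce_def ra_def shrink_def)
    have V: "\<exists>i. i \<in> K \<and> x \<in> ball (ce i) (ra i) \<and> ra i < d" if x: "x \<in> N" "0 < d" for x d
    proof -
      obtain \<rho> where \<rho>: "\<rho> > 0" "ball x \<rho> \<subseteq> U"
        using U NA x by (meson openE subsetD)
      have xb: "x \<in> ball a r" using x AB NA by auto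
      have "(\<lambda>k. 2 * \<kappa>^k * r) \<longlonglongrightarrow> 2 * 0 * r"
        using \<kappa> by (intro tendsto_intros LIMSEQ_power_zero) auto
      then have "eventually (\<lambda>k. 2 * \<kappa>^k * r < min \<rho> d) sequentially"
        using \<rho> x by (intro order_tendstoD) auto
      then obtain k where k: "2 * \<kappa>^k * r < min \<rho> d" by (auto simp: eventually_sequentially)
      have "shrink a r x (\<kappa>^k) \<subseteq> U"
      proof -
        have "shrink a r x (\<kappa>^k) \<subseteq> ball x (2 * \<kappa>^k * r)"
          using shrink_subset_ball[OF xb] \<kappa> by simp
        also have "\<dots> \<subseteq> ball x \<rho>"
          using k by (intro subset_ball) simp
        finally show ?thesis using \<rho> by blast
      qed
      then have "(x,k) \<in> K" using x by (simp add: K_def)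
      moreover have "x \<in> ball (ce (x,k)) (ra (x,k))"
        unfolding sh using mem_shrink[OF xb] \<kappa> by simp
      moreover have "ra (x,k) < d"
      proof -
        have "0 < \<kappa>^k * r" using \<kappa> r by simp
        then show ?thesis using k by (simp add: ra_def)
      qed
      ultimately show ?thesis by blast
    qed
    obtain C where C: "countable C" "C \<subseteq> K"
       "pairwise (\<lambda>i j. disjnt (ball (ce i) (ra i)) (ball (ce j) (ra j))) C"
       "negligible (N - (\<Union>i \<in> C. ball (ce i) (ra i)))"
      by (rule Vitali_covering_theorem_balls[of N K ce ra, OF V]) (assumption | rule that)+
    let ?B = "\<lambda>i. ball (ce i) (ra i)"
    have disj: "disjoint_family_on ?B C"
      using C(3) by (auto simp: disjoint_family_on_def pairwise_def disjnt_def)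
    have Bm: "?B i \<in> sets lborel" for i by simp
    have fin: "emeasure lborel X = ennreal (measure lborel X)" if "X \<subseteq> ?B i" for X i
      using emeasure_mono[OF that Bm] emeasure_lborel_ball_finite[of "ce i" "ra i"]
      by (intro emeasure_eq_ennreal_measure) (auto simp: top_unique)
    define T where "T = (\<Union>i\<in>C. ?B i)"
    have "emeasure lborel T = (\<integral>\<^sup>+i. emeasure lborel (?B i) \<partial>count_space C)"
      unfolding T_def by (rule emeasure_UN_countable[OF Bm C(1) disj])
    also have "\<dots> \<le> (\<integral>\<^sup>+i. ennreal (1 / \<eta>) * emeasure lborel (?B i - A) \<partial>count_space C)"
    proof (rule nn_integral_mono)
      fix i assume "i \<in> space (count_space C)"
      then have "fst i \<in> N" using C(2) by (auto simp: K_def)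
      from Nle[OF this] have "\<eta> * measure lborel (?B i) \<le> measure lborel (?B i - A)" unfolding sh by blast
      then have "measure lborel (?B i) \<le> 1 / \<eta> * measure lborel (?B i - A)" using \<eta> by (simp add: field_simps)
      then have "ennreal (measure lborel (?B i)) \<le> ennreal (1 / \<eta>) * ennreal (measure lborel (?B i - A))"
        using \<eta> by (simp add: ennreal_mult[symmetric] ennreal_leI)
      then show "emeasure lborel (?B i) \<le> ennreal (1 / \<eta>) * emeasure lborel (?B i - A)"
        by (simp only: fin[OF order_refl] fin[OF Diff_subset])
    qed
    also have "\<dots> = ennreal (1 / \<eta>) * (\<integral>\<^sup>+i. emeasure lborel (?B i - A) \<partial>count_space C)"
      by (simp add: nn_integral_cmult)
    also have "(\<integral>\<^sup>+i. emeasure lborel (?B i - A) \<partial>count_space C) = emeasure lborel (\<Union>i\<in>C. ?B i - A)"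
    proof (rule emeasure_UN_countable[symmetric, OF _ C(1)])
      show "disjoint_family_on (\<lambda>i. ?B i - A) C" using disj unfolding disjoint_family_on_def by blast
    qed (use A in simp)
    also have "\<dots> \<le> emeasure lborel (U - A)"
    proof (rule emeasure_mono)
      show "(\<Union>i\<in>C. ?B i - A) \<subseteq> U - A" using C(2) unfolding sh by (fastforce simp: K_def)
    qed (use U A in simp)
    also have "\<dots> \<le> ennreal (\<eta> * e)" using U by simp
    also have "ennreal (1 / \<eta>) * ennreal (\<eta> * e) = ennreal e"
      using \<eta> by (simp add: ennreal_mult'[symmetric])
    finally have Te: "emeasure lborel T \<le> ennreal e" by (simp add: mult_left_mono)
    have Tm: "T \<in> sets lborel" unfolding T_def by (simp add: open_UN)
    have T: "T \<in> lmeasurable" "measure lebesgue T \<le> e"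
    proof -
      show "T \<in> lmeasurable" using Tm Te by (intro fmeasurableI) (auto simp: less_top[symmetric] top_unique)
      show "measure lebesgue T \<le> e"
        using Tm Te e by (simp add: measure_def enn2real_leI)
    qed
    have Z: "N - T \<in> lmeasurable" "measure lebesgue (N - T) = 0"
      using C(4) unfolding T_def by (rule negligible_imp_measurable, rule negligible_imp_measure0)
    have "measure lebesgue (T \<union> (N - T)) \<le> e"
      using measure_Un_le[of T lebesgue "N - T"] T Z by (simp add: fmeasurableD)
    then show "\<exists>W. N \<subseteq> W \<and> W \<in> lmeasurable \<and> measure lebesgue W \<le> e"
      using fmeasurable.Un[OF T(1) Z(1)] by (intro exI[of _ "T \<union> (N - T)"]) blast
  qed
  then show ?thesis by (simp only: N_def)
qed

section \<open>The isoperimetric inequality\<close>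

lemma measure_ball_split:
  assumes "A \<in> sets borel"
  shows "measure lborel (ball c \<rho>) = measure lborel (A \<inter> ball c \<rho>) + measure lborel (ball c \<rho> - A)"
proof -
  have "emeasure lborel X \<noteq> \<infinity>" if "X \<subseteq> ball c \<rho>" for X
    using emeasure_mono[OF that, of lborel] emeasure_lborel_ball_finite[of c \<rho>] by (auto simp: top_unique)
  moreover have "ball c \<rho> = (A \<inter> ball c \<rho>) \<union> (ball c \<rho> - A)" by auto
  ultimately show ?thesis
    using measure_Union[of lborel "A \<inter> ball c \<rho>" "ball c \<rho> - A"] assms by fastforce
qed

text \<open>
  At some scale \<open>A\<close> nearly fills the ball \<open>shrink a r z (\<kappa>^k)\<close>, but it does not fill the whole ball.
  At the last scale before \<open>A\<close> occupies more than \<open>1 - \<eta>\<close>, its proportion is still not much smaller,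
  because the volume changes only by the factor \<open>\<kappa> ^ d\<close> from one scale to the next.
\<close>

lemma balanced_subball:
  fixes A :: "'a::euclidean_space set"
  assumes A: "A \<in> sets borel" and AB: "A \<subseteq> ball a r"
    and half: "2 * measure lborel A \<le> measure lborel (ball a r)"
    and \<eta>: "0 < \<eta>" "\<eta> < 1/2"
  obtains N where "N \<in> null_sets lborel"
    "\<And>z. z \<in> A - N \<Longrightarrow> \<exists>c \<rho>. 0 < \<rho> \<and> \<rho> \<le> r \<and> z \<in> ball c \<rho> \<and> ball c \<rho> \<subseteq> ball a r \<and>
       \<eta> * measure lborel (ball c \<rho>) \<le> measure lborel (ball c \<rho> - A) \<and>
       measure lborel (ball c \<rho> - A) \<le> 2 * \<eta> * measure lborel (ball c \<rho>)"
proof -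
  \<comment> \<open>The ratio for which one step loses exactly \<open>\<eta>\<close>: \<open>(1 - \<eta>) * \<kappa> ^ d = 1 - 2 * \<eta>\<close>.\<close>
  define \<kappa> where "\<kappa> = root DIM('a) ((1 - 2 * \<eta>) / (1 - \<eta>))"
  have q: "0 < (1 - 2 * \<eta>) / (1 - \<eta>)" "(1 - 2 * \<eta>) / (1 - \<eta>) < 1"
    using \<eta> by (auto simp: field_simps)
  have \<kappa>: "0 < \<kappa>" "\<kappa> < 1" "(1 - \<eta>) * \<kappa> ^ DIM('a) = 1 - 2 * \<eta>"
    unfolding \<kappa>_def using q \<eta> by (auto simp: real_root_pow_pos2 real_root_lt_1_iff)
  define S where "S = (\<lambda>z k. shrink a r z (\<kappa>^k))"
  have "negligible {z \<in> A. \<forall>k::nat. \<eta> * measure lborel (S z k) \<le> measure lborel (S z k - A)}"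
    unfolding S_def using \<eta> by (intro negligible_if_everywhere_thin A AB \<kappa>) auto
  then obtain N where N: "N \<in> null_sets lborel"
    and thin: "{z \<in> A. \<forall>k::nat. \<eta> * measure lborel (S z k) \<le> measure lborel (S z k - A)} \<subseteq> N"
    unfolding negligible_iff_null_sets null_sets_completion_iff2 by blast
  show thesis
  proof (rule that[OF N])
    fix z assume z: "z \<in> A - N"
    then have zb: "z \<in> ball a r" using AB by auto
    then have r: "r > 0" by (smt (verit) mem_ball zero_le_dist)
    have Sb: "\<exists>c. S z k = ball c (\<kappa>^k * r)" for k
      by (auto simp: S_def shrink_def)
    have Sm: "measure lborel (S z k) = unit_ball_vol DIM('a) * (\<kappa>^k * r) ^ DIM('a)" for k
      using Sb[of k] r \<kappa> by (auto simp: content_ball)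
    have split: "measure lborel (S z k) = measure lborel (A \<inter> S z k) + measure lborel (S z k - A)" for k
      using Sb[of k] measure_ball_split[OF A] by metis
    define P where "P = (\<lambda>k. measure lborel (S z k - A) < \<eta> * measure lborel (S z k))"
    have "\<not> (\<forall>k. \<eta> * measure lborel (S z k) \<le> measure lborel (S z k - A))" using z thin by blast
    then have "\<exists>k. P k" by (simp add: P_def not_le)
    then have Pk: "P (LEAST k. P k)" by (rule LeastI_ex)
    have "\<not> P 0"
    proof -
      have "A \<inter> S z 0 = A" using AB by (auto simp: S_def)
      then have "(1/2) * measure lborel (S z 0) \<le> measure lborel (S z 0 - A)"
        using half split[of 0] by (simp add: S_def)
      moreover have "\<eta> * measure lborel (S z 0) \<le> (1/2) * measure lborel (S z 0)"
        using \<eta> by (intro mult_right_mono) auto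
      ultimately show ?thesis by (simp add: P_def)
    qed
    with Pk obtain j where j: "(LEAST k. P k) = Suc j"
      by (metis not0_implies_Suc)
    have Pj: "\<not> P j" using not_less_Least[of j P] j by simp
    obtain c where c: "S z j = ball c (\<kappa>^j * r)" using Sb by blast
    have "measure lborel (S z (Suc j)) = \<kappa> ^ DIM('a) * measure lborel (S z j)"
      unfolding Sm by (simp add: power_mult_distrib)
    then have "(1 - 2 * \<eta>) * measure lborel (S z j) = (1 - \<eta>) * measure lborel (S z (Suc j))"
      using \<kappa>(3) by (metis mult.assoc)
    also have "\<dots> \<le> measure lborel (A \<inter> S z (Suc j))"
      using Pk split[of "Suc j"] unfolding j by (simp add: P_def algebra_simps)
    also have "\<dots> \<le> measure lborel (A \<inter> S z j)"
    proof (rule measure_mono_fmeasurable)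
      have "S z (Suc j) \<subseteq> S z j"
        unfolding S_def using \<kappa> by (intro shrink_mono[OF zb] power_decreasing) auto
      then show "A \<inter> S z (Suc j) \<subseteq> A \<inter> S z j" by blast
      show "A \<inter> S z (Suc j) \<in> sets lborel" using A Sb[of "Suc j"] by auto
      have "S z j \<in> fmeasurable lborel"
        unfolding c using emeasure_lborel_ball_finite by (intro fmeasurableI) auto
      from fmeasurable_Int_fmeasurable[OF this, of A] show "A \<inter> S z j \<in> fmeasurable lborel"
        using A by (simp only: Int_commute sets_lborel)
    qed
    finally have "measure lborel (S z j - A) \<le> 2 * \<eta> * measure lborel (S z j)"
      using split[of j] by (simp add: algebra_simps)
    moreover have "\<eta> * measure lborel (S z j) \<le> measure lborel (S z j - A)"
      using Pj by (simp add: P_def)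
    moreover have "0 < \<kappa>^j * r" "\<kappa>^j * r \<le> r"
      using \<kappa> r by (auto simp: mult_le_cancel_right1 power_le_one)
    moreover have "z \<in> S z j" "S z j \<subseteq> ball a r"
      unfolding S_def using \<kappa> by (intro mem_shrink[OF zb] shrink_subset[OF zb] power_le_one; simp)+
    ultimately show "\<exists>c \<rho>. 0 < \<rho> \<and> \<rho> \<le> r \<and> z \<in> ball c \<rho> \<and> ball c \<rho> \<subseteq> ball a r \<and>
       \<eta> * measure lborel (ball c \<rho>) \<le> measure lborel (ball c \<rho> - A) \<and>
       measure lborel (ball c \<rho> - A) \<le> 2 * \<eta> * measure lborel (ball c \<rho>)"
      unfolding c by blast
  qed
qed

lemma emeasure_UN_le_count_space:
  assumes "countable I" and X: "\<And>i. i \<in> I \<Longrightarrow> X i \<in> sets M"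
  shows "emeasure M (\<Union>i\<in>I. X i) \<le> (\<integral>\<^sup>+i. emeasure M (X i) \<partial>count_space I)"
proof -
  have "(\<Union>i\<in>I. X i) \<in> sets M" using assms by auto
  then have "emeasure M (\<Union>i\<in>I. X i) = (\<integral>\<^sup>+x. indicator (\<Union>i\<in>I. X i) x \<partial>M)"
    by simp
  also have "\<dots> \<le> (\<integral>\<^sup>+x. \<integral>\<^sup>+i. indicator (X i) x \<partial>count_space I \<partial>M)"
  proof (intro nn_integral_mono)
    fix x
    show "indicator (\<Union>i\<in>I. X i) x \<le> (\<integral>\<^sup>+i. indicator (X i) x \<partial>count_space I :: ennreal)"
    proof (cases "x \<in> (\<Union>i\<in>I. X i)")
      case True
      then obtain j where j: "j \<in> I" "x \<in> X j" by blast
      have "(1::ennreal) = (\<integral>\<^sup>+i. indicator {j} i \<partial>count_space I)"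
        using j by simp
      also have "\<dots> \<le> (\<integral>\<^sup>+i. indicator (X i) x \<partial>count_space I)"
        using j by (intro nn_integral_mono) (auto simp: indicator_def)
      finally show ?thesis using True by simp
    qed simp
  qed
  also have "\<dots> = (\<integral>\<^sup>+i. \<integral>\<^sup>+x. indicator (X i) x \<partial>M \<partial>count_space I)"
    using assms by (intro nn_integral_count_space_nn_integral) auto
  also have "\<dots> = (\<integral>\<^sup>+i. emeasure M (X i) \<partial>count_space I)"
    using X by (intro nn_integral_cong) auto
  finally show ?thesis .
qed

text \<open>
  The density hypothesis on the kernel in terms of the set of pairs where the kernel is large.
\<close>

definition thick :: "real \<Rightarrow> ('a::euclidean_space \<times> 'a) set \<Rightarrow> bool" where
  "thick \<mu> E \<longleftrightarrow> (\<forall>a r x. x \<in> ball a r \<longrightarrow>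
     \<mu> * measure lborel (ball a r) \<le> measure lborel {z \<in> ball a r. (x, z) \<in> E})"

lemma sets_slice:
  assumes "E \<in> sets (borel :: ('a::euclidean_space \<times> 'a) measure)"
  shows "{z. (x, z) \<in> E} \<in> sets borel"
proof -
  have "Pair x -` E \<inter> space borel \<in> sets borel"
    by (rule measurable_sets[OF borel_measurable_continuous_onI assms]) (intro continuous_intros)
  then show ?thesis by (simp add: vimage_def)
qed

text \<open>
  For a ball \<open>D\<close> from lemma \<open>balanced_subball\<close> with \<open>\<eta> = \<mu> / 4\<close>, a point of \<open>D - A\<close> has \<open>E\<close>-neighbours
  in \<open>D\<close> of measure at least \<open>\<mu> * |D|\<close>, and at most \<open>\<mu> / 2 * |D|\<close> of them lie outside \<open>A\<close>. As the
  weight is at least \<open>(2 * \<rho>) powr (- d)\<close> on a ball of radius \<open>\<rho>\<close>, every point of \<open>D - A\<close>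
  contributes at least the absolute constant \<open>q\<close>. The points of \<open>A' - A\<close> are discarded and reappear
  as the error term.
\<close>

lemma isoperimetric:
  fixes E :: "('a::euclidean_space \<times> 'a) set" and \<mu> :: real
  defines "q \<equiv> unit_ball_vol DIM('a) * \<mu> / (2 * 2 ^ DIM('a))"
  assumes E: "E \<in> sets borel" "thick \<mu> E" and \<mu>: "0 < \<mu>" "\<mu> < 1"
    and A: "A \<in> sets borel" and A': "A' \<in> sets borel" "A \<subseteq> A'" "A' \<subseteq> ball a r"
    and half: "2 * measure lborel A \<le> measure lborel (ball a r)"
  shows "emeasure lborel A \<le> ennreal (4 * 5 ^ DIM('a) / \<mu>) * (ennreal (1 / q) *
     (\<integral>\<^sup>+x. \<integral>\<^sup>+y. indicator (ball a r - A') x * indicator A y * indicator E (x, y) *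
        ennreal (norm (x - y) powr - real DIM('a)) \<partial>lborel \<partial>lborel) + emeasure lborel (A' - A))"
proof -
  define d where "d = DIM('a)"
  define V where "V = unit_ball_vol DIM('a)"
  have V: "V > 0" by (simp add: V_def)
  have q: "q > 0" using \<mu> V by (simp add: q_def V_def)
  have fin: "emeasure lborel (X :: 'a set) = ennreal (measure lborel X)" if "X \<subseteq> ball c \<rho>" for X c \<rho>
  proof -
    have "emeasure lborel X < \<infinity>"
      using emeasure_mono[OF that, of lborel] emeasure_lborel_ball_finite[of c \<rho>]
      by (metis borel_open infinity_ennreal_def open_ball order_le_less_trans sets_lborel)
    then show ?thesis by (simp add: emeasure_eq_ennreal_measure)
  qed
  have vol: "measure lborel (ball c \<rho> :: 'a set) = V * \<rho> ^ d" if "\<rho> \<ge> 0" for c \<rho>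
    using that by (simp add: content_ball V_def d_def)
  define \<eta> where "\<eta> = \<mu> / 4"
  have \<eta>: "0 < \<eta>" "\<eta> < 1/2" using \<mu> by (auto simp: \<eta>_def)
  define good where "good = (\<lambda>(c::'a, \<rho>::real). 0 < \<rho> \<and> \<rho> \<le> r \<and> ball c \<rho> \<subseteq> ball a r \<and>
       \<eta> * measure lborel (ball c \<rho>) \<le> measure lborel (ball c \<rho> - A) \<and>
       measure lborel (ball c \<rho> - A) \<le> 2 * \<eta> * measure lborel (ball c \<rho>))"
  have AB: "A \<subseteq> ball a r" using A' by simp
  obtain N where N: "N \<in> null_sets lborel"
    and N': "\<And>z. z \<in> A - N \<Longrightarrow> \<exists>c \<rho>. 0 < \<rho> \<and> \<rho> \<le> r \<and> z \<in> ball c \<rho> \<and> ball c \<rho> \<subseteq> ball a r \<and>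
       \<eta> * measure lborel (ball c \<rho>) \<le> measure lborel (ball c \<rho> - A) \<and>
       measure lborel (ball c \<rho> - A) \<le> 2 * \<eta> * measure lborel (ball c \<rho>)"
    by (rule balanced_subball[OF A AB half \<eta>]) (rule that)
  have Ngood: "\<exists>i. good i \<and> z \<in> ball (fst i) (snd i)" if z: "z \<in> A - N" for z
  proof -
    from N'[OF z] obtain c \<rho> where "good (c, \<rho>)" "z \<in> ball c \<rho>"
      unfolding good_def split by blast
    then show ?thesis by (intro exI[of _ "(c, \<rho>)"]) simp
  qed
  define B where "B = (\<lambda>i::'a\<times>real. ball (fst i) (snd i))"
  obtain C where C: "countable C" "C \<subseteq> {i. good i}"
     "pairwise (\<lambda>i j. disjnt (ball (fst i) (snd i)) (ball (fst j) (snd j))) C"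
     "A - N \<subseteq> (\<Union>i\<in>C. ball (fst i) (5 * snd i))"
  proof (rule Vitali_covering_lemma_balls[where S = "A - N" and K = "{i. good i}" and a = fst and r = snd and B = r])
    show "A - N \<subseteq> (\<Union>i\<in>{i. good i}. ball (fst i) (snd i))"
      using Ngood by blast
    show "0 < snd i \<and> snd i \<le> r" if "i \<in> {i. good i}" for i
      using that by (cases i) (simp add: good_def)
  qed (rule that)
  have disj: "disjoint_family_on B C"
    using C(3) unfolding disjoint_family_on_def pairwise_def disjnt_def B_def by blast
  have goodC: "0 < snd i" "B i \<subseteq> ball a r" "\<eta> * measure lborel (B i) \<le> measure lborel (B i - A)"
     "measure lborel (B i - A) \<le> 2 * \<eta> * measure lborel (B i)" if "i \<in> C" for i
  proof -
    have "good (fst i, snd i)" using C(2) that by auto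
    then show "0 < snd i" "B i \<subseteq> ball a r" "\<eta> * measure lborel (B i) \<le> measure lborel (B i - A)"
      "measure lborel (B i - A) \<le> 2 * \<eta> * measure lborel (B i)"
      unfolding good_def split B_def by blast+
  qed
  have Bm [measurable]: "B i \<in> sets borel" for i by (simp add: B_def)
  define k where "k = (\<lambda>x y. indicator A y * indicator E (x, y) *
        ennreal (norm (x - y) powr - real DIM('a)))"
  define g where "g = (\<lambda>x. \<integral>\<^sup>+y. k x y \<partial>lborel)"
  have gm [measurable]: "g \<in> borel_measurable borel"
  proof -
    have [measurable]: "E \<in> sets (borel \<Otimes>\<^sub>M borel)" using E(1) unfolding borel_prod .
    have "(\<lambda>p. k (fst p) (snd p)) \<in> borel_measurable (borel \<Otimes>\<^sub>M lborel)"
      unfolding k_def using A by measurable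
    from lborel.borel_measurable_nn_integral_fst[OF this] show ?thesis
      by (simp add: g_def)
  qed
  have gq: "ennreal q \<le> g x" if i: "i \<in> C" and x: "x \<in> B i - A" for i x
  proof -
    define \<rho> where "\<rho> = snd i"
    have \<rho>: "\<rho> > 0" using goodC(1)[OF i] by (simp add: \<rho>_def)
    define T where "T = A \<inter> {z \<in> B i. (x, z) \<in> E}"
    have slice: "{z \<in> B i. (x, z) \<in> E} \<in> sets borel"
      using sets.Int[OF Bm sets_slice[OF E(1)], of i x] by (simp add: Int_def)
    have Tm: "T \<in> sets borel" unfolding T_def using slice A by blast
    have "\<mu> * measure lborel (B i) \<le> measure lborel {z \<in> B i. (x, z) \<in> E}"
      using E(2) x unfolding thick_def B_def by blast
    also have "\<dots> \<le> measure lborel (T \<union> (B i - A))"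
    proof (rule measure_mono_fmeasurable)
      show "T \<union> (B i - A) \<in> fmeasurable lborel"
      proof (rule fmeasurableI)
        have "T \<union> (B i - A) \<subseteq> ball (fst i) (snd i)" by (auto simp: T_def B_def)
        from fin[OF this] show "emeasure lborel (T \<union> (B i - A)) < \<infinity>" by simp
      qed (use Tm A in auto)
    qed (use slice in \<open>auto simp: T_def\<close>)
    also have "\<dots> \<le> measure lborel T + measure lborel (B i - A)"
      by (intro measure_Un_le) (use Tm A in auto)
    also have "\<dots> \<le> measure lborel T + 2 * \<eta> * measure lborel (B i)"
      using goodC(4)[OF i] by simp
    finally have mT: "(\<mu> / 2) * (V * \<rho> ^ d) \<le> measure lborel T"
      using \<rho> vol[of \<rho> "fst i"] by (simp add: \<eta>_def B_def \<rho>_def algebra_simps)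
    have "ennreal q = ennreal ((2 * \<rho>) powr - real d * ((\<mu> / 2) * (V * \<rho> ^ d)))"
      using \<rho> by (simp add: q_def V_def d_def powr_minus powr_realpow field_simps)
    also have "\<dots> \<le> ennreal ((2 * \<rho>) powr - real d * measure lborel T)"
      using mT by (intro ennreal_leI mult_left_mono) auto
    also have "\<dots> = ennreal ((2 * \<rho>) powr - real d) * emeasure lborel T"
    proof -
      have "T \<subseteq> ball (fst i) (snd i)" by (auto simp: T_def B_def)
      from fin[OF this] show ?thesis by (simp add: ennreal_mult)
    qed
    also have "\<dots> = (\<integral>\<^sup>+y. ennreal ((2 * \<rho>) powr - real d) * indicator T y \<partial>lborel)"
      using Tm by (simp add: nn_integral_cmult)
    also have "\<dots> \<le> g x"
      unfolding g_def
    proof (intro nn_integral_mono)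
      fix y
      show "ennreal ((2 * \<rho>) powr - real d) * indicator T y \<le> k x y"
      proof (cases "y \<in> T")
        case True
        then have "y \<in> B i" "y \<in> A" "(x, y) \<in> E" by (auto simp: T_def)
        \<comment> \<open>The weight vanishes on the diagonal, as \<open>0 powr _ = 0\<close>, so the points must be distinct.\<close>
        have "x \<noteq> y" using x \<open>y \<in> A\<close> by auto
        have "norm (x - y) < 2 * \<rho>"
          using x \<open>y \<in> B i\<close> dist_triangle[of x y "fst i"]
          by (auto simp: B_def \<rho>_def dist_norm norm_minus_commute)
        then have "(2 * \<rho>) powr - real d \<le> norm (x - y) powr - real d"
          using \<open>x \<noteq> y\<close> by (intro powr_mono2') auto
        then show ?thesis
          using True \<open>y \<in> A\<close> \<open>(x, y) \<in> E\<close> by (simp add: k_def d_def ennreal_leI)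
      qed simp
    qed
    finally show ?thesis .
  qed
  define P where "P = (\<integral>\<^sup>+x. indicator (ball a r - A') x * g x \<partial>lborel)"
  have mB: "emeasure lborel (B i) \<le> ennreal (1 / \<eta>) *
      (ennreal (1 / q) * (\<integral>\<^sup>+x. g x * indicator (B i - A') x \<partial>lborel) + emeasure lborel (B i \<inter> (A' - A)))"
    if i: "i \<in> C" for i
  proof -
    have "emeasure lborel (B i) = ennreal (1 / \<eta> * (\<eta> * measure lborel (B i)))"
      using \<eta> fin[of "B i" "fst i" "snd i"] by (simp add: B_def)
    also have "\<dots> \<le> ennreal (1 / \<eta> * measure lborel (B i - A))"
      using goodC(3)[OF i] \<eta> by (intro ennreal_leI mult_left_mono) auto
    also have "\<dots> = ennreal (1 / \<eta>) * emeasure lborel (B i - A)"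
      using \<eta> fin[of "B i - A" "fst i" "snd i"] by (subst ennreal_mult) (auto simp: B_def)
    also have "B i - A = (B i - A') \<union> (B i \<inter> (A' - A))" using A' by auto
    also have "emeasure lborel \<dots> \<le> emeasure lborel (B i - A') + emeasure lborel (B i \<inter> (A' - A))"
      using A A' Bm by (intro emeasure_subadditive) auto
    also have "emeasure lborel (B i - A') = ennreal (1 / q) * (ennreal q * emeasure lborel (B i - A'))"
      using q by (simp add: mult.assoc[symmetric] ennreal_mult[symmetric])
    also have "ennreal q * emeasure lborel (B i - A') = (\<integral>\<^sup>+x. ennreal q * indicator (B i - A') x \<partial>lborel)"
      using A' Bm by (simp add: nn_integral_cmult)
    also have "\<dots> \<le> (\<integral>\<^sup>+x. g x * indicator (B i - A') x \<partial>lborel)"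
      using gq[OF i] A' by (intro nn_integral_mono) (auto simp: indicator_def)
    finally show ?thesis by (simp add: mult_left_mono add_right_mono)
  qed
  have "emeasure lborel A = emeasure lborel (A - N)"
    using N A by (simp add: emeasure_Diff_null_set)
  also have "\<dots> \<le> emeasure lborel (\<Union>i\<in>C. ball (fst i) (5 * snd i))"
  proof (rule emeasure_mono[OF C(4)])
    have "(\<Union>i\<in>C. ball (fst i) (5 * snd i)) \<in> sets borel" by (intro borel_open) auto
    then show "(\<Union>i\<in>C. ball (fst i) (5 * snd i)) \<in> sets lborel" by simp
  qed
  also have "\<dots> \<le> (\<integral>\<^sup>+i. emeasure lborel (ball (fst i) (5 * snd i)) \<partial>count_space C)"
    by (intro emeasure_UN_le_count_space C) auto
  also have "\<dots> = (\<integral>\<^sup>+i. ennreal (5 ^ d) * emeasure lborel (B i) \<partial>count_space C)"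
  proof (intro nn_integral_cong)
    fix i assume "i \<in> space (count_space C)"
    then have "0 < snd i" using goodC by simp
    then show "emeasure lborel (ball (fst i) (5 * snd i)) = ennreal (5 ^ d) * emeasure lborel (B i)"
      by (simp add: B_def emeasure_ball d_def power_mult_distrib ennreal_mult[symmetric] mult_ac)
  qed
  also have "\<dots> = ennreal (5 ^ d) * (\<integral>\<^sup>+i. emeasure lborel (B i) \<partial>count_space C)"
    by (simp add: nn_integral_cmult)
  also have "\<dots> \<le> ennreal (5 ^ d) * (\<integral>\<^sup>+i. ennreal (1 / \<eta>) *
      (ennreal (1 / q) * (\<integral>\<^sup>+x. g x * indicator (B i - A') x \<partial>lborel) + emeasure lborel (B i \<inter> (A' - A))) \<partial>count_space C)"
    using mB by (intro mult_left_mono nn_integral_mono) auto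
  also have "\<dots> = ennreal (5 ^ d) * (ennreal (1 / \<eta>) *
      (ennreal (1 / q) * (\<integral>\<^sup>+i. \<integral>\<^sup>+x. g x * indicator (B i - A') x \<partial>lborel \<partial>count_space C)
       + (\<integral>\<^sup>+i. emeasure lborel (B i \<inter> (A' - A)) \<partial>count_space C)))"
    by (simp add: nn_integral_cmult nn_integral_add)
  also have "(\<integral>\<^sup>+i. emeasure lborel (B i \<inter> (A' - A)) \<partial>count_space C) = emeasure lborel (\<Union>i\<in>C. B i \<inter> (A' - A))"
  proof (rule emeasure_UN_countable[symmetric, OF _ C(1)])
    show "disjoint_family_on (\<lambda>i. B i \<inter> (A' - A)) C"
      using disj unfolding disjoint_family_on_def by blast
  qed (use A A' Bm in auto)
  also have "\<dots> \<le> emeasure lborel (A' - A)"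
    using A A' by (intro emeasure_mono) auto
  also have "(\<integral>\<^sup>+i. \<integral>\<^sup>+x. g x * indicator (B i - A') x \<partial>lborel \<partial>count_space C) =
      (\<integral>\<^sup>+i. emeasure (density lborel g) (B i - A') \<partial>count_space C)"
    using A' Bm by (intro nn_integral_cong) (auto simp: emeasure_density)
  also have "\<dots> = emeasure (density lborel g) (\<Union>i\<in>C. B i - A')"
  proof (rule emeasure_UN_countable[symmetric, OF _ C(1)])
    show "disjoint_family_on (\<lambda>i. B i - A') C"
      using disj unfolding disjoint_family_on_def by blast
  qed (use A' Bm in auto)
  also have "\<dots> \<le> emeasure (density lborel g) (ball a r - A')"
  proof (rule emeasure_mono)
    show "(\<Union>i\<in>C. B i - A') \<subseteq> ball a r - A'" using goodC(2) by blast
  qed (use A' in auto)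
  also have "\<dots> = P"
    using A' by (simp add: emeasure_density P_def mult.commute)
  finally have "emeasure lborel A \<le> ennreal (5 ^ d) * (ennreal (1 / \<eta>) *
      (ennreal (1 / q) * P + emeasure lborel (A' - A)))"
    by (simp add: mult_left_mono add_right_mono add_left_mono)
  also have "\<dots> = ennreal (4 * 5 ^ d / \<mu>) * (ennreal (1 / q) * P + emeasure lborel (A' - A))"
    using \<mu> by (simp add: \<eta>_def mult.assoc[symmetric] ennreal_mult[symmetric] mult_ac)
  also have "P = (\<integral>\<^sup>+x. \<integral>\<^sup>+y. indicator (ball a r - A') x * indicator A y * indicator E (x, y) *
        ennreal (norm (x - y) powr - real DIM('a)) \<partial>lborel \<partial>lborel)"
    unfolding P_def g_def
  proof (intro nn_integral_cong)
    fix x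
    have km: "k x \<in> borel_measurable lborel"
    proof -
      have "indicator A y * indicator E (x, y) = (indicator (A \<inter> {z. (x, z) \<in> E}) y :: ennreal)" for y
        by (auto simp: indicator_def)
      then show ?thesis unfolding k_def using A sets_slice[OF E(1), of x] by simp
    qed
    show "indicator (ball a r - A') x * (\<integral>\<^sup>+y. k x y \<partial>lborel) =
      (\<integral>\<^sup>+y. indicator (ball a r - A') x * indicator A y * indicator E (x, y) *
        ennreal (norm (x - y) powr - real DIM('a)) \<partial>lborel)"
      by (subst nn_integral_cmult[symmetric, OF km]) (simp add: k_def mult.assoc)
  qed
  finally show ?thesis by (simp add: d_def)
qed

section \<open>From sets to functions\<close>

abbreviation lborel2 :: "('a::euclidean_space \<times> 'b::euclidean_space) measure" where
  "lborel2 \<equiv> lborel \<Otimes>\<^sub>M lborel"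

abbreviation borel2 :: "('a::euclidean_space \<times> 'b::euclidean_space) measure" where
  "borel2 \<equiv> borel \<Otimes>\<^sub>M borel"

lemma sigma_finite_lborel2: "sigma_finite_measure lborel2"
  unfolding lborel_prod by (rule sigma_finite_lborel)

lemma measurable_lborel2: "measurable lborel2 M = measurable borel2 M"
  by (intro measurable_cong_sets sets_pair_measure_cong) auto

lemma sets_Collect_UNIV:
  assumes "Measurable.pred M P" "space M = UNIV"
  shows "{p. P p} \<in> sets M"
  using assms by (simp add: pred_def)

text \<open>
  Tonelli's theorem in the form in which all superpositions over levels, centres and radii are
  computed below: \<open>Q\<close> records which \<open>x\<close> are counted at the parameter \<open>t\<close>.
\<close>

lemma weighted_tonelli:
  fixes w :: "'c::euclidean_space \<Rightarrow> ennreal" and h :: "'b \<Rightarrow> ennreal"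
  assumes sf: "sigma_finite_measure M"
    and [measurable]: "w \<in> borel_measurable borel" "h \<in> borel_measurable M" "Q \<in> sets (borel \<Otimes>\<^sub>M M)"
  shows "(\<lambda>t. \<integral>\<^sup>+x. h x * indicator Q (t, x) \<partial>M) \<in> borel_measurable borel"
    and "(\<lambda>x. \<integral>\<^sup>+t. w t * indicator Q (t, x) \<partial>lborel) \<in> borel_measurable M"
    and "(\<integral>\<^sup>+t. w t * (\<integral>\<^sup>+x. h x * indicator Q (t, x) \<partial>M) \<partial>lborel)
      = (\<integral>\<^sup>+x. h x * (\<integral>\<^sup>+t. w t * indicator Q (t, x) \<partial>lborel) \<partial>M)"
proof -
  interpret M: sigma_finite_measure M by (rule sf)
  interpret P: pair_sigma_finite lborel M ..
  have "Q \<in> sets (lborel \<Otimes>\<^sub>M M) \<longleftrightarrow> Q \<in> sets (borel \<Otimes>\<^sub>M M)"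
    by (intro arg_cong2[of _ _ _ _ "(\<in>)"] sets_pair_measure_cong refl) simp
  then have [measurable]: "Q \<in> sets (lborel \<Otimes>\<^sub>M M)" using assms(4) by simp
  have "(\<lambda>z. h (snd z) * indicator Q z) \<in> borel_measurable (borel \<Otimes>\<^sub>M M)" by measurable
  from M.borel_measurable_nn_integral_fst[OF this]
  show "(\<lambda>t. \<integral>\<^sup>+x. h x * indicator Q (t, x) \<partial>M) \<in> borel_measurable borel" by simp
  have "(\<lambda>z. w (snd z) * indicator Q (snd z, fst z)) \<in> borel_measurable (M \<Otimes>\<^sub>M lborel)" by measurable
  from lborel.borel_measurable_nn_integral_fst[OF this]
  show "(\<lambda>x. \<integral>\<^sup>+t. w t * indicator Q (t, x) \<partial>lborel) \<in> borel_measurable M" by simp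
  have "(\<integral>\<^sup>+t. w t * (\<integral>\<^sup>+x. h x * indicator Q (t, x) \<partial>M) \<partial>lborel)
      = (\<integral>\<^sup>+t. \<integral>\<^sup>+x. w t * (h x * indicator Q (t, x)) \<partial>M \<partial>lborel)"
    by (intro nn_integral_cong nn_integral_cmult[symmetric]) measurable
  also have "\<dots> = (\<integral>\<^sup>+x. \<integral>\<^sup>+t. h x * (w t * indicator Q (t, x)) \<partial>lborel \<partial>M)"
    by (subst P.Fubini'[symmetric]) (measurable, simp add: mult.left_commute)
  also have "\<dots> = (\<integral>\<^sup>+x. h x * (\<integral>\<^sup>+t. w t * indicator Q (t, x) \<partial>lborel) \<partial>M)"
    by (intro nn_integral_cong nn_integral_cmult) measurable
  finally show "(\<integral>\<^sup>+t. w t * (\<integral>\<^sup>+x. h x * indicator Q (t, x) \<partial>M) \<partial>lborel)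
      = (\<integral>\<^sup>+x. h x * (\<integral>\<^sup>+t. w t * indicator Q (t, x) \<partial>lborel) \<partial>M)" .
qed

text \<open>
  The same inequality with the iterated integral as an integral over pairs, to which Fubini's
  theorem with a further variable applies.
\<close>

lemma isoperimetric_pair:
  fixes E :: "('a::euclidean_space \<times> 'a) set" and \<mu> :: real
  defines "q \<equiv> unit_ball_vol DIM('a) * \<mu> / (2 * 2 ^ DIM('a))"
  assumes E[measurable]: "E \<in> sets borel2" and thick: "thick \<mu> E" and \<mu>: "0 < \<mu>" "\<mu> < 1"
    and A[measurable]: "A \<in> sets borel" and A'[measurable]: "A' \<in> sets borel" and sub: "A \<subseteq> A'" "A' \<subseteq> ball a r"
    and half: "2 * measure lborel A \<le> measure lborel (ball a r)"
  shows "emeasure lborel A \<le> ennreal (4 * 5 ^ DIM('a) / \<mu>) * (ennreal (1 / q) *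
     (\<integral>\<^sup>+p. indicator (ball a r - A') (fst p) * indicator A (snd p) * indicator E p *
        ennreal (norm (fst p - snd p) powr - real DIM('a)) \<partial>lborel2) + emeasure lborel (A' - A))"
proof -
  have "E \<in> sets borel" using E unfolding borel_prod .
  note isoperimetric[OF this thick \<mu> A A' sub half]
  also have "(\<integral>\<^sup>+x. \<integral>\<^sup>+y. indicator (ball a r - A') x * indicator A y * indicator E (x, y) *
        ennreal (norm (x - y) powr - real DIM('a)) \<partial>lborel \<partial>lborel) =
     (\<integral>\<^sup>+p. indicator (ball a r - A') (fst p) * indicator A (snd p) * indicator E p *
        ennreal (norm (fst p - snd p) powr - real DIM('a)) \<partial>lborel2)"
  proof -
    have [measurable]: "ball a r \<in> sets borel" by simp
    have "(\<lambda>p. indicator (ball a r - A') (fst p) * indicator A (snd p) * indicator E p *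
        ennreal (norm (fst p - snd p) powr - real DIM('a))) \<in> borel_measurable lborel2"
      unfolding measurable_lborel2 by measurable
    from lborel.nn_integral_fst[OF this] show ?thesis by simp
  qed
  finally show ?thesis unfolding q_def .
qed

text \<open>
  Here \<open>K\<close> and \<open>1 / q\<close> are the constants of the isoperimetric inequality, and \<open>\<theta>\<close> is chosen such that
  \<open>K * (1 / \<theta>\<^sup>2 - 1) = 1 / 2\<close>, which makes the error term half of the left hand side.
\<close>

definition poincare_const :: "nat \<Rightarrow> real \<Rightarrow> real" where
  "poincare_const d \<mu> = (let K = 4 * 5 ^ d / \<mu>; q = unit_ball_vol d * \<mu> / (2 * 2 ^ d);
     \<theta> = sqrt (2 * K / (2 * K + 1)) in 2 * K / (q * (1 - \<theta>)\<^sup>2))"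

text \<open>
  At a fixed scale the power \<open>2 * s\<close> is irrelevant, which is why the weight has the exponent \<open>- d\<close>; this
  also makes the estimates below independent of \<open>s\<close>.
\<close>

definition energy :: "('a::euclidean_space \<times> 'a) set \<Rightarrow> 'a set \<Rightarrow> ('a \<Rightarrow> real) \<Rightarrow> ennreal" where
  "energy E B u = (\<integral>\<^sup>+p. indicator (B \<times> B) p * indicator E p *
     ennreal ((u (fst p) - u (snd p))\<^sup>2 * norm (fst p - snd p) powr - real DIM('a)) \<partial>lborel2)"

lemma nn_integral_2t:
  assumes "0 \<le> a" "a \<le> (b::real)"
  shows "(\<integral>\<^sup>+t. ennreal (2 * t) * indicator {a..b} t \<partial>lborel) = ennreal (b\<^sup>2 - a\<^sup>2)"
  using assms by (intro nn_integral_FTC_Icc) (auto intro!: derivative_eq_intros)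

lemma nn_integral_2t_0:
  assumes "0 \<le> b"
  shows "(\<integral>\<^sup>+t. ennreal (2 * t) * indicator {..b} t \<partial>lborel) = ennreal (b\<^sup>2)"
proof -
  have "(\<integral>\<^sup>+t. ennreal (2 * t) * indicator {..b} t \<partial>lborel) = (\<integral>\<^sup>+t. ennreal (2 * t) * indicator {0..b} t \<partial>lborel)"
    by (intro nn_integral_cong) (auto simp: indicator_def ennreal_neg)
  then show ?thesis using nn_integral_2t[of 0 b] assms by simp
qed

lemma ennreal_absorb_half:
  assumes "X \<le> Y + ennreal (1/2) * X" "X < \<infinity>"
  shows "X \<le> 2 * Y"
proof (cases "Y = \<infinity>")
  case True then show ?thesis by (simp add: ennreal_mult_top)
next
  case False
  then obtain y where y: "Y = ennreal y" "y \<ge> 0" by (cases Y) auto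
  obtain x where x: "X = ennreal x" "x \<ge> 0" using assms(2) by (cases X) auto
  have "ennreal x \<le> ennreal (y + 1/2 * x)"
    using assms(1) unfolding x y by (metis ennreal_mult ennreal_plus x(2) y(2) mult_nonneg_nonneg zero_le_divide_1_iff zero_le_numeral)
  then have "x \<le> y + 1/2 * x" using x y by (subst (asm) ennreal_le_iff) auto
  then have "ennreal x \<le> ennreal (2 * y)" by (intro ennreal_leI) simp
  then show ?thesis unfolding x y using y by (simp add: ennreal_mult)
qed

text \<open>
  The isoperimetric inequality for the level sets \<open>{f \<ge> t} \<subseteq> {f \<ge> \<theta> * t}\<close>, integrated over \<open>t > 0\<close> against
  \<open>2 * t\<close>. By layer cake, the measure of \<open>{f \<ge> t}\<close> integrates to \<open>\<integral> f\<^sup>2\<close> and the error term to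
  \<open>(1 / \<theta>\<^sup>2 - 1) * \<integral> f\<^sup>2\<close>. A pair \<open>(x, y)\<close> is counted for \<open>f x / \<theta> < t \<le> f y\<close> only, hence at most
  \<open>(f y)\<^sup>2\<close> times, and only if \<open>f x < \<theta> * f y\<close>; in this case \<open>f y \<le> (f y - f x) / (1 - \<theta>)\<close>. Boundedness of
  \<open>f\<close> makes \<open>\<integral> f\<^sup>2\<close> finite, so that the error can be absorbed.
\<close>

lemma square_bound_bounded:
  fixes E :: "('a::euclidean_space \<times> 'a) set" and \<mu> :: real
  assumes E[measurable]: "E \<in> sets borel2" and thick: "thick \<mu> E" and \<mu>: "0 < \<mu>" "\<mu> < 1"
    and f[measurable]: "f \<in> borel_measurable borel" and f0: "\<And>x. 0 \<le> f x" and fM: "\<And>x. f x \<le> M"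
    and half: "\<And>t. 0 < t \<Longrightarrow> 2 * measure lborel {x \<in> ball a r. t \<le> f x} \<le> measure lborel (ball a r)"
  shows "(\<integral>\<^sup>+x. indicator (ball a r) x * ennreal ((f x)\<^sup>2) \<partial>lborel)
     \<le> ennreal (poincare_const DIM('a) \<mu>) * energy E (ball a r) f"
proof -
  define K where "K = 4 * 5 ^ DIM('a) / \<mu>"
  define q where "q = unit_ball_vol DIM('a) * \<mu> / (2 * 2 ^ DIM('a))"
  define \<theta> where "\<theta> = sqrt (2 * K / (2 * K + 1))"
  have K: "K > 0" and q: "q > 0" using \<mu> by (auto simp: K_def q_def)
  have \<theta>: "0 < \<theta>" "\<theta> < 1" "K * (1 / \<theta>\<^sup>2 - 1) = 1/2"
    using K by (auto simp: \<theta>_def field_simps real_sqrt_lt_1_iff)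
  let ?B = "ball a r"
  have [measurable]: "?B \<in> sets borel" by simp
  define X where "X = (\<integral>\<^sup>+x. indicator ?B x * ennreal ((f x)\<^sup>2) \<partial>lborel)"
  define QA where "QA = {z. fst z \<le> f (snd z)}"
  define QD where "QD = {z. \<theta> * fst z \<le> f (snd z) \<and> f (snd z) < fst z}"
  define QP where "QP = {z. f (fst (snd z)) < \<theta> * fst z \<and> fst z \<le> f (snd (snd z))}"
  have Q: "QA \<in> sets (borel \<Otimes>\<^sub>M borel)" "QD \<in> sets (borel \<Otimes>\<^sub>M borel)" "QP \<in> sets (borel \<Otimes>\<^sub>M borel2)"
    unfolding QA_def QD_def QP_def
    by (rule sets_Collect_UNIV, measurable, simp add: space_pair_measure)+
  have "sets (borel \<Otimes>\<^sub>M lborel) = sets (borel \<Otimes>\<^sub>M borel)" "sets (borel \<Otimes>\<^sub>M lborel2) = sets (borel \<Otimes>\<^sub>M borel2)"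
    by (intro sets_pair_measure_cong sets_lborel refl)+
  with Q have Q': "QA \<in> sets (borel \<Otimes>\<^sub>M lborel)" "QD \<in> sets (borel \<Otimes>\<^sub>M lborel)" "QP \<in> sets (borel \<Otimes>\<^sub>M lborel2)"
    by blast+
  define H where "H = (\<lambda>p. indicator (?B \<times> ?B) p * (indicator E p * ennreal (norm (fst p - snd p) powr - real DIM('a))))"
  have Hm: "H \<in> borel_measurable lborel2"
    unfolding H_def measurable_lborel2 indicator_times by measurable
  have iB: "indicator ?B \<in> borel_measurable lborel" by simp
  have m2t: "(\<lambda>t. ennreal (2 * t)) \<in> borel_measurable borel" by measurable
  let ?a = "\<lambda>t. \<integral>\<^sup>+x. indicator ?B x * indicator QA (t, x) \<partial>lborel"
  let ?D = "\<lambda>t. \<integral>\<^sup>+x. indicator ?B x * indicator QD (t, x) \<partial>lborel"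
  let ?P = "\<lambda>t. \<integral>\<^sup>+p. H p * indicator QP (t, p) \<partial>lborel2"
  note WA = weighted_tonelli[OF sigma_finite_lborel m2t iB Q'(1)]
  note WD = weighted_tonelli[OF sigma_finite_lborel m2t iB Q'(2)]
  note WP = weighted_tonelli[OF sigma_finite_lborel2 m2t Hm Q'(3)]
  have step: "ennreal (2 * t) * ?a t \<le> ennreal K * (ennreal (1 / q) * (ennreal (2 * t) * ?P t) + ennreal (2 * t) * ?D t)" for t
  proof (cases "t > 0")
    case True
    define A where "A = {x \<in> ?B. t \<le> f x}"
    define A' where "A' = {x \<in> ?B. \<theta> * t \<le> f x}"
    have Am: "A \<in> sets borel" "A' \<in> sets borel" unfolding A_def A'_def by measurable
    have "\<theta> * t \<le> t" using \<theta> True by simp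
    then have sub: "A \<subseteq> A'" "A' \<subseteq> ?B" by (auto simp: A_def A'_def)
    have halfA: "2 * measure lborel A \<le> measure lborel ?B" unfolding A_def by (rule half[OF True])
    have "indicator ?B x * indicator QA (t, x) = (indicator A x :: ennreal)" for x
      by (auto simp: A_def QA_def indicator_def)
    then have "emeasure lborel A = ?a t" using Am by simp
    moreover have "indicator ?B x * indicator QD (t, x) = (indicator (A' - A) x :: ennreal)" for x
      by (auto simp: A_def A'_def QD_def indicator_def)
    then have "emeasure lborel (A' - A) = ?D t" using Am by simp
    moreover have "(\<integral>\<^sup>+p. indicator (?B - A') (fst p) * indicator A (snd p) * indicator E p *
        ennreal (norm (fst p - snd p) powr - real DIM('a)) \<partial>lborel2) = ?P t"
      by (intro nn_integral_cong) (auto simp: A_def A'_def QP_def H_def indicator_def)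
    ultimately have "?a t \<le> ennreal K * (ennreal (1 / q) * ?P t + ?D t)"
      using isoperimetric_pair[OF E thick \<mu> Am sub halfA] by (simp only: K_def q_def)
    then have "ennreal (2 * t) * ?a t \<le> ennreal (2 * t) * (ennreal K * (ennreal (1 / q) * ?P t + ?D t))"
      by (rule mult_left_mono) simp
    also have "\<dots> = ennreal K * (ennreal (1 / q) * (ennreal (2 * t) * ?P t) + ennreal (2 * t) * ?D t)"
      by (simp add: distrib_left mult_ac)
    finally show ?thesis .
  qed (simp add: ennreal_neg)
  have X_eq: "X = (\<integral>\<^sup>+t. ennreal (2 * t) * ?a t \<partial>lborel)"
    unfolding WA(3) X_def
  proof (rule nn_integral_cong)
    fix x :: 'a
    have "indicator QA (t, x) = (indicator {..f x} t :: ennreal)" for t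
      by (simp add: QA_def indicator_def)
    then show "indicator ?B x * ennreal ((f x)\<^sup>2) = indicator ?B x * (\<integral>\<^sup>+t. ennreal (2 * t) * indicator QA (t, x) \<partial>lborel)"
      by (simp only: nn_integral_2t_0[OF f0])
  qed
  have D_le: "(\<integral>\<^sup>+t. ennreal (2 * t) * ?D t \<partial>lborel) \<le> ennreal (1 / \<theta>\<^sup>2 - 1) * X"
  proof -
    have "(\<integral>\<^sup>+t. ennreal (2 * t) * indicator QD (t, x) \<partial>lborel) \<le> ennreal (1 / \<theta>\<^sup>2 - 1) * ennreal ((f x)\<^sup>2)" for x
    proof -
      have "\<theta> * f x \<le> 1 * f x" using \<theta> f0[of x] by (intro mult_right_mono) auto
      then have "f x \<le> f x / \<theta>" using \<theta> by (simp add: field_simps)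
      then have "(\<integral>\<^sup>+t. ennreal (2 * t) * indicator {f x .. f x / \<theta>} t \<partial>lborel) = ennreal ((f x / \<theta>)\<^sup>2 - (f x)\<^sup>2)"
        using f0[of x] by (intro nn_integral_2t) auto
      also have "(f x / \<theta>)\<^sup>2 - (f x)\<^sup>2 = (1 / \<theta>\<^sup>2 - 1) * (f x)\<^sup>2"
        by (simp add: power_divide algebra_simps)
      also have "ennreal \<dots> = ennreal (1 / \<theta>\<^sup>2 - 1) * ennreal ((f x)\<^sup>2)"
        by (rule ennreal_mult'') simp
      finally have eq: "(\<integral>\<^sup>+t. ennreal (2 * t) * indicator {f x .. f x / \<theta>} t \<partial>lborel) = ennreal (1 / \<theta>\<^sup>2 - 1) * ennreal ((f x)\<^sup>2)" .
      show ?thesis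
        unfolding eq[symmetric] using \<theta> by (intro nn_integral_mono) (auto simp: QD_def indicator_def field_simps)
    qed
    then have "(\<integral>\<^sup>+t. ennreal (2 * t) * ?D t \<partial>lborel) \<le> (\<integral>\<^sup>+x. indicator ?B x * (ennreal (1 / \<theta>\<^sup>2 - 1) * ennreal ((f x)\<^sup>2)) \<partial>lborel)"
      unfolding WD(3) by (intro nn_integral_mono mult_left_mono) auto
    also have "\<dots> = ennreal (1 / \<theta>\<^sup>2 - 1) * X"
      unfolding X_def by (simp add: nn_integral_cmult[symmetric] mult.left_commute)
    finally show ?thesis .
  qed
  have P_le: "(\<integral>\<^sup>+t. ennreal (2 * t) * ?P t \<partial>lborel) \<le> ennreal (1 / (1 - \<theta>)\<^sup>2) * energy E ?B f"
  proof -
    have "(\<integral>\<^sup>+t. ennreal (2 * t) * indicator QP (t, p) \<partial>lborel) \<le> ennreal (1 / (1 - \<theta>)\<^sup>2) * ennreal ((f (fst p) - f (snd p))\<^sup>2)" for p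
    proof (cases "f (fst p) < \<theta> * f (snd p)")
      case True
      have "(\<integral>\<^sup>+t. ennreal (2 * t) * indicator QP (t, p) \<partial>lborel) \<le> (\<integral>\<^sup>+t. ennreal (2 * t) * indicator {..f (snd p)} t \<partial>lborel)"
        by (intro nn_integral_mono) (auto simp: QP_def indicator_def)
      also have "\<dots> = ennreal ((f (snd p))\<^sup>2)" by (rule nn_integral_2t_0[OF f0])
      also have "(f (snd p))\<^sup>2 \<le> 1 / (1 - \<theta>)\<^sup>2 * (f (fst p) - f (snd p))\<^sup>2"
      proof -
        have "((1 - \<theta>) * f (snd p))\<^sup>2 \<le> (f (snd p) - f (fst p))\<^sup>2"
          using True \<theta> f0[of "snd p"] mult_right_mono[of \<theta> 1 "f (snd p)"]
          by (intro power_mono) (auto simp: algebra_simps)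
        then have "(1 - \<theta>)\<^sup>2 * (f (snd p))\<^sup>2 \<le> (f (fst p) - f (snd p))\<^sup>2"
          by (simp only: power_mult_distrib power2_commute[of "f (snd p)"])
        moreover have "(1 - \<theta>)\<^sup>2 > 0" using \<theta> by simp
        ultimately show ?thesis by (simp add: pos_le_divide_eq mult.commute)
      qed
      finally show ?thesis
        by (simp add: ennreal_mult[symmetric] ennreal_leI)
    next
      case False
      have "\<theta> * t \<le> \<theta> * f (snd p)" if "t \<le> f (snd p)" for t using that \<theta> by simp
      then have "(\<lambda>t. ennreal (2 * t) * indicator QP (t, p)) = (\<lambda>t. 0)"
        using False by (force simp: QP_def indicator_def)
      then show ?thesis by (simp only: nn_integral_const) simp
    qed
    then have "(\<integral>\<^sup>+t. ennreal (2 * t) * ?P t \<partial>lborel) \<le> (\<integral>\<^sup>+p. H p * (ennreal (1 / (1 - \<theta>)\<^sup>2) * ennreal ((f (fst p) - f (snd p))\<^sup>2)) \<partial>lborel2)"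
      unfolding WP(3) by (intro nn_integral_mono mult_left_mono) auto
    also have "\<dots> = (\<integral>\<^sup>+p. ennreal (1 / (1 - \<theta>)\<^sup>2) * (indicator (?B \<times> ?B) p * indicator E p *
     ennreal ((f (fst p) - f (snd p))\<^sup>2 * norm (fst p - snd p) powr - real DIM('a))) \<partial>lborel2)"
      by (intro nn_integral_cong) (simp add: H_def ennreal_mult mult_ac)
    also have "\<dots> = ennreal (1 / (1 - \<theta>)\<^sup>2) * energy E ?B f"
      unfolding energy_def by (intro nn_integral_cmult) (unfold measurable_lborel2 indicator_times, measurable)
    finally show ?thesis .
  qed
  have m: "(\<lambda>t. ennreal (2 * t) * ?P t) \<in> borel_measurable lborel" "(\<lambda>t. ennreal (2 * t) * ?D t) \<in> borel_measurable lborel"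
    using WP(1) WD(1) m2t by (simp_all add: borel_measurable_times_ennreal)
  have "X \<le> (\<integral>\<^sup>+t. ennreal K * (ennreal (1 / q) * (ennreal (2 * t) * ?P t) + ennreal (2 * t) * ?D t) \<partial>lborel)"
    unfolding X_eq by (intro nn_integral_mono step)
  also have "\<dots> = ennreal K * (ennreal (1 / q) * (\<integral>\<^sup>+t. ennreal (2 * t) * ?P t \<partial>lborel) + (\<integral>\<^sup>+t. ennreal (2 * t) * ?D t \<partial>lborel))"
    using m by (simp add: nn_integral_cmult nn_integral_add)
  also have "\<dots> \<le> ennreal K * (ennreal (1 / q) * (ennreal (1 / (1 - \<theta>)\<^sup>2) * energy E ?B f) + ennreal (1 / \<theta>\<^sup>2 - 1) * X)"
    by (intro mult_left_mono add_mono P_le D_le) auto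
  also have "\<dots> = ennreal (K / (q * (1 - \<theta>)\<^sup>2)) * energy E ?B f + ennreal (1/2) * X"
  proof -
    have "ennreal K * (ennreal (1 / \<theta>\<^sup>2 - 1) * X) = ennreal (1/2) * X"
      using K \<theta>(3) by (simp only: mult.assoc[symmetric] ennreal_mult'[symmetric] less_imp_le)
    moreover have "ennreal K * (ennreal (1 / q) * (ennreal (1 / (1 - \<theta>)\<^sup>2) * energy E ?B f)) = ennreal (K / (q * (1 - \<theta>)\<^sup>2)) * energy E ?B f"
      using K q \<theta> by (simp add: mult.assoc[symmetric] ennreal_mult''[symmetric])
    ultimately show ?thesis by (simp add: distrib_left)
  qed
  finally have "X \<le> ennreal (K / (q * (1 - \<theta>)\<^sup>2)) * energy E ?B f + ennreal (1/2) * X" .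
  then have "X \<le> 2 * (ennreal (K / (q * (1 - \<theta>)\<^sup>2)) * energy E ?B f)"
  proof (rule ennreal_absorb_half)
    have "X \<le> (\<integral>\<^sup>+x. ennreal (M\<^sup>2) * indicator ?B x \<partial>lborel)"
      unfolding X_def using f0 fM by (intro nn_integral_mono) (auto simp: indicator_def intro!: ennreal_leI power_mono)
    also have "\<dots> = ennreal (M\<^sup>2) * emeasure lborel ?B" by (simp add: nn_integral_cmult)
    also have "\<dots> < \<infinity>" using emeasure_lborel_ball_finite[of a r] by (simp add: ennreal_mult_less_top)
    finally show "X < \<infinity>" .
  qed
  also have "\<dots> = ennreal (2 * (K / (q * (1 - \<theta>)\<^sup>2))) * energy E ?B f"
  proof -
    have "2 * ennreal z = ennreal (2 * z)" if "z \<ge> 0" for z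
      using that by (simp add: ennreal_mult)
    then show ?thesis using K q by (simp add: mult.assoc[symmetric])
  qed
  also have "2 * (K / (q * (1 - \<theta>)\<^sup>2)) = poincare_const DIM('a) \<mu>"
    by (simp add: poincare_const_def Let_def K_def q_def \<theta>_def)
  finally show ?thesis unfolding X_def .
qed

lemma ball_in_borel [measurable]: "ball (a::'a::metric_space) r \<in> sets borel"
  by simp

lemma energy_mono:
  assumes "\<And>x y. (f x - f y)\<^sup>2 \<le> (u x - u y)\<^sup>2"
  shows "energy E B f \<le> energy E B u"
  unfolding energy_def
  by (intro nn_integral_mono mult_left_mono ennreal_leI mult_right_mono assms) auto

text \<open>
  Boundedness is removed by truncation, which does not increase the energy.
\<close>

lemma square_bound:
  fixes E :: "('a::euclidean_space \<times> 'a) set" and \<mu> :: real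
  assumes E: "E \<in> sets borel2" and thick: "thick \<mu> E" and \<mu>: "0 < \<mu>" "\<mu> < 1"
    and f[measurable]: "f \<in> borel_measurable borel" and f0: "\<And>x. 0 \<le> f x"
    and half: "\<And>t. 0 < t \<Longrightarrow> 2 * measure lborel {x \<in> ball a r. t \<le> f x} \<le> measure lborel (ball a r)"
  shows "(\<integral>\<^sup>+x. indicator (ball a r) x * ennreal ((f x)\<^sup>2) \<partial>lborel)
     \<le> ennreal (poincare_const DIM('a) \<mu>) * energy E (ball a r) f"
proof -
  define fn where "fn = (\<lambda>n x. min (f x) (real (Suc n)))"
  have [measurable]: "fn n \<in> borel_measurable borel" for n unfolding fn_def by measurable
  have bound: "(\<integral>\<^sup>+x. indicator (ball a r) x * ennreal ((fn n x)\<^sup>2) \<partial>lborel)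
     \<le> ennreal (poincare_const DIM('a) \<mu>) * energy E (ball a r) f" for n
  proof -
    have "(\<integral>\<^sup>+x. indicator (ball a r) x * ennreal ((fn n x)\<^sup>2) \<partial>lborel)
     \<le> ennreal (poincare_const DIM('a) \<mu>) * energy E (ball a r) (fn n)"
    proof (rule square_bound_bounded[OF E thick \<mu>, where M = "real (Suc n)"])
      fix t :: real assume t: "0 < t"
      show "2 * measure lborel {x \<in> ball a r. t \<le> fn n x} \<le> measure lborel (ball a r)"
        using half[OF t] by (cases "t \<le> real (Suc n)") (simp_all add: fn_def)
    qed (use f0 in \<open>auto simp: fn_def\<close>)
    also have "\<dots> \<le> ennreal (poincare_const DIM('a) \<mu>) * energy E (ball a r) f"
    proof (intro mult_left_mono energy_mono)
      fix x y
      have "\<bar>fn n x - fn n y\<bar> \<le> \<bar>f x - f y\<bar>" by (auto simp: fn_def)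
      then show "(fn n x - fn n y)\<^sup>2 \<le> (f x - f y)\<^sup>2" by (simp only: abs_le_square_iff)
    qed simp
    finally show ?thesis .
  qed
  have sup: "(SUP n. ennreal ((fn n x)\<^sup>2)) = ennreal ((f x)\<^sup>2)" for x
  proof (rule antisym)
    show "(SUP n. ennreal ((fn n x)\<^sup>2)) \<le> ennreal ((f x)\<^sup>2)"
      using f0 by (intro SUP_least ennreal_leI power_mono) (auto simp: fn_def)
    obtain n :: nat where "f x \<le> real n" using real_arch_simple by blast
    then have "fn n x = f x" by (simp add: fn_def)
    then show "ennreal ((f x)\<^sup>2) \<le> (SUP n. ennreal ((fn n x)\<^sup>2))"
      by (intro SUP_upper2[of n]) auto
  qed
  have "(\<integral>\<^sup>+x. indicator (ball a r) x * ennreal ((f x)\<^sup>2) \<partial>lborel) =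
     (\<integral>\<^sup>+x. (SUP n. indicator (ball a r) x * ennreal ((fn n x)\<^sup>2)) \<partial>lborel)"
    by (intro nn_integral_cong) (simp add: sup flip: SUP_mult_left_ennreal)
  also have "\<dots> = (SUP n. \<integral>\<^sup>+x. indicator (ball a r) x * ennreal ((fn n x)\<^sup>2) \<partial>lborel)"
  proof (rule nn_integral_monotone_convergence_SUP)
    show "incseq (\<lambda>n x. indicator (ball a r) x * ennreal ((fn n x)\<^sup>2))"
      using f0 by (auto simp: incseq_def le_fun_def fn_def intro!: mult_left_mono ennreal_leI power_mono)
  qed auto
  also have "\<dots> \<le> ennreal (poincare_const DIM('a) \<mu>) * energy E (ball a r) f"
    by (intro SUP_least bound)
  finally show ?thesis .
qed

text \<open>
  The infimum of the levels \<open>m\<close> with \<open>2 * |{u > m}| \<le> |B|\<close>. The two inequalities are stated for superlevel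
  sets at positive heights \<open>t\<close>, as they are used, and then no continuity of the measure in the level
  is involved.
\<close>

lemma median_exists:
  fixes u :: "'a::euclidean_space \<Rightarrow> real"
  assumes u[measurable]: "u \<in> borel_measurable borel"
  obtains m where "\<And>t. 0 < t \<Longrightarrow> 2 * measure lborel {x \<in> ball a r. t \<le> u x - m} \<le> measure lborel (ball a r)"
    "\<And>t. 0 < t \<Longrightarrow> 2 * measure lborel {x \<in> ball a r. t \<le> m - u x} \<le> measure lborel (ball a r)"
proof (cases "r > 0")
  case False
  then have "ball a r = {}" by simp
  show thesis by (rule that[of 0]) (unfold \<open>ball a r = {}\<close>, simp_all)
next
  case True
  let ?B = "ball a r" let ?b = "measure lborel ?B"
  have [measurable]: "?B \<in> sets borel" by simp
  have b: "?b > 0" using True by (rule content_ball_pos)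
  have fin: "emeasure lborel X \<noteq> \<infinity>" if "X \<subseteq> ?B" for X :: "'a set"
    using emeasure_mono[OF that, of lborel] emeasure_lborel_ball_finite[of a r]
    by (auto simp: top_unique)
  have mono: "measure lborel X \<le> measure lborel Y" if "X \<subseteq> Y" "Y \<subseteq> ?B" "X \<in> sets borel" "Y \<in> sets borel" for X Y :: "'a set"
    using that fin[OF that(2)] by (intro measure_mono_fmeasurable fmeasurableI) (auto simp: less_top)
  define F where "F = (\<lambda>t. measure lborel {x \<in> ?B. u x > t})"
  have Fmono: "F t \<le> F s" if "s \<le> t" for s t
    unfolding F_def using that by (intro mono) auto
  have "(\<lambda>n. measure lborel {x \<in> ?B. u x > real n}) \<longlonglongrightarrow> measure lborel (\<Inter>n. {x \<in> ?B. u x > real n})"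
    by (intro Lim_measure_decseq fin) (auto simp: decseq_def)
  moreover have "(\<Inter>n. {x \<in> ?B. u x > real n}) = {}"
  proof -
    have "\<exists>n. \<not> u x > real n" for x
      using real_arch_simple[of "u x"] by (simp add: not_less)
    then show ?thesis by blast
  qed
  ultimately have "(\<lambda>n. F (real n)) \<longlonglongrightarrow> 0" by (simp only: F_def measure_empty)
  then have "eventually (\<lambda>n. F (real n) < ?b / 2) sequentially"
    using b by (intro order_tendstoD) auto
  then obtain t1 where t1: "F t1 < ?b / 2" by (auto simp: eventually_sequentially)
  have "(\<lambda>n. measure lborel {x \<in> ?B. u x > - real n}) \<longlonglongrightarrow> measure lborel (\<Union>n. {x \<in> ?B. u x > - real n})"
    by (intro Lim_measure_incseq fin) (auto simp: incseq_def)
  moreover have "(\<Union>n. {x \<in> ?B. u x > - real n}) = ?B"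
  proof -
    have "\<exists>n. u x > - real n" for x
      using reals_Archimedean2[of "- u x"] by (metis minus_less_iff)
    then show ?thesis by blast
  qed
  ultimately have "(\<lambda>n. F (- real n)) \<longlonglongrightarrow> ?b" by (simp only: F_def)
  then have "eventually (\<lambda>n. F (- real n) > ?b / 2) sequentially"
    using b by (intro order_tendstoD) auto
  then obtain t2 where t2: "F t2 > ?b / 2" by (auto simp: eventually_sequentially)
  define S where "S = {t. 2 * F t \<le> ?b}"
  have S: "t1 \<in> S" using t1 by (simp add: S_def)
  have bdd: "bdd_below S"
  proof (rule bdd_belowI)
    fix s assume "s \<in> S"
    then show "t2 \<le> s" using Fmono[of s t2] t2 by (force simp: S_def)
  qed
  define m where "m = Inf S"
  show thesis
  proof (rule that[of m])
    fix t :: real assume t: "0 < t"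
    have "Inf S < m + t" using t by (simp add: m_def)
    then obtain s where "s \<in> S" "s < m + t" using cInf_less_iff[of S] S bdd by blast
    moreover have "measure lborel {x \<in> ?B. t \<le> u x - m} \<le> F s" if "s < m + t"
      unfolding F_def using that by (intro mono) auto
    ultimately show "2 * measure lborel {x \<in> ?B. t \<le> u x - m} \<le> ?b" by (force simp: S_def)
    have "m - t \<notin> S" using cInf_lower[of "m - t" S] bdd t by (auto simp: m_def)
    then have "F (m - t) > ?b / 2" by (simp add: S_def)
    moreover have "measure lborel {x \<in> ?B. t \<le> m - u x} + F (m - t) = measure lborel ({x \<in> ?B. t \<le> m - u x} \<union> {x \<in> ?B. u x > m - t})"
      unfolding F_def by (intro measure_Union[symmetric] fin) auto
    moreover have "\<dots> \<le> ?b" by (intro mono) auto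
    ultimately show "2 * measure lborel {x \<in> ?B. t \<le> m - u x} \<le> ?b" by simp
  qed
qed

text \<open>
  With a median \<open>m\<close> of \<open>u\<close>, both \<open>max (u - m) 0\<close> and \<open>max (m - u) 0\<close> are supported on at most half of the ball, and
  \<open>(u x - u y)\<^sup>2 \<le> 2 * (u x - m)\<^sup>2 + 2 * (u y - m)\<^sup>2\<close>.
\<close>

lemma local_poincare:
  fixes E :: "('a::euclidean_space \<times> 'a) set" and \<mu> :: real
  assumes E: "E \<in> sets borel2" and thick: "thick \<mu> E" and \<mu>: "0 < \<mu>" "\<mu> < 1"
    and u[measurable]: "u \<in> borel_measurable borel"
  shows "(\<integral>\<^sup>+p. indicator (ball a r \<times> ball a r) p * ennreal ((u (fst p) - u (snd p))\<^sup>2) \<partial>lborel2)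
     \<le> ennreal (8 * poincare_const DIM('a) \<mu> * measure lborel (ball a r)) * energy E (ball a r) u"
proof -
  let ?B = "ball a r" let ?C = "poincare_const DIM('a) \<mu>"
  have [measurable]: "?B \<in> sets borel" by simp
  obtain m where m: "\<And>t. 0 < t \<Longrightarrow> 2 * measure lborel {x \<in> ?B. t \<le> u x - m} \<le> measure lborel ?B"
    "\<And>t. 0 < t \<Longrightarrow> 2 * measure lborel {x \<in> ?B. t \<le> m - u x} \<le> measure lborel ?B"
    using median_exists[OF u, of a r] by blast
  define X where "X = (\<integral>\<^sup>+z. indicator ?B z * ennreal ((u z - m)\<^sup>2) \<partial>lborel)"
  have part: "(\<integral>\<^sup>+x. indicator ?B x * ennreal ((max (w x) 0)\<^sup>2) \<partial>lborel) \<le> ennreal ?C * energy E ?B u"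
    if [measurable]: "w \<in> borel_measurable borel" and w: "\<And>x y. \<bar>w x - w y\<bar> = \<bar>u x - u y\<bar>"
      and half: "\<And>t. 0 < t \<Longrightarrow> 2 * measure lborel {x \<in> ?B. t \<le> w x} \<le> measure lborel ?B" for w
  proof -
    have "(\<integral>\<^sup>+x. indicator ?B x * ennreal ((max (w x) 0)\<^sup>2) \<partial>lborel) \<le> ennreal ?C * energy E ?B (\<lambda>x. max (w x) 0)"
    proof (rule square_bound[OF E thick \<mu>])
      fix t :: real assume t: "0 < t"
      then have "{x \<in> ?B. t \<le> max (w x) 0} = {x \<in> ?B. t \<le> w x}" by auto
      then show "2 * measure lborel {x \<in> ?B. t \<le> max (w x) 0} \<le> measure lborel ?B" using half[OF t] by simp
    qed auto
    also have "\<dots> \<le> ennreal ?C * energy E ?B u"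
    proof (intro mult_left_mono energy_mono)
      fix x y
      have "\<bar>max (w x) 0 - max (w y) 0\<bar> \<le> \<bar>w x - w y\<bar>" by auto
      then show "(max (w x) 0 - max (w y) 0)\<^sup>2 \<le> (u x - u y)\<^sup>2" by (simp only: abs_le_square_iff w)
    qed simp
    finally show ?thesis .
  qed
  have pos: "(\<integral>\<^sup>+x. indicator ?B x * ennreal ((max (u x - m) 0)\<^sup>2) \<partial>lborel) \<le> ennreal ?C * energy E ?B u"
    by (rule part) (use m(1) in auto)
  have neg: "(\<integral>\<^sup>+x. indicator ?B x * ennreal ((max (m - u x) 0)\<^sup>2) \<partial>lborel) \<le> ennreal ?C * energy E ?B u"
    by (rule part) (use m(2) in auto)
  have "X = (\<integral>\<^sup>+x. indicator ?B x * ennreal ((max (u x - m) 0)\<^sup>2) + indicator ?B x * ennreal ((max (m - u x) 0)\<^sup>2) \<partial>lborel)"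
    unfolding X_def by (intro nn_integral_cong) (auto simp: indicator_def max_def power2_commute)
  also have "\<dots> = (\<integral>\<^sup>+x. indicator ?B x * ennreal ((max (u x - m) 0)\<^sup>2) \<partial>lborel) + (\<integral>\<^sup>+x. indicator ?B x * ennreal ((max (m - u x) 0)\<^sup>2) \<partial>lborel)"
    by (intro nn_integral_add) measurable
  also have "\<dots> \<le> ennreal ?C * energy E ?B u + ennreal ?C * energy E ?B u"
    by (intro add_mono pos neg)
  finally have X: "X \<le> 2 * (ennreal ?C * energy E ?B u)" by (simp add: mult_2)
  let ?g = "\<lambda>x. indicator ?B x * ennreal ((u x - m)\<^sup>2)"
  have "(\<integral>\<^sup>+p. indicator (?B \<times> ?B) p * ennreal ((u (fst p) - u (snd p))\<^sup>2) \<partial>lborel2)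
     \<le> (\<integral>\<^sup>+p. 2 * (?g (fst p) * indicator ?B (snd p) + indicator ?B (fst p) * ?g (snd p)) \<partial>lborel2)"
  proof (intro nn_integral_mono)
    fix p :: "'a \<times> 'a"
    have "(u (fst p) - u (snd p))\<^sup>2 \<le> 2 * ((u (fst p) - m)\<^sup>2 + (u (snd p) - m)\<^sup>2)"
      using zero_le_power2[of "(u (fst p) - m) + (u (snd p) - m)"] by (simp add: power2_eq_square algebra_simps)
    then have "ennreal ((u (fst p) - u (snd p))\<^sup>2) \<le> 2 * (ennreal ((u (fst p) - m)\<^sup>2) + ennreal ((u (snd p) - m)\<^sup>2))"
      by (simp add: ennreal_mult[symmetric] ennreal_plus[symmetric] ennreal_leI ennreal_numeral[symmetric] del: ennreal_plus ennreal_numeral)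
    then show "indicator (?B \<times> ?B) p * ennreal ((u (fst p) - u (snd p))\<^sup>2)
      \<le> 2 * (?g (fst p) * indicator ?B (snd p) + indicator ?B (fst p) * ?g (snd p))"
      by (cases p) (auto simp: indicator_def)
  qed
  also have "\<dots> = (\<integral>\<^sup>+x. \<integral>\<^sup>+y. 2 * (?g x * indicator ?B y + indicator ?B x * ?g y) \<partial>lborel \<partial>lborel)"
  proof -
    have "(\<lambda>p. 2 * (?g (fst p) * indicator ?B (snd p) + indicator ?B (fst p) * ?g (snd p))) \<in> borel_measurable lborel2"
      unfolding measurable_lborel2 by measurable
    from lborel.nn_integral_fst[OF this] show ?thesis by simp
  qed
  also have "\<dots> = 2 * (X * emeasure lborel ?B + emeasure lborel ?B * X)"
    unfolding X_def by (simp add: nn_integral_cmult nn_integral_multc nn_integral_add)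
  also have "\<dots> = 4 * emeasure lborel ?B * X"
    by (simp add: mult_2[symmetric] mult_ac)
  also have "\<dots> \<le> 4 * emeasure lborel ?B * (2 * (ennreal ?C * energy E ?B u))"
    by (intro mult_left_mono X) simp
  also have "emeasure lborel ?B = ennreal (measure lborel ?B)"
    using emeasure_lborel_ball_finite[of a r] by (simp add: emeasure_eq_ennreal_measure)
  also have "4 * ennreal (measure lborel ?B) * (2 * (ennreal ?C * energy E ?B u)) =
     ennreal (8 * ?C * measure lborel ?B) * energy E ?B u"
  proof -
    have "?C \<ge> 0" using \<mu> by (simp add: poincare_const_def Let_def)
    then show ?thesis by (simp add: ennreal_mult mult_ac)
  qed
  finally show ?thesis .
qed

section \<open>Integration over all balls\<close>

text \<open>
  A pair lies in \<open>ball a r \<times> ball a r\<close> exactly for the centres \<open>a\<close> in the intersection of two balls.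
\<close>

lemma integral_over_centres:
  fixes G :: "'a::euclidean_space \<times> 'a \<Rightarrow> ennreal"
  assumes G: "G \<in> borel_measurable borel2"
  shows "(\<lambda>a. \<integral>\<^sup>+p. indicator (ball a r \<times> ball a r) p * G p \<partial>lborel2) \<in> borel_measurable borel"
    and "(\<integral>\<^sup>+a. \<integral>\<^sup>+p. indicator (ball a r \<times> ball a r) p * G p \<partial>lborel2 \<partial>lborel)
    = (\<integral>\<^sup>+p. emeasure lborel (ball (fst p) r \<inter> ball (snd p) r) * G p \<partial>lborel2)"
proof -
  define Q where "Q = {z::'a\<times>'a\<times>'a. dist (fst z) (fst (snd z)) < r \<and> dist (fst z) (snd (snd z)) < r}"
  have "Q \<in> sets (borel \<Otimes>\<^sub>M borel2)"
    unfolding Q_def by (rule sets_Collect_UNIV, measurable) (simp add: space_pair_measure)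
  also have "sets (borel \<Otimes>\<^sub>M borel2) = sets (borel \<Otimes>\<^sub>M lborel2)"
    by (intro sets_pair_measure_cong sets_lborel[symmetric] refl)
  finally have Q: "Q \<in> sets (borel \<Otimes>\<^sub>M lborel2)" .
  have G': "G \<in> borel_measurable lborel2" using G by (simp only: measurable_lborel2)
  have eq: "indicator (ball a r \<times> ball a r) p * G p = G p * indicator Q (a, p)" for a p
    by (cases p) (simp add: Q_def indicator_def)
  note W = weighted_tonelli[OF sigma_finite_lborel2 borel_measurable_const[of 1] G' Q]
  show "(\<lambda>a. \<integral>\<^sup>+p. indicator (ball a r \<times> ball a r) p * G p \<partial>lborel2) \<in> borel_measurable borel"
    unfolding eq by (rule W(1))
  have "(\<integral>\<^sup>+a. indicator Q (a, p) \<partial>lborel) = emeasure lborel (ball (fst p) r \<inter> ball (snd p) r)" for p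
  proof -
    have "indicator Q (a, p) = (indicator (ball (fst p) r \<inter> ball (snd p) r) a :: ennreal)" for a
      by (auto simp: Q_def indicator_def dist_commute)
    then show ?thesis by simp
  qed
  then show "(\<integral>\<^sup>+a. \<integral>\<^sup>+p. indicator (ball a r \<times> ball a r) p * G p \<partial>lborel2 \<partial>lborel)
    = (\<integral>\<^sup>+p. emeasure lborel (ball (fst p) r \<inter> ball (snd p) r) * G p \<partial>lborel2)"
    unfolding eq using W(3) by (simp add: mult.commute)
qed

lemma poincare_const_nonneg: "0 < \<mu> \<Longrightarrow> 0 \<le> poincare_const d \<mu>"
  by (simp add: poincare_const_def Let_def)

text \<open>
  The Poincare inequality integrated over the centres of all balls of radius \<open>r\<close>. Two points at
  distance less than \<open>r\<close> lie together in the balls centred in a ball of radius \<open>r / 2\<close>, and two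
  points at distance \<open>2 * r\<close> or more lie together in none.
\<close>

lemma fixed_scale:
  fixes E :: "('a::euclidean_space \<times> 'a) set" and \<mu> r :: real
  assumes E[measurable]: "E \<in> sets borel2" and thick: "thick \<mu> E" and \<mu>: "0 < \<mu>" "\<mu> < 1"
    and u[measurable]: "u \<in> borel_measurable borel" and r: "r > 0"
  shows "(\<integral>\<^sup>+p. indicator {p. norm (fst p - snd p) < r} p * ennreal ((u (fst p) - u (snd p))\<^sup>2) \<partial>lborel2)
    \<le> ennreal (8 * 2 ^ DIM('a) * unit_ball_vol DIM('a) * poincare_const DIM('a) \<mu> * r ^ DIM('a)) *
      (\<integral>\<^sup>+p. indicator {p. norm (fst p - snd p) < 2 * r} p * (indicator E p *
        ennreal ((u (fst p) - u (snd p))\<^sup>2 * norm (fst p - snd p) powr - real DIM('a))) \<partial>lborel2)"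
proof -
  define d where "d = DIM('a)"
  define V where "V = unit_ball_vol (real d)"
  define C where "C = poincare_const d \<mu>"
  have V: "V > 0" and C: "C \<ge> 0" using \<mu> by (auto simp: V_def C_def poincare_const_nonneg)
  have vol: "emeasure lborel (ball c \<rho> :: 'a set) = ennreal (V * \<rho> ^ d)" if "\<rho> \<ge> 0" for c \<rho>
    using that by (simp add: emeasure_ball V_def d_def)
  define g where "g = (\<lambda>p::'a\<times>'a. ennreal ((u (fst p) - u (snd p))\<^sup>2))"
  define h where "h = (\<lambda>p::'a\<times>'a. indicator E p * ennreal ((u (fst p) - u (snd p))\<^sup>2 * norm (fst p - snd p) powr - real DIM('a)))"
  have [measurable]: "g \<in> borel_measurable borel2" unfolding g_def by measurable
  have [measurable]: "h \<in> borel_measurable borel2" unfolding h_def by measurable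
  have [measurable]: "{p::'a\<times>'a. norm (fst p - snd p) < c} \<in> sets borel2" for c
    by (rule sets_Collect_UNIV, measurable) (simp add: space_pair_measure)
  let ?I = "\<lambda>c. \<integral>\<^sup>+p. indicator {p. norm (fst p - snd p) < c} p * g p \<partial>lborel2"
  let ?J = "\<lambda>c. \<integral>\<^sup>+p. indicator {p. norm (fst p - snd p) < c} p * h p \<partial>lborel2"
  have "ennreal (V * (r/2) ^ d) * ?I r = (\<integral>\<^sup>+p. ennreal (V * (r/2) ^ d) * (indicator {p. norm (fst p - snd p) < r} p * g p) \<partial>lborel2)"
    by (intro nn_integral_cmult[symmetric]) (unfold measurable_lborel2, measurable)
  also have "\<dots> \<le> (\<integral>\<^sup>+p. emeasure lborel (ball (fst p) r \<inter> ball (snd p) r) * g p \<partial>lborel2)"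
  proof (intro nn_integral_mono)
    fix p :: "'a \<times> 'a"
    show "ennreal (V * (r/2) ^ d) * (indicator {p. norm (fst p - snd p) < r} p * g p) \<le> emeasure lborel (ball (fst p) r \<inter> ball (snd p) r) * g p"
    proof (cases "norm (fst p - snd p) < r")
      case True
      let ?c = "midpoint (fst p) (snd p)"
      have "dist (fst p) (snd p) < r" using True by (simp add: dist_norm)
      then have c: "dist (fst p) ?c < r / 2" "dist (snd p) ?c < r / 2"
        by (simp_all add: dist_midpoint)
      have "ball ?c (r/2) \<subseteq> ball (fst p) r \<inter> ball (snd p) r"
      proof
        fix z assume "z \<in> ball ?c (r/2)"
        then show "z \<in> ball (fst p) r \<inter> ball (snd p) r"
          using c dist_triangle[of "fst p" z ?c] dist_triangle[of "snd p" z ?c] by simp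
      qed
      then have "emeasure lborel (ball ?c (r/2)) \<le> emeasure lborel (ball (fst p) r \<inter> ball (snd p) r)"
        by (intro emeasure_mono) auto
      then show ?thesis
        using True r vol[of "r/2" ?c] by (auto intro!: mult_right_mono)
    qed simp
  qed
  also have "\<dots> = (\<integral>\<^sup>+a. \<integral>\<^sup>+p. indicator (ball a r \<times> ball a r) p * g p \<partial>lborel2 \<partial>lborel)"
    by (rule integral_over_centres(2)[symmetric]) measurable
  also have "\<dots> \<le> (\<integral>\<^sup>+a. ennreal (8 * C * (V * r ^ d)) * (\<integral>\<^sup>+p. indicator (ball a r \<times> ball a r) p * h p \<partial>lborel2) \<partial>(lborel :: 'a measure))"
  proof (intro nn_integral_mono)
    fix a :: 'a
    show "(\<integral>\<^sup>+p. indicator (ball a r \<times> ball a r) p * g p \<partial>lborel2)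
      \<le> ennreal (8 * C * (V * r ^ d)) * (\<integral>\<^sup>+p. indicator (ball a r \<times> ball a r) p * h p \<partial>lborel2)"
      using local_poincare[OF E thick \<mu> u, of a r] r
      by (simp add: g_def h_def energy_def C_def V_def d_def content_ball mult_ac)
  qed
  also have "\<dots> = ennreal (8 * C * (V * r ^ d)) * (\<integral>\<^sup>+a. \<integral>\<^sup>+p. indicator (ball a r \<times> ball a r) p * h p \<partial>lborel2 \<partial>lborel)"
  proof (rule nn_integral_cmult)
    have "h \<in> borel_measurable borel2" by measurable
    from integral_over_centres(1)[OF this, of r]
    show "(\<lambda>a. \<integral>\<^sup>+p. indicator (ball a r \<times> ball a r) p * h p \<partial>lborel2) \<in> borel_measurable lborel" by simp
  qed
  also have "(\<integral>\<^sup>+a. \<integral>\<^sup>+p. indicator (ball a r \<times> ball a r) p * h p \<partial>lborel2 \<partial>lborel) =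
     (\<integral>\<^sup>+p. emeasure lborel (ball (fst p) r \<inter> ball (snd p) r) * h p \<partial>lborel2)"
    by (rule integral_over_centres(2)) measurable
  also have "\<dots> \<le> (\<integral>\<^sup>+p. ennreal (V * r ^ d) * (indicator {p. norm (fst p - snd p) < 2 * r} p * h p) \<partial>lborel2)"
  proof (intro nn_integral_mono)
    fix p :: "'a \<times> 'a"
    show "emeasure lborel (ball (fst p) r \<inter> ball (snd p) r) * h p \<le> ennreal (V * r ^ d) * (indicator {p. norm (fst p - snd p) < 2 * r} p * h p)"
    proof (cases "norm (fst p - snd p) < 2 * r")
      case True
      have "emeasure lborel (ball (fst p) r \<inter> ball (snd p) r) \<le> emeasure lborel (ball (fst p) r)"
        by (intro emeasure_mono) auto
      then show ?thesis using True r vol[of r "fst p"] by (auto intro!: mult_right_mono)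
    next
      case False
      have "ball (fst p) r \<inter> ball (snd p) r = {}"
      proof (rule ccontr)
        assume "ball (fst p) r \<inter> ball (snd p) r \<noteq> {}"
        then obtain z where "dist (fst p) z < r" "dist (snd p) z < r" by auto
        then have "dist (fst p) (snd p) < 2 * r" by (smt (verit) dist_commute dist_triangle)
        then show False using False by (simp add: dist_norm)
      qed
      then show ?thesis by simp
    qed
  qed
  also have "\<dots> = ennreal (V * r ^ d) * ?J (2 * r)"
    by (intro nn_integral_cmult) (unfold measurable_lborel2, measurable)
  finally have main: "ennreal (V * (r/2) ^ d) * ?I r \<le> ennreal (8 * C * (V * r ^ d)) * (ennreal (V * r ^ d) * ?J (2 * r))"
    by (simp add: mult_left_mono)
  define k where "k = 1 / (V * (r/2) ^ d)"
  have k: "k \<ge> 0" "ennreal k * ennreal (V * (r/2) ^ d) = 1"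
    using V r by (auto simp: k_def ennreal_mult[symmetric])
  have "?I r = ennreal k * (ennreal (V * (r/2) ^ d) * ?I r)"
    using k by (simp add: mult.assoc[symmetric])
  also have "\<dots> \<le> ennreal k * (ennreal (8 * C * (V * r ^ d)) * (ennreal (V * r ^ d) * ?J (2 * r)))"
    by (intro mult_left_mono main) simp
  also have "\<dots> = ennreal (k * (8 * C * (V * r ^ d)) * (V * r ^ d)) * ?J (2 * r)"
    using k C V r by (simp add: ennreal_mult mult.assoc)
  also have "k * (8 * C * (V * r ^ d)) * (V * r ^ d) = 8 * 2 ^ d * V * C * r ^ d"
    using V r by (simp add: k_def power_divide field_simps)
  finally show ?thesis
    unfolding g_def h_def V_def d_def C_def .
qed

lemma nn_integral_powr_tail:
  assumes "a > 0" "b > (0::real)"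
  shows "(\<integral>\<^sup>+r. ennreal (r powr (- b - 1)) * indicator {a<..} r \<partial>lborel) = ennreal (a powr - b / b)"
proof -
  have "(\<integral>\<^sup>+r. ennreal (r powr (- b - 1)) * indicator {a<..} r \<partial>lborel) = (\<integral>\<^sup>+r. ennreal (r powr (- b - 1)) * indicator {a..} r \<partial>lborel)"
    using AE_lborel_singleton[of a] by (intro nn_integral_cong_AE) (auto elim!: eventually_mono simp: indicator_def)
  also have "\<dots> = ennreal (0 - (- (a powr - b / b)))"
  proof (rule nn_integral_FTC_atLeast)
    show "DERIV (\<lambda>r. - (r powr - b / b)) x :> x powr (- b - 1)" if "a \<le> x" for x
      using assms that by (auto intro!: derivative_eq_intros)
    have "((\<lambda>r. r powr - b) \<longlongrightarrow> 0) at_top"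
      using assms by (intro tendsto_neg_powr) (auto simp: filterlim_ident)
    then show "((\<lambda>r. - (r powr - b / b)) \<longlongrightarrow> 0) at_top"
      using tendsto_minus[OF tendsto_divide_zero[of "\<lambda>r. r powr - b" at_top b]] by simp
  qed auto
  finally show ?thesis by simp
qed

definition coercivity_const :: "nat \<Rightarrow> real \<Rightarrow> real" where
  "coercivity_const d \<mu> = 16 * real (d + 2) * 2 ^ d * unit_ball_vol d * poincare_const d \<mu>"

text \<open>
  Integration of lemma \<open>fixed_scale\<close> against \<open>r powr (- d - 2 * s - 1)\<close> over \<open>r > 0\<close>. On the left the weight
  becomes \<open>|x - y| powr (- d - 2 * s) / (d + 2 * s)\<close>; on the right a factor \<open>r ^ d\<close> has been gained, and the
  remaining weight \<open>r powr (- 2 * s - 1)\<close> integrates to a multiple of \<open>|x - y| powr (- 2 * s) / s\<close>.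
\<close>

lemma coercivity_borel:
  fixes E :: "('a::euclidean_space \<times> 'a) set" and \<mu> s :: real
  assumes E[measurable]: "E \<in> sets borel2" and thick: "thick \<mu> E" and \<mu>: "0 < \<mu>" "\<mu> < 1"
    and u[measurable]: "u \<in> borel_measurable borel" and s: "0 < s" "s < 1"
  shows "(\<integral>\<^sup>+p. ennreal ((u (fst p) - u (snd p))\<^sup>2 * norm (fst p - snd p) powr (- real DIM('a) - 2 * s)) \<partial>lborel2)
    \<le> ennreal (coercivity_const DIM('a) \<mu> / s) *
      (\<integral>\<^sup>+p. indicator E p * ennreal ((u (fst p) - u (snd p))\<^sup>2 * norm (fst p - snd p) powr (- real DIM('a) - 2 * s)) \<partial>lborel2)"
proof -
  define d where "d = DIM('a)"
  define M where "M = 8 * 2 ^ d * unit_ball_vol (real d) * poincare_const d \<mu>"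
  have M: "M \<ge> 0" using \<mu> by (simp add: M_def poincare_const_nonneg)
  define g where "g = (\<lambda>p::'a\<times>'a. ennreal ((u (fst p) - u (snd p))\<^sup>2))"
  define h where "h = (\<lambda>p::'a\<times>'a. indicator E p * ennreal ((u (fst p) - u (snd p))\<^sup>2 * norm (fst p - snd p) powr - real d))"
  have [measurable]: "g \<in> borel_measurable borel2" unfolding g_def by measurable
  have [measurable]: "h \<in> borel_measurable borel2" unfolding h_def by measurable
  define N where "N = (\<lambda>p::'a\<times>'a. norm (fst p - snd p))"
  have [measurable]: "N \<in> borel_measurable borel2" unfolding N_def by measurable
  let ?b = "real d + 2 * s"
  have b: "?b > 0" using s by (simp add: d_def)
  define w where "w = (\<lambda>b r. ennreal (r powr (- b - 1)) * indicator {0<..} r)"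
  have wm: "w b \<in> borel_measurable borel" for b unfolding w_def by measurable
  define Q where "Q = (\<lambda>c. {z. N (snd z) < c * fst z})"
  have Q: "Q c \<in> sets (borel \<Otimes>\<^sub>M lborel2)" for c
  proof -
    have "Q c \<in> sets (borel \<Otimes>\<^sub>M borel2)"
      unfolding Q_def by (rule sets_Collect_UNIV, measurable) (simp add: space_pair_measure)
    also have "sets (borel \<Otimes>\<^sub>M borel2) = sets (borel \<Otimes>\<^sub>M lborel2)"
      by (intro sets_pair_measure_cong sets_lborel[symmetric] refl)
    finally show ?thesis .
  qed
  have m: "g \<in> borel_measurable lborel2" "h \<in> borel_measurable lborel2"
    unfolding measurable_lborel2 by measurable
  let ?I = "\<lambda>\<beta> c p. \<integral>\<^sup>+r. w \<beta> r * indicator (Q c) (r, p) \<partial>lborel"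
  let ?G = "\<lambda>r. \<integral>\<^sup>+p. g p * indicator (Q 1) (r, p) \<partial>lborel2"
  let ?H = "\<lambda>r. \<integral>\<^sup>+p. h p * indicator (Q 2) (r, p) \<partial>lborel2"
  have tail: "?I \<beta> c p = ennreal ((N p / c) powr - \<beta> / \<beta>)" if "N p > 0" "c > 0" "\<beta> > 0" for p \<beta> c
  proof -
    have "w \<beta> r * indicator (Q c) (r, p) = ennreal (r powr (- \<beta> - 1)) * indicator {N p / c<..} r" for r
    proof -
      have "r > 0" if "N p < c * r"
        using that \<open>N p > 0\<close> \<open>c > 0\<close> zero_less_mult_pos[of c r] by linarith
      then show ?thesis
        using that by (auto simp: w_def Q_def indicator_def field_simps)
    qed
    then show ?thesis using that by (simp only: nn_integral_powr_tail divide_pos_pos)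
  qed
  let ?F = "\<lambda>p. ennreal ((u (fst p) - u (snd p))\<^sup>2 * norm (fst p - snd p) powr (- real d - 2 * s))"
  have [measurable]: "?F \<in> borel_measurable borel2" by measurable
  \<comment> \<open>On the diagonal the integral over \<open>r\<close> diverges, but the increment of \<open>u\<close> vanishes.\<close>
  have N0: "u (fst p) - u (snd p) = 0" if "\<not> N p > 0" for p
    using that by (simp add: N_def)
  have "(\<integral>\<^sup>+p. ?F p \<partial>lborel2) = (\<integral>\<^sup>+p. ennreal ?b * (g p * ?I ?b 1 p) \<partial>lborel2)"
  proof (intro nn_integral_cong)
    fix p
    show "?F p = ennreal ?b * (g p * ?I ?b 1 p)"
    proof (cases "N p > 0")
      case True
      show ?thesis
        unfolding tail[OF True zero_less_one b] g_def using b
        by (simp add: ennreal_mult[symmetric] N_def)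
    next
      case False
      then show ?thesis using N0[OF False] by (simp add: g_def)
    qed
  qed
  also have "\<dots> = ennreal ?b * (\<integral>\<^sup>+p. g p * ?I ?b 1 p \<partial>lborel2)"
    by (intro nn_integral_cmult borel_measurable_times_ennreal m weighted_tonelli(2)[OF sigma_finite_lborel2 wm m(1) Q])
  also have "(\<integral>\<^sup>+p. g p * ?I ?b 1 p \<partial>lborel2) = (\<integral>\<^sup>+r. w ?b r * ?G r \<partial>lborel)"
    by (rule weighted_tonelli(3)[OF sigma_finite_lborel2 wm m(1) Q, symmetric])
  also have "\<dots> \<le> (\<integral>\<^sup>+r. ennreal M * (w (2 * s) r * ?H r) \<partial>lborel)"
  proof (intro nn_integral_mono)
    fix r :: real
    show "w ?b r * ?G r \<le> ennreal M * (w (2 * s) r * ?H r)"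
    proof (cases "r > 0")
      case True
      have "?G r \<le> ennreal (M * r ^ d) * ?H r"
        using fixed_scale[OF E thick \<mu> u True]
        by (simp add: M_def N_def Q_def g_def h_def d_def mult.commute indicator_def)
      then have "w ?b r * ?G r \<le> w ?b r * (ennreal (M * r ^ d) * ?H r)"
        by (intro mult_left_mono) auto
      also have "\<dots> = ennreal M * (w (2 * s) r * ?H r)"
      proof -
        have "r powr (- ?b - 1) * r ^ d = r powr (- (2 * s) - 1)"
          using True by (simp add: powr_realpow[symmetric] powr_add[symmetric])
        then have eq: "w ?b r * ennreal (r ^ d) = w (2 * s) r"
          using True by (simp add: w_def ennreal_mult[symmetric])
        have "w ?b r * (ennreal (M * r ^ d) * S) = ennreal M * ((w ?b r * ennreal (r ^ d)) * S)" for S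
          using M True by (simp add: ennreal_mult mult_ac)
        then show ?thesis by (simp only: eq)
      qed
      finally show ?thesis .
    qed (simp add: w_def)
  qed
  also have "\<dots> = ennreal M * (\<integral>\<^sup>+r. w (2 * s) r * ?H r \<partial>lborel)"
    using wm weighted_tonelli(1)[OF sigma_finite_lborel2 wm m(2) Q]
    by (intro nn_integral_cmult borel_measurable_times_ennreal) simp_all
  also have "(\<integral>\<^sup>+r. w (2 * s) r * ?H r \<partial>lborel) = (\<integral>\<^sup>+p. h p * ?I (2 * s) 2 p \<partial>lborel2)"
    by (rule weighted_tonelli(3)[OF sigma_finite_lborel2 wm m(2) Q])
  also have "\<dots> \<le> (\<integral>\<^sup>+p. ennreal (2 / s) * (indicator E p * ?F p) \<partial>lborel2)"
  proof (intro nn_integral_mono)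
    fix p
    show "h p * ?I (2 * s) 2 p \<le> ennreal (2 / s) * (indicator E p * ?F p)"
    proof (cases "N p > 0")
      case True
      have "(N p / 2) powr - (2 * s) = N p powr - (2 * s) * 2 powr (2 * s)"
        using True by (simp add: powr_divide powr_minus field_simps)
      also have "\<dots> \<le> N p powr - (2 * s) * 2 powr 2"
        using s by (intro mult_left_mono powr_mono) auto
      finally have "(N p / 2) powr - (2 * s) / (2 * s) \<le> 2 / s * N p powr - (2 * s)"
        using s by (simp add: field_simps)
      then have "h p * ?I (2 * s) 2 p \<le> h p * ennreal (2 / s * N p powr - (2 * s))"
        using s by (subst tail[OF True]) (auto intro!: mult_left_mono ennreal_leI)
      also have "\<dots> = ennreal (2 / s) * (indicator E p * ?F p)"
      proof -
        have "N p powr - real d * N p powr - (2 * s) = N p powr (- real d - 2 * s)"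
          by (simp add: powr_add[symmetric])
        then have "((u (fst p) - u (snd p))\<^sup>2 * N p powr - real d) * (2 / s * N p powr - (2 * s)) = 2 / s * ((u (fst p) - u (snd p))\<^sup>2 * N p powr (- real d - 2 * s))"
          by (simp add: field_simps)
        moreover have "ennreal a * ennreal b = ennreal c * ennreal e"
          if "a * b = c * e" "0 \<le> a" "0 \<le> b" "0 \<le> c" "0 \<le> e" for a b c e :: real
          using that by (simp add: ennreal_mult[symmetric])
        ultimately have "ennreal ((u (fst p) - u (snd p))\<^sup>2 * N p powr - real d) * ennreal (2 / s * N p powr - (2 * s)) = ennreal (2 / s) * ?F p"
          using s by (simp add: N_def)
        then show ?thesis by (cases "p \<in> E") (simp_all add: h_def N_def)
      qed
      finally show ?thesis .
    next
      case False
      then show ?thesis using N0[OF False] by (simp add: h_def)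
    qed
  qed
  also have "\<dots> = ennreal (2 / s) * (\<integral>\<^sup>+p. indicator E p * ?F p \<partial>lborel2)"
    by (intro nn_integral_cmult) (unfold measurable_lborel2, measurable)
  finally have "(\<integral>\<^sup>+p. ?F p \<partial>lborel2) \<le> ennreal ?b * (ennreal M * (ennreal (2 / s) * (\<integral>\<^sup>+p. indicator E p * ?F p \<partial>lborel2)))"
    by (simp add: mult_left_mono)
  also have "\<dots> = ennreal (?b * (M * (2 / s))) * (\<integral>\<^sup>+p. indicator E p * ?F p \<partial>lborel2)"
    using b M s by (subst (1 2) ennreal_mult) (auto simp: mult.assoc)
  also have "\<dots> \<le> ennreal (coercivity_const d \<mu> / s) * (\<integral>\<^sup>+p. indicator E p * ?F p \<partial>lborel2)"
  proof (intro mult_right_mono ennreal_leI)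
    have "?b * (M * (2 / s)) \<le> real (d + 2) * (M * (2 / s))"
      using s M by (intro mult_right_mono) auto
    then show "?b * (M * (2 / s)) \<le> coercivity_const d \<mu> / s"
      by (simp add: coercivity_const_def M_def mult_ac)
  qed simp
  finally show ?thesis unfolding d_def .
qed

section \<open>Lebesgue measurable kernels and functions\<close>

text \<open>
  The set where the kernel is large contains a Borel set \<open>S\<close> with null complement in it. For \<open>x\<close> outside
  a null set \<open>Z\<close> the section of \<open>S\<close> at \<open>x\<close> has lost only a null set, and adding \<open>Z \<times> UNIV\<close> to
  \<open>S\<close> restores the density condition at the remaining \<open>x\<close> without changing any integral.
\<close>

lemma coercivity_lebesgue:
  fixes K :: "'a::euclidean_space \<Rightarrow> 'a \<Rightarrow> real" and \<mu> s lam :: real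
  assumes \<mu>: "0 < \<mu>" "\<mu> < 1" and s: "0 < s" "s < 1" and lam: "0 < lam"
    and Km: "(\<lambda>(x, y). K x y) \<in> borel_measurable lebesgue"
    and dens: "\<And>a r x. 0 < r \<Longrightarrow> x \<in> ball a r \<Longrightarrow>
       \<mu> * measure lebesgue (ball a r) \<le>
       measure lebesgue {z \<in> ball a r. lam * norm (x - z) powr (- real DIM('a) - 2 * s) \<le> K x z}"
    and u: "u \<in> borel_measurable lebesgue"
  shows "ennreal lam * (\<integral>\<^sup>+p. (case p of (x, y) \<Rightarrow>
        ennreal (\<bar>u x - u y\<bar>\<^sup>2 * norm (x - y) powr (- real DIM('a) - 2 * s))) \<partial>lebesgue)
    \<le> ennreal (coercivity_const DIM('a) \<mu> / s) * (\<integral>\<^sup>+x. \<integral>\<^sup>+y. ennreal ((u x - u y)\<^sup>2 * K x y) \<partial>lebesgue \<partial>lebesgue)"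
proof -
  define \<beta> where "\<beta> = - real DIM('a) - 2 * s"
  define G where "G = {p::'a\<times>'a. lam * norm (fst p - snd p) powr \<beta> \<le> K (fst p) (snd p)}"
  obtain u' where u'[measurable]: "u' \<in> borel_measurable lborel" and uu': "AE x in lborel. u x = u' x"
    using completion_ex_borel_measurable_real[OF u] by blast
  have G: "G \<in> sets lebesgue"
  proof -
    have "(\<lambda>p::'a\<times>'a. lam * norm (fst p - snd p) powr \<beta>) \<in> borel_measurable borel2" by measurable
    then have "(\<lambda>p::'a\<times>'a. lam * norm (fst p - snd p) powr \<beta>) \<in> borel_measurable lborel"
      by (simp add: borel_prod)
    then have "(\<lambda>p::'a\<times>'a. lam * norm (fst p - snd p) powr \<beta>) \<in> borel_measurable lebesgue"
      by (rule measurable_completion)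
    moreover have "(\<lambda>p. K (fst p) (snd p)) \<in> borel_measurable lebesgue"
      using Km by (simp add: case_prod_unfold)
    ultimately have "{p \<in> space lebesgue. lam * norm (fst p - snd p) powr \<beta> \<le> K (fst p) (snd p)} \<in> sets lebesgue"
      by (rule borel_measurable_le)
    then show ?thesis by (simp add: G_def)
  qed
  obtain S N N' where SN: "G = S \<union> N" "N \<subseteq> N'" "N' \<in> null_sets (lborel :: ('a\<times>'a) measure)" "S \<in> sets lborel"
    using sets_completionE[OF G] by blast
  have "N' \<in> null_sets lborel2" using SN(3) by (simp add: lborel_prod)
  then have "AE x in lborel. AE y in lborel. (x, y) \<notin> N'"
    by (intro lborel_pair.AE_pair AE_not_in)
  then obtain Z where Z: "{x \<in> space lborel. \<not> (AE y in lborel. (x, y) \<notin> N')} \<subseteq> Z" "emeasure lborel Z = 0" "Z \<in> sets lborel"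
    by (rule AE_E)
  have Zn: "Z \<in> null_sets lborel" using Z by auto
  have Zc: "AE y in lborel. (x, y) \<notin> N'" if "x \<notin> Z" for x using Z(1) that by auto
  \<comment> \<open>At the exceptional points \<open>x \<in> Z\<close> every pair is admitted, which makes \<open>E\<close> trivially dense there.\<close>
  define E where "E = S \<union> Z \<times> UNIV"
  have E: "E \<in> sets borel2"
  proof -
    have "S \<in> sets borel2" using SN(4) by (simp only: borel_prod sets_lborel)
    moreover have "Z \<times> UNIV \<in> sets (borel \<Otimes>\<^sub>M (borel :: 'a measure))" using Z(3) by (intro pair_measureI) auto
    ultimately show ?thesis unfolding E_def by blast
  qed
  have slice: "{z. (x, z) \<in> E} \<in> sets borel" for x
    using E by (intro sets_slice) (simp only: borel_prod)
  have thick: "thick \<mu> E"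
    unfolding thick_def
  proof (intro allI impI)
    fix a r and x :: 'a assume x: "x \<in> ball a r"
    then have r: "r > 0" by (smt (verit) mem_ball zero_le_dist)
    let ?T = "{z \<in> ball a r. lam * norm (x - z) powr \<beta> \<le> K x z}"
    let ?R = "{z \<in> ball a r. (x, z) \<in> E}"
    have T0: "?R \<in> sets borel" using sets.Int[OF ball_in_borel[of a r] slice[of x]] by (simp add: Int_def)
    have T0f: "?R \<in> fmeasurable lborel"
    proof (rule fmeasurableI)
      have "emeasure lborel ?R \<le> emeasure lborel (ball a r)" by (intro emeasure_mono) auto
      then show "emeasure lborel ?R < \<infinity>" using emeasure_lborel_ball_finite[of a r]
        by (metis infinity_ennreal_def order_le_less_trans)
    qed (use T0 in simp)
    show "\<mu> * measure lborel (ball a r) \<le> measure lborel ?R"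
    proof (cases "x \<in> Z")
      case True
      then have "?R = ball a r" by (auto simp: E_def)
      then show ?thesis using \<mu> mult_right_mono[of \<mu> 1 "measure lborel (ball a r)"] by simp
    next
      case False
      have "{y. (x, y) \<in> N'} \<in> sets lborel"
        using sets_slice[OF null_setsD2[OF SN(3), unfolded sets_lborel], of x] by (simp only: sets_lborel)
      moreover from Zc[OF False] have "AE y in lborel. y \<notin> {y. (x, y) \<in> N'}" by simp
      ultimately have Nx: "{y. (x, y) \<in> N'} \<in> null_sets lborel"
        using AE_iff_null_sets by blast
      have sub: "?T \<subseteq> ?R \<union> {y. (x, y) \<in> N'}"
      proof
        fix z assume z: "z \<in> ?T"
        then have "(x, z) \<in> G" by (simp add: G_def)
        then show "z \<in> ?R \<union> {y. (x, y) \<in> N'}" using SN z by (auto simp: E_def)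
      qed
      have Uf: "?R \<union> {y. (x, y) \<in> N'} \<in> fmeasurable lborel"
        by (rule fmeasurable.Un[OF T0f fmeasurableI_null_sets[OF Nx]])
      have "\<mu> * measure lborel (ball a r) \<le> measure lebesgue ?T"
        using dens[OF r x] measure_completion[of "ball a r" lborel] unfolding \<beta>_def
        by (simp only: sets_lborel ball_in_borel)
      also have "\<dots> \<le> measure lebesgue (?R \<union> {y. (x, y) \<in> N'})"
      proof (cases "?T \<in> sets lebesgue")
        case True
        from Uf have "?R \<union> {y. (x, y) \<in> N'} \<in> lmeasurable" by (auto simp: fmeasurable_def)
        then show ?thesis by (rule measure_mono_fmeasurable[OF sub True])
      next
        case False
        from measure_notin_sets[OF this] show ?thesis by (simp only: measure_nonneg)
      qed
      also have "\<dots> = measure lborel (?R \<union> {y. (x, y) \<in> N'})"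
        by (rule measure_completion[OF fmeasurableD[OF Uf]])
      also have "\<dots> = measure lborel ?R"
        by (rule measure_Un_null_set[OF fmeasurableD[OF T0f] Nx])
      finally show ?thesis .
    qed
  qed
  let ?F = "\<lambda>p. ennreal ((u' (fst p) - u' (snd p))\<^sup>2 * norm (fst p - snd p) powr \<beta>)"
  have Fm: "(\<lambda>p. indicator E p * ?F p) \<in> borel_measurable lborel2"
    using E u' unfolding measurable_lborel2 by measurable
  obtain N1 where N1: "{x \<in> space lborel. \<not> u x = u' x} \<subseteq> N1" "emeasure lborel N1 = 0" "N1 \<in> sets lborel"
    using AE_E[OF uu'] by blast
  have N1n: "N1 \<in> null_sets lborel" using N1 by auto
  have N1u: "u x = u' x" if "x \<notin> N1" for x using N1(1) that by auto
  have "(\<integral>\<^sup>+p. (case p of (x, y) \<Rightarrow> ennreal (\<bar>u x - u y\<bar>\<^sup>2 * norm (x - y) powr \<beta>)) \<partial>lebesgue)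
     = (\<integral>\<^sup>+p. (case p of (x, y) \<Rightarrow> ennreal (\<bar>u x - u y\<bar>\<^sup>2 * norm (x - y) powr \<beta>)) \<partial>lborel2)"
    by (simp add: nn_integral_completion lborel_prod)
  also have "\<dots> = (\<integral>\<^sup>+p. ?F p \<partial>lborel2)"
  proof (rule nn_integral_cong_AE)
    have "N1 \<times> UNIV \<in> null_sets (lborel \<Otimes>\<^sub>M (lborel :: 'a measure))"
      using N1n by (intro lborel.times_in_null_sets1) auto
    moreover have "UNIV \<times> N1 \<in> null_sets ((lborel :: 'a measure) \<Otimes>\<^sub>M lborel)"
      using N1n by (intro lborel.times_in_null_sets2) auto
    ultimately have "AE p in lborel2. p \<notin> N1 \<times> (UNIV :: 'a set)" "AE p in lborel2. p \<notin> (UNIV :: 'a set) \<times> N1"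
      by (auto intro!: AE_not_in)
    then show "AE p in lborel2. (case p of (x, y) \<Rightarrow> ennreal (\<bar>u x - u y\<bar>\<^sup>2 * norm (x - y) powr \<beta>)) = ?F p"
      by eventually_elim (simp add: N1u case_prod_unfold mem_Times_iff)
  qed
  also have "ennreal lam * \<dots> \<le> ennreal lam * (ennreal (coercivity_const DIM('a) \<mu> / s) * (\<integral>\<^sup>+p. indicator E p * ?F p \<partial>lborel2))"
    unfolding \<beta>_def using u' by (intro mult_left_mono coercivity_borel[OF E thick \<mu> _ s]) auto
  also have "\<dots> = ennreal (coercivity_const DIM('a) \<mu> / s) * (ennreal lam * (\<integral>\<^sup>+p. indicator E p * ?F p \<partial>lborel2))"
    by (simp add: mult_ac)
  also have "ennreal lam * (\<integral>\<^sup>+p. indicator E p * ?F p \<partial>lborel2) = (\<integral>\<^sup>+p. ennreal lam * (indicator E p * ?F p) \<partial>lborel2)"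
    by (rule nn_integral_cmult[OF Fm, symmetric])
  also have "\<dots> = (\<integral>\<^sup>+x. \<integral>\<^sup>+y. ennreal lam * (indicator E (x, y) * ?F (x, y)) \<partial>lborel \<partial>lborel)"
    by (intro lborel.nn_integral_fst[symmetric] borel_measurable_times_ennreal Fm) simp
  also have "\<dots> \<le> (\<integral>\<^sup>+x. \<integral>\<^sup>+y. ennreal ((u x - u y)\<^sup>2 * K x y) \<partial>lborel \<partial>lborel)"
  proof (rule nn_integral_mono_AE)
    show "AE x in lborel. (\<integral>\<^sup>+y. ennreal lam * (indicator E (x, y) * ?F (x, y)) \<partial>lborel) \<le> (\<integral>\<^sup>+y. ennreal ((u x - u y)\<^sup>2 * K x y) \<partial>lborel)"
      using AE_not_in[OF Zn] AE_not_in[OF N1n]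
    proof eventually_elim
      fix x assume x: "x \<notin> Z" "x \<notin> N1"
      show "(\<integral>\<^sup>+y. ennreal lam * (indicator E (x, y) * ?F (x, y)) \<partial>lborel) \<le> (\<integral>\<^sup>+y. ennreal ((u x - u y)\<^sup>2 * K x y) \<partial>lborel)"
      proof (rule nn_integral_mono_AE)
        show "AE y in lborel. ennreal lam * (indicator E (x, y) * ?F (x, y)) \<le> ennreal ((u x - u y)\<^sup>2 * K x y)"
          using AE_not_in[OF N1n]
        proof eventually_elim
          fix y assume y: "y \<notin> N1"
          show "ennreal lam * (indicator E (x, y) * ?F (x, y)) \<le> ennreal ((u x - u y)\<^sup>2 * K x y)"
          proof (cases "(x, y) \<in> E")
            case True
            then have "(x, y) \<in> G" using x SN by (auto simp: E_def)
            then have "lam * norm (x - y) powr \<beta> \<le> K x y" by (simp add: G_def)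
            then have "(u x - u y)\<^sup>2 * (lam * norm (x - y) powr \<beta>) \<le> (u x - u y)\<^sup>2 * K x y"
              by (intro mult_left_mono) auto
            then have "ennreal (lam * ((u' x - u' y)\<^sup>2 * norm (x - y) powr \<beta>)) \<le> ennreal ((u x - u y)\<^sup>2 * K x y)"
              using N1u[OF x(2)] N1u[OF y] by (intro ennreal_leI) (simp add: mult_ac)
            then show ?thesis using True lam by (simp add: ennreal_mult)
          qed simp
        qed
      qed
    qed
  qed
  also have "\<dots> = (\<integral>\<^sup>+x. \<integral>\<^sup>+y. ennreal ((u x - u y)\<^sup>2 * K x y) \<partial>lebesgue \<partial>lebesgue)"
    by (simp add: nn_integral_completion)
  finally show ?thesis
    unfolding \<beta>_def by (simp add: mult_left_mono)
qed

section \<open>Gaussian integrals\<close>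

text \<open>
  The characteristic function of the standard normal distribution, rescaled.
\<close>

lemma gaussian_1d:
  fixes \<tau> z :: real
  assumes \<tau>: "\<tau> > 0"
  shows "integrable lborel (\<lambda>x. of_real (exp (- \<tau> * x\<^sup>2)) * cis (x * z))"
    and "(LINT x|lborel. of_real (exp (- \<tau> * x\<^sup>2)) * cis (x * z)) = of_real (sqrt (pi / \<tau>) * exp (- z\<^sup>2 / (4 * \<tau>)))"
proof -
  define c where "c = sqrt (2 * \<tau>)"
  have c: "c > 0" "c\<^sup>2 = 2 * \<tau>" using \<tau> by (auto simp: c_def)
  let ?f = "\<lambda>x. complex_of_real (exp (- \<tau> * x\<^sup>2)) * cis (x * z)"
  let ?g = "\<lambda>y. std_normal_density y *\<^sub>R iexp (z / c * y)"
  have eq: "?f x = of_real (sqrt (2 * pi)) * ?g (c * x)" for x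
  proof -
    have "z / c * (c * x) = x * z" using c by simp
    then have g: "?g (c * x) = of_real (std_normal_density (c * x)) * cis (x * z)"
      by (simp only: scaleR_conv_of_real cis_conv_exp)
    have "exp (- \<tau> * x\<^sup>2) = sqrt (2 * pi) * std_normal_density (c * x)"
      using c by (simp add: std_normal_density_def power_mult_distrib)
    then show ?thesis unfolding g by (simp only: of_real_mult mult.assoc)
  qed
  have gi: "integrable lborel ?g"
  proof (rule Bochner_Integration.integrable_bound)
    show "integrable lborel std_normal_density" by simp
    show "AE y in lborel. norm (?g y) \<le> norm (std_normal_density y)" by simp
  qed simp
  have "(LINT y|std_normal_distribution. iexp (z / c * y)) = (LINT y|lborel. ?g y)"
    by (subst integral_density) auto
  then have g: "(LINT y|lborel. ?g y) = of_real (exp (- (z / c)\<^sup>2 / 2))"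
    using fun_cong[OF char_std_normal_distribution, of "z / c"] by (simp add: char_def)
  have gi': "integrable lborel (\<lambda>x. ?g (0 + c * x))"
    using c gi by (intro lborel_integrable_real_affine) auto
  show "integrable lborel ?f" unfolding eq using gi' by (intro integrable_mult_right) (simp only: add_0)
  have "(LINT y|lborel. ?g y) = c *\<^sub>R (LINT x|lborel. ?g (0 + c * x))"
    using c by (subst lborel_integral_real_affine[of c _ 0]) auto
  then have "(LINT x|lborel. ?g (c * x)) = of_real (exp (- (z / c)\<^sup>2 / 2) / c)"
    unfolding g using c by (simp add: scaleR_conv_of_real field_simps)
  then have "(LINT x|lborel. ?f x) = of_real (sqrt (2 * pi)) * of_real (exp (- (z / c)\<^sup>2 / 2) / c)"
    unfolding eq by (simp only: integral_mult_right_zero)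
  also have "sqrt (2 * pi) * (exp (- (z / c)\<^sup>2 / 2) / c) = sqrt (pi / \<tau>) * exp (- z\<^sup>2 / (4 * \<tau>))"
  proof -
    have "sqrt (2 * pi) / c = sqrt (pi / \<tau>)" by (simp add: c_def flip: real_sqrt_divide)
    moreover have "- (z / c)\<^sup>2 / 2 = - z\<^sup>2 / (4 * \<tau>)" by (simp add: power_divide c)
    ultimately show ?thesis by (metis times_divide_eq_left times_divide_eq_right)
  qed
  then have "complex_of_real (sqrt (2 * pi)) * of_real (exp (- (z / c)\<^sup>2 / 2) / c) = of_real (sqrt (pi / \<tau>) * exp (- z\<^sup>2 / (4 * \<tau>)))"
    by (simp only: of_real_mult[symmetric])
  finally show "(LINT x|lborel. ?f x) = of_real (sqrt (pi / \<tau>) * exp (- z\<^sup>2 / (4 * \<tau>)))" .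
qed

text \<open>
  Exponential and character are products over the coordinates, and so is Lebesgue measure.
\<close>

lemma gaussian_fourier:
  fixes z :: "'a::euclidean_space" and \<tau> :: real
  assumes \<tau>: "\<tau> > 0"
  shows "integrable lborel (\<lambda>x::'a. exp (- \<tau> * (norm x)\<^sup>2))"
    and "(LINT x|lborel. exp (- \<tau> * (norm x)\<^sup>2) * cos (x \<bullet> z)) = (pi / \<tau>) powr (real DIM('a) / 2) * exp (- (norm z)\<^sup>2 / (4 * \<tau>))"
proof -
  interpret P: product_sigma_finite "\<lambda>b::'a. lborel :: real measure" ..
  have eqP: "complex_of_real (exp (- \<tau> * (norm x)\<^sup>2)) * cis (x \<bullet> z) = (\<Prod>b\<in>Basis. of_real (exp (- \<tau> * (x \<bullet> b)\<^sup>2)) * cis ((x \<bullet> b) * (z \<bullet> b)))" for x z :: 'a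
  proof -
    have n: "(norm x)\<^sup>2 = (\<Sum>b\<in>Basis. (x \<bullet> b)\<^sup>2)"
      unfolding power2_norm_eq_inner by (subst euclidean_inner) (simp add: power2_eq_square)
    have "exp (- \<tau> * (norm x)\<^sup>2) = (\<Prod>b\<in>Basis. exp (- \<tau> * (x \<bullet> b)\<^sup>2))"
      unfolding n by (simp add: sum_distrib_left exp_sum)
    moreover have "cis (x \<bullet> z) = (\<Prod>b\<in>Basis. cis ((x \<bullet> b) * (z \<bullet> b)))"
      by (subst euclidean_inner) (simp add: cis_conv_exp sum_distrib_left exp_sum)
    ultimately show ?thesis by (simp add: prod.distrib)
  qed
  let ?h = "\<lambda>z (b::'a) t. complex_of_real (exp (- \<tau> * t\<^sup>2)) * cis (t * (z \<bullet> b))"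
  let ?F = "\<lambda>z x. complex_of_real (exp (- \<tau> * (norm x)\<^sup>2)) * cis (x \<bullet> z)"
  have Fm: "?F z \<in> borel_measurable borel" for z :: 'a
    by (intro borel_measurable_continuous_onI continuous_intros)
  have sm: "(\<lambda>f. \<Sum>b\<in>Basis. f b *\<^sub>R b) \<in> (\<Pi>\<^sub>M b\<in>Basis. lborel) \<rightarrow>\<^sub>M (borel :: 'a measure)"
    by measurable
  have co: "(\<Sum>b\<in>Basis. f b *\<^sub>R b) \<bullet> b = f b" if "b \<in> Basis" for f and b :: 'a
    using that by simp
  have comp: "?F z (\<Sum>b\<in>Basis. f b *\<^sub>R b) = (\<Prod>b\<in>Basis. ?h z b (f b))" for f and z :: 'a
    unfolding eqP by (intro prod.cong refl) (simp only: co)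
  have int: "integrable lborel (?F z)" for z :: 'a
    by (subst lborel_eq, subst integrable_distr_eq[OF sm Fm], unfold comp, rule P.product_integrable_prod)
      (use gaussian_1d(1)[OF \<tau>] in auto)
  have val: "(LINT x|lborel. ?F z x) = of_real ((pi / \<tau>) powr (real DIM('a) / 2) * exp (- (norm z)\<^sup>2 / (4 * \<tau>)))" for z :: 'a
  proof -
    have "(LINT x|lborel. ?F z x) = (\<Prod>b\<in>Basis. LINT t|lborel. ?h z b t)"
      by (subst lborel_eq, subst integral_distr[OF sm Fm], unfold comp, rule P.product_integral_prod)
        (use gaussian_1d(1)[OF \<tau>] in auto)
    also have "\<dots> = of_real (\<Prod>b\<in>Basis. sqrt (pi / \<tau>) * exp (- (z \<bullet> b)\<^sup>2 / (4 * \<tau>)))"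
      unfolding of_real_prod by (intro prod.cong refl gaussian_1d(2) \<tau>)
    also have "(\<Prod>b\<in>Basis. sqrt (pi / \<tau>) * exp (- (z \<bullet> b)\<^sup>2 / (4 * \<tau>))) = sqrt (pi / \<tau>) ^ DIM('a) * exp (\<Sum>b\<in>Basis. - (z \<bullet> b)\<^sup>2 / (4 * \<tau>))"
      by (simp add: prod.distrib exp_sum)
    also have "(\<Sum>b\<in>Basis. - (z \<bullet> b)\<^sup>2 / (4 * \<tau>)) = - (norm z)\<^sup>2 / (4 * \<tau>)"
    proof -
      have "(norm z)\<^sup>2 = (\<Sum>b\<in>Basis. (z \<bullet> b)\<^sup>2)"
        unfolding power2_norm_eq_inner by (subst euclidean_inner) (simp add: power2_eq_square)
      then show ?thesis by (simp add: sum_divide_distrib sum_negf)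
    qed
    also have "sqrt (pi / \<tau>) ^ DIM('a) = (pi / \<tau>) powr (real DIM('a) / 2)"
      using \<tau> by (simp add: powr_half_sqrt[symmetric] powr_realpow[symmetric] powr_powr)
    finally show ?thesis .
  qed
  have "integrable lborel (\<lambda>x::'a. Re (?F 0 x))" by (rule integrable_bounded_linear[OF bounded_linear_Re int])
  then show "integrable lborel (\<lambda>x::'a. exp (- \<tau> * (norm x)\<^sup>2))" by simp
  have "(LINT x|lborel. Re (?F z x)) = Re (LINT x|lborel. ?F z x)" by (rule integral_bounded_linear[OF bounded_linear_Re int])
  also have "\<dots> = (pi / \<tau>) powr (real DIM('a) / 2) * exp (- (norm z)\<^sup>2 / (4 * \<tau>))"
    unfolding val by (rule Re_complex_of_real)
  finally show "(LINT x|lborel. exp (- \<tau> * (norm x)\<^sup>2) * cos (x \<bullet> z)) = (pi / \<tau>) powr (real DIM('a) / 2) * exp (- (norm z)\<^sup>2 / (4 * \<tau>))"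
    by (simp add: mult.commute)
qed

lemma gaussian_fourier_nn:
  fixes z :: "'a::euclidean_space" and \<tau> :: real
  assumes \<tau>: "\<tau> > 0"
  shows "(\<integral>\<^sup>+x. ennreal (exp (- \<tau> * (norm x)\<^sup>2) * (2 - 2 * cos (x \<bullet> z))) \<partial>lborel)
    = ennreal (2 * (pi / \<tau>) powr (real DIM('a) / 2) * (1 - exp (- (norm z)\<^sup>2 / (4 * \<tau>))))"
proof -
  let ?e = "\<lambda>x::'a. exp (- \<tau> * (norm x)\<^sup>2)"
  have i1: "integrable lborel ?e" by (rule gaussian_fourier[OF \<tau>])
  have i2: "integrable lborel (\<lambda>x. ?e x * cos (x \<bullet> z))"
    by (rule Bochner_Integration.integrable_bound[OF i1])
      (auto intro!: borel_measurable_continuous_onI continuous_intros simp: abs_mult mult_left_le)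
  have eq: "?e x * (2 - 2 * cos (x \<bullet> z)) = 2 * ?e x - 2 * (?e x * cos (x \<bullet> z))" for x
    by (simp add: algebra_simps)
  have i3: "integrable lborel (\<lambda>x. ?e x * (2 - 2 * cos (x \<bullet> z)))"
    unfolding eq using i1 i2 by (intro Bochner_Integration.integrable_diff integrable_mult_right)
  have "(LINT x|lborel. ?e x * (2 - 2 * cos (x \<bullet> z))) = 2 * (LINT x|lborel. ?e x) - 2 * (LINT x|lborel. ?e x * cos (x \<bullet> z))"
    unfolding eq using i1 i2 by (subst Bochner_Integration.integral_diff) auto
  also have "(LINT x|lborel. ?e x) = (pi / \<tau>) powr (real DIM('a) / 2)"
    using gaussian_fourier(2)[OF \<tau>, of "0::'a"] by simp
  also have "(LINT x|lborel. ?e x * cos (x \<bullet> z)) = (pi / \<tau>) powr (real DIM('a) / 2) * exp (- (norm z)\<^sup>2 / (4 * \<tau>))"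
    by (rule gaussian_fourier(2)[OF \<tau>])
  finally have "(LINT x|lborel. ?e x * (2 - 2 * cos (x \<bullet> z))) = 2 * (pi / \<tau>) powr (real DIM('a) / 2) * (1 - exp (- (norm z)\<^sup>2 / (4 * \<tau>)))"
    by (simp only: right_diff_distrib mult_1_right mult.assoc)
  then show ?thesis
    using nn_integral_eq_integral[OF i3] by simp
qed

text \<open>
  Applied with \<open>a = |h|\<^sup>2\<close>, this represents negative powers of \<open>|h|\<close> as superpositions of Gaussians.
\<close>

lemma gamma_kernel:
  fixes a p :: real
  assumes a: "a > 0" and p: "p > 0"
  shows "(\<integral>\<^sup>+t. ennreal (indicator {0<..} t * t powr (p - 1) * exp (- t * a)) \<partial>lborel) = ennreal (Gamma p * a powr - p)"
proof -
  have "ennreal (Gamma p) = (\<integral>\<^sup>+t. ennreal (indicator {0..} t * t powr (p - 1) / exp t) \<partial>lborel)"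
    by (rule Gamma_conv_nn_integral_real[OF p])
  also have "\<dots> = ennreal \<bar>a\<bar> * (\<integral>\<^sup>+t. ennreal (indicator {0..} (0 + a * t) * (0 + a * t) powr (p - 1) / exp (0 + a * t)) \<partial>lborel)"
    using a by (intro nn_integral_real_affine) auto
  also have "(\<integral>\<^sup>+t. ennreal (indicator {0..} (0 + a * t) * (0 + a * t) powr (p - 1) / exp (0 + a * t)) \<partial>lborel) =
     (\<integral>\<^sup>+t. ennreal (a powr (p - 1)) * ennreal (indicator {0<..} t * t powr (p - 1) * exp (- t * a)) \<partial>lborel)"
  proof (intro nn_integral_cong)
    fix t :: real
    show "ennreal (indicator {0..} (0 + a * t) * (0 + a * t) powr (p - 1) / exp (0 + a * t)) = ennreal (a powr (p - 1)) * ennreal (indicator {0<..} t * t powr (p - 1) * exp (- t * a))"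
    proof (cases "t > 0")
      case True
      then show ?thesis using a
        by (simp add: powr_mult exp_minus field_simps ennreal_mult[symmetric])
    next
      case False
      then show ?thesis using a by (cases "t = 0") (auto simp: indicator_def zero_le_mult_iff)
    qed
  qed
  also have "\<dots> = ennreal (a powr (p - 1)) * (\<integral>\<^sup>+t. ennreal (indicator {0<..} t * t powr (p - 1) * exp (- t * a)) \<partial>lborel)"
    by (intro nn_integral_cmult) measurable
  finally have *: "ennreal (Gamma p) = ennreal (a powr p) * (\<integral>\<^sup>+t. ennreal (indicator {0<..} t * t powr (p - 1) * exp (- t * a)) \<partial>lborel)"
    (is "_ = _ * ?I")
    using a by (simp add: mult.assoc[symmetric] ennreal_mult[symmetric] powr_mult_base)
  have "ennreal (Gamma p * a powr - p) = ennreal (a powr - p) * ennreal (Gamma p)"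
    using Gamma_real_pos[OF p] by (simp add: ennreal_mult mult.commute)
  also have "\<dots> = ?I"
    unfolding * using a by (simp add: mult.assoc[symmetric] ennreal_mult[symmetric] powr_add[symmetric])
  finally show ?thesis ..
qed

section \<open>The symbol of the fractional Laplacian\<close>

text \<open>
  This is \<open>\<integral> t powr (- s - 1) * (1 - exp (- t / 4)) dt\<close> over \<open>t > 0\<close>, with \<open>1 / t\<close> in place of \<open>t\<close>: a multiple of the
  weight in the subordination formula for the power \<open>s\<close> of the Laplacian.
\<close>

definition heat_integral :: "real \<Rightarrow> ennreal" where
  "heat_integral s = (\<integral>\<^sup>+t. ennreal (indicator {0<..} t * t powr (s - 1) * (1 - exp (- 1 / (4 * t)))) \<partial>lborel)"

lemma nn_integral_powr_unit:
  assumes "0 < (s::real)"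
  shows "(\<integral>\<^sup>+t. ennreal (indicator {0..1} t * t powr (s - 1)) \<partial>lborel) = ennreal (1 / s)"
proof -
  have "((\<lambda>t. t powr (s - 1)) has_integral (1 powr (s - 1 + 1) / (s - 1 + 1))) {0..1}"
    using assms by (intro has_integral_powr_from_0) auto
  from nn_integral_has_integral_lebesgue[OF _ this] show ?thesis by simp
qed

lemma heat_integral_finite:
  assumes s: "0 < s" "s < 1"
  shows "heat_integral s < \<infinity>"
proof -
  have "heat_integral s \<le> (\<integral>\<^sup>+t. ennreal (indicator {0..1} t * t powr (s - 1)) + ennreal (t powr (- (1 - s) - 1)) * indicator {1<..} t \<partial>lborel)"
    unfolding heat_integral_def
  proof (intro nn_integral_mono)
    fix t :: real
    let ?r = "t powr (s - 1) * (1 - exp (- 1 / (4 * t)))"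
    consider "t \<le> 0" | "0 < t" "t \<le> 1" | "1 < t" by linarith
    then show "ennreal (indicator {0<..} t * t powr (s - 1) * (1 - exp (- 1 / (4 * t)))) \<le> ennreal (indicator {0..1} t * t powr (s - 1)) + ennreal (t powr (- (1 - s) - 1)) * indicator {1<..} t"
    proof cases
      case 2
      have "?r \<le> t powr (s - 1) * 1" by (intro mult_left_mono) auto
      then show ?thesis using 2 by (simp add: ennreal_leI)
    next
      case 3
      have "1 + (- 1 / (4 * t)) \<le> exp (- 1 / (4 * t))" by (rule exp_ge_add_one_self)
      then have "1 - exp (- 1 / (4 * t)) \<le> 1 / t" using 3 by (simp add: field_simps)
      then have "?r \<le> t powr (s - 1) * (1 / t)" by (intro mult_left_mono) auto
      also have "\<dots> = t powr (- (1 - s) - 1)"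
      proof -
        have "1 / t = t powr (- 1)" using 3 by (simp add: powr_minus field_simps)
        moreover have "- (1 - s) - 1 = (s - 1) + (- 1)" by simp
        ultimately show ?thesis by (simp only: powr_add)
      qed
      finally show ?thesis using 3 by (simp add: ennreal_leI)
    qed simp
  qed
  also have "\<dots> = ennreal (1 / s) + ennreal (1 powr - (1 - s) / (1 - s))"
    using s nn_integral_powr_tail[of 1 "1 - s"]
    by (subst nn_integral_add) (auto simp: nn_integral_powr_unit simp del: minus_diff_eq)
  also have "\<dots> < \<infinity>" by simp
  finally show ?thesis .
qed

text \<open>
  On \<open>{0..1}\<close> the factor \<open>1 - exp (- 1 / (4 * t))\<close> is bounded below, and \<open>t powr (s - 1)\<close> has the integral \<open>1 / s\<close>.
  This is where the size \<open>1 / s\<close> of the symbol comes from.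
\<close>

lemma heat_integral_lower:
  assumes s: "0 < s"
  shows "ennreal ((1 - exp (- 1 / 4)) / s) \<le> heat_integral s"
proof -
  have "ennreal ((1 - exp (- 1 / 4)) / s) = ennreal (1 - exp (- 1 / 4)) * (\<integral>\<^sup>+t. ennreal (indicator {0..1} t * t powr (s - 1)) \<partial>lborel)"
    using s by (simp add: nn_integral_powr_unit ennreal_mult[symmetric])
  also have "\<dots> = (\<integral>\<^sup>+t. ennreal (1 - exp (- 1 / 4)) * ennreal (indicator {0..1} t * t powr (s - 1)) \<partial>lborel)"
    by (intro nn_integral_cmult[symmetric]) measurable
  also have "\<dots> \<le> heat_integral s"
    unfolding heat_integral_def
  proof (intro nn_integral_mono)
    fix t :: real
    show "ennreal (1 - exp (- 1 / 4)) * ennreal (indicator {0..1} t * t powr (s - 1)) \<le> ennreal (indicator {0<..} t * t powr (s - 1) * (1 - exp (- 1 / (4 * t))))"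
    proof (cases "0 < t \<and> t \<le> 1")
      case True
      then have "exp (- 1 / (4 * t)) \<le> exp (- 1 / 4)" by (simp add: field_simps)
      then have "(1 - exp (- 1 / 4)) * t powr (s - 1) \<le> t powr (s - 1) * (1 - exp (- 1 / (4 * t)))"
        by (subst mult.commute) (intro mult_left_mono, auto)
      then show ?thesis using True by (simp add: ennreal_mult[symmetric] ennreal_leI)
    next
      case False
      then show ?thesis by (cases "t = 0") (auto simp: indicator_def)
    qed
  qed
  finally show ?thesis .
qed

text \<open>
  The reciprocal of the normalisation constant of the fractional seminorm.
\<close>

definition symbol_const :: "nat \<Rightarrow> real \<Rightarrow> real" where
  "symbol_const d s = 2 * pi powr (real d / 2) * enn2real (heat_integral s) / Gamma (real d / 2 + s)"

text \<open>
  Gaussians are radial, so the representation of \<open>|h| powr (- d - 2 * s)\<close> by lemma \<open>gamma_kernel\<close> shows the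
  dependence on \<open>|\<xi>|\<close> alone without any appeal to rotations, and the substitution \<open>t = |\<xi>|\<^sup>2 * t'\<close> produces
  the power \<open>2 * s\<close>.
\<close>

lemma symbol_integral:
  fixes \<xi> :: "'a::euclidean_space"
  assumes s: "0 < s" "s < 1"
  shows "(\<integral>\<^sup>+h. ennreal ((2 - 2 * cos (\<xi> \<bullet> h)) * norm h powr (- real DIM('a) - 2 * s)) \<partial>lborel)
     = ennreal (symbol_const DIM('a) s * norm \<xi> powr (2 * s))"
proof -
  define d where "d = real DIM('a)"
  define p where "p = d / 2 + s"
  have p: "p > 0" using s by (simp add: p_def d_def)
  have Gp: "Gamma p > 0" by (rule Gamma_real_pos[OF p])
  define c where "c = (\<lambda>h::'a. 2 - 2 * cos (\<xi> \<bullet> h))"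
  have c0: "c h \<ge> 0" for h by (simp add: c_def)
  have [measurable]: "c \<in> borel_measurable borel"
    unfolding c_def by (intro borel_measurable_continuous_onI continuous_intros)
  define w where "w = (\<lambda>t. indicator {0<..} t * t powr (p - 1))"
  have w0: "w t \<ge> 0" for t by (simp add: w_def)
  have [measurable]: "w \<in> borel_measurable borel" unfolding w_def by measurable
  let ?D = "\<integral>\<^sup>+h. ennreal (c h * norm h powr (- d - 2 * s)) \<partial>lborel"
  have "ennreal (Gamma p) * ?D = (\<integral>\<^sup>+h. ennreal (Gamma p) * ennreal (c h * norm h powr (- d - 2 * s)) \<partial>lborel)"
    by (intro nn_integral_cmult[symmetric]) measurable
  also have "\<dots> = (\<integral>\<^sup>+h. \<integral>\<^sup>+t. ennreal (w t * exp (- t * (norm h)\<^sup>2) * c h) \<partial>lborel \<partial>lborel)"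
  proof (intro nn_integral_cong)
    fix h :: 'a
    show "ennreal (Gamma p) * ennreal (c h * norm h powr (- d - 2 * s)) = (\<integral>\<^sup>+t. ennreal (w t * exp (- t * (norm h)\<^sup>2) * c h) \<partial>lborel)"
    proof (cases "h = 0")
      case True
      then show ?thesis by (simp add: c_def)
    next
      case False
      then have n: "norm h > 0" by simp
      have "((norm h)\<^sup>2) powr - p = norm h powr (- d - 2 * s)"
        using n by (simp add: powr_powr p_def flip: powr_numeral)
      then have "(\<integral>\<^sup>+t. ennreal (w t * exp (- t * (norm h)\<^sup>2)) \<partial>lborel) = ennreal (Gamma p * norm h powr (- d - 2 * s))"
        using gamma_kernel[of "(norm h)\<^sup>2" p] n p by (simp add: w_def)
      moreover have "(\<integral>\<^sup>+t. ennreal (w t * exp (- t * (norm h)\<^sup>2) * c h) \<partial>lborel) = (\<integral>\<^sup>+t. ennreal (w t * exp (- t * (norm h)\<^sup>2)) \<partial>lborel) * ennreal (c h)"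
        using c0 w0 by (subst nn_integral_multc[symmetric]) (auto simp: ennreal_mult)
      ultimately show ?thesis using c0[of h] Gp by (simp add: ennreal_mult[symmetric] mult_ac)
    qed
  qed
  also have "\<dots> = (\<integral>\<^sup>+t. \<integral>\<^sup>+h. ennreal (w t * exp (- t * (norm h)\<^sup>2) * c h) \<partial>lborel \<partial>lborel)"
  proof (rule lborel_pair.Fubini'[symmetric])
    show "(\<lambda>(h, t). ennreal (w t * exp (- t * (norm h)\<^sup>2) * c h)) \<in> borel_measurable lborel2"
      unfolding measurable_lborel2 by measurable
  qed
  also have "\<dots> = (\<integral>\<^sup>+t. ennreal (2 * pi powr (d / 2)) * ennreal (indicator {0<..} t * t powr (s - 1) * (1 - exp (- (norm \<xi>)\<^sup>2 / (4 * t)))) \<partial>lborel)"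
  proof (intro nn_integral_cong)
    fix t :: real
    show "(\<integral>\<^sup>+h. ennreal (w t * exp (- t * (norm h)\<^sup>2) * c h) \<partial>lborel) = ennreal (2 * pi powr (d / 2)) * ennreal (indicator {0<..} t * t powr (s - 1) * (1 - exp (- (norm \<xi>)\<^sup>2 / (4 * t))))"
    proof (cases "t > 0")
      case True
      have "(\<integral>\<^sup>+h. ennreal (w t * exp (- t * (norm h)\<^sup>2) * c h) \<partial>lborel) = (\<integral>\<^sup>+h. ennreal (w t) * ennreal (exp (- t * (norm h)\<^sup>2) * c h) \<partial>lborel)"
        using c0 w0 by (intro nn_integral_cong) (simp add: ennreal_mult[symmetric] mult.assoc)
      also have "\<dots> = ennreal (w t) * (\<integral>\<^sup>+h. ennreal (exp (- t * (norm h)\<^sup>2) * c h) \<partial>lborel)"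
        by (intro nn_integral_cmult) measurable
      also have "(\<integral>\<^sup>+h. ennreal (exp (- t * (norm h)\<^sup>2) * c h) \<partial>lborel) = ennreal (2 * (pi / t) powr (d / 2) * (1 - exp (- (norm \<xi>)\<^sup>2 / (4 * t))))"
        using gaussian_fourier_nn[OF True, of \<xi>] by (simp add: c_def d_def inner_commute)
      also have "ennreal (w t) * \<dots> = ennreal (w t * (2 * (pi / t) powr (d / 2) * (1 - exp (- (norm \<xi>)\<^sup>2 / (4 * t)))))"
        using w0 by (intro ennreal_mult'[symmetric])
      also have "w t * (2 * (pi / t) powr (d / 2) * (1 - exp (- (norm \<xi>)\<^sup>2 / (4 * t)))) = 2 * pi powr (d / 2) * (indicator {0<..} t * t powr (s - 1) * (1 - exp (- (norm \<xi>)\<^sup>2 / (4 * t))))"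
      proof -
        have "p - 1 = d / 2 + (s - 1)" by (simp add: p_def)
        then have "t powr (p - 1) = t powr (d / 2) * t powr (s - 1)"
          by (simp only: powr_add)
        then have "t powr (p - 1) * (pi / t) powr (d / 2) = pi powr (d / 2) * t powr (s - 1)"
          using True by (simp add: powr_divide)
        then show ?thesis using True by (simp add: w_def)
      qed
      finally show ?thesis by (simp add: ennreal_mult')
    next
      case False
      then show ?thesis by (simp add: w_def)
    qed
  qed
  also have "\<dots> = ennreal (2 * pi powr (d / 2)) * (\<integral>\<^sup>+t. ennreal (indicator {0<..} t * t powr (s - 1) * (1 - exp (- (norm \<xi>)\<^sup>2 / (4 * t)))) \<partial>lborel)"
    by (intro nn_integral_cmult) measurable
  also have "(\<integral>\<^sup>+t. ennreal (indicator {0<..} t * t powr (s - 1) * (1 - exp (- (norm \<xi>)\<^sup>2 / (4 * t)))) \<partial>lborel) = ennreal (norm \<xi> powr (2 * s)) * heat_integral s"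
  proof (cases "\<xi> = 0")
    case False
    define r where "r = (norm \<xi>)\<^sup>2"
    have r: "r > 0" using False by (simp add: r_def)
    have "(\<integral>\<^sup>+t. ennreal (indicator {0<..} t * t powr (s - 1) * (1 - exp (- r / (4 * t)))) \<partial>lborel) =
       ennreal \<bar>r\<bar> * (\<integral>\<^sup>+t. ennreal (indicator {0<..} (0 + r * t) * (0 + r * t) powr (s - 1) * (1 - exp (- r / (4 * (0 + r * t))))) \<partial>lborel)"
      using r by (intro nn_integral_real_affine) auto
    also have "(\<integral>\<^sup>+t. ennreal (indicator {0<..} (0 + r * t) * (0 + r * t) powr (s - 1) * (1 - exp (- r / (4 * (0 + r * t))))) \<partial>lborel)
       = (\<integral>\<^sup>+t. ennreal (r powr (s - 1)) * ennreal (indicator {0<..} t * t powr (s - 1) * (1 - exp (- 1 / (4 * t)))) \<partial>lborel)"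
    proof (intro nn_integral_cong)
      fix t :: real
      show "ennreal (indicator {0<..} (0 + r * t) * (0 + r * t) powr (s - 1) * (1 - exp (- r / (4 * (0 + r * t))))) = ennreal (r powr (s - 1)) * ennreal (indicator {0<..} t * t powr (s - 1) * (1 - exp (- 1 / (4 * t))))"
      proof (cases "t > 0")
        case True
        then have "- r / (4 * (0 + r * t)) = - 1 / (4 * t)" using r by simp
        then show ?thesis using True r by (simp add: powr_mult ennreal_mult'[symmetric] mult.assoc)
      next
        case False
        then have "r * t \<le> 0" using r by (simp add: mult_le_0_iff)
        then show ?thesis using False by simp
      qed
    qed
    also have "\<dots> = ennreal (r powr (s - 1)) * heat_integral s"
      unfolding heat_integral_def by (intro nn_integral_cmult) measurable
    also have "ennreal \<bar>r\<bar> * (ennreal (r powr (s - 1)) * heat_integral s) = ennreal (r * r powr (s - 1)) * heat_integral s"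
      using r by (simp add: ennreal_mult mult.assoc)
    also have "r * r powr (s - 1) = norm \<xi> powr (2 * s)"
    proof -
      have "r * r powr (s - 1) = r powr s" using r by (simp add: powr_mult_base)
      also have "\<dots> = norm \<xi> powr (2 * s)" unfolding r_def using False by (simp add: powr_powr flip: powr_numeral)
      finally show ?thesis .
    qed
    finally show ?thesis by (simp add: r_def)
  qed simp
  finally have main: "ennreal (Gamma p) * ?D = ennreal (2 * pi powr (d / 2)) * (ennreal (norm \<xi> powr (2 * s)) * heat_integral s)" .
  have "?D = ennreal (1 / Gamma p) * (ennreal (Gamma p) * ?D)"
    using Gp by (simp add: mult.assoc[symmetric] ennreal_mult'[symmetric])
  also have "\<dots> = ennreal (1 / Gamma p) * (ennreal (2 * pi powr (d / 2)) * (ennreal (norm \<xi> powr (2 * s)) * ennreal (enn2real (heat_integral s))))"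
    using heat_integral_finite[OF s] unfolding main by (simp add: less_top)
  also have "\<dots> = ennreal (1 / Gamma p * (2 * pi powr (d / 2) * (norm \<xi> powr (2 * s) * enn2real (heat_integral s))))"
    using Gp by (simp only: ennreal_mult'' [symmetric] ennreal_mult'[symmetric] enn2real_nonneg powr_ge_zero mult_nonneg_nonneg zero_le_numeral)
  also have "1 / Gamma p * (2 * pi powr (d / 2) * (norm \<xi> powr (2 * s) * enn2real (heat_integral s))) = symbol_const DIM('a) s * norm \<xi> powr (2 * s)"
    by (simp add: symbol_const_def p_def d_def)
  finally show ?thesis unfolding c_def d_def .
qed

text \<open>
  In Euler's integral, \<open>t powr (a + s - 1) \<le> t powr (a - 1) + t powr a\<close>.
\<close>

lemma Gamma_le_sum:
  assumes a: "0 < a" and s: "0 < s" "s < (1::real)"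
  shows "Gamma (a + s) \<le> Gamma a + Gamma (a + 1)"
proof -
  let ?g = "\<lambda>x t. indicator {0..} t * t powr (x - 1) / exp t :: real"
  have "ennreal (Gamma (a + s)) = (\<integral>\<^sup>+t. ennreal (?g (a + s) t) \<partial>lborel)"
    using a s by (intro Gamma_conv_nn_integral_real) auto
  also have "\<dots> \<le> (\<integral>\<^sup>+t. ennreal (?g a t) + ennreal (?g (a + 1) t) \<partial>lborel)"
  proof (intro nn_integral_mono)
    fix t :: real
    have "t powr (a + s - 1) \<le> t powr (a - 1) + t powr a" if "t > 0"
    proof (cases "t \<le> 1")
      case True
      have "t powr (a + s - 1) \<le> t powr (a - 1)" using True that s by (intro powr_mono') auto
      then show ?thesis using powr_ge_zero[of t a] by linarith
    next
      case False
      then have "t powr (a + s - 1) \<le> t powr a" using s by (intro powr_mono) auto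
      then show ?thesis using powr_ge_zero[of t "a - 1"] by linarith
    qed
    then have "?g (a + s) t \<le> ?g a t + ?g (a + 1) t"
      by (cases "t > 0") (auto simp: indicator_def add_divide_distrib[symmetric] divide_right_mono)
    then show "ennreal (?g (a + s) t) \<le> ennreal (?g a t) + ennreal (?g (a + 1) t)"
      by (simp add: ennreal_plus[symmetric] ennreal_leI del: ennreal_plus)
  qed
  also have "\<dots> = ennreal (Gamma a) + ennreal (Gamma (a + 1))"
    using a by (subst nn_integral_add) (auto simp: Gamma_conv_nn_integral_real)
  also have "\<dots> = ennreal (Gamma a + Gamma (a + 1))"
    using Gamma_real_pos[of a] Gamma_real_pos[of "a + 1"] a by simp
  finally show ?thesis
    using Gamma_real_pos[of a] Gamma_real_pos[of "a + 1"] a by (subst (asm) ennreal_le_iff) auto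
qed

text \<open>
  The Gamma values bound \<open>Gamma (d / 2 + s)\<close> for all \<open>s\<close> in the unit interval at once, so that this lower bound
  for \<open>s * symbol_const d s\<close> depends on the dimension only.
\<close>

definition symbol_bound :: "nat \<Rightarrow> real" where
  "symbol_bound d = 2 * pi powr (real d / 2) * (1 - exp (- 1 / 4)) / (Gamma (real d / 2) + Gamma (real d / 2 + 1))"

lemma symbol_bound_pos: "d > 0 \<Longrightarrow> symbol_bound d > 0"
  unfolding symbol_bound_def
  using Gamma_real_pos[of "real d / 2"] Gamma_real_pos[of "real d / 2 + 1"]
  by (intro divide_pos_pos mult_pos_pos add_pos_pos) auto

lemma symbol_const_lower:
  assumes s: "0 < s" "s < 1" and d: "d > 0"
  shows "symbol_bound d / s \<le> symbol_const d s"
proof -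
  have G: "0 < Gamma (real d / 2 + s)" "Gamma (real d / 2 + s) \<le> Gamma (real d / 2) + Gamma (real d / 2 + 1)"
    using Gamma_real_pos[of "real d / 2 + s"] Gamma_le_sum[of "real d / 2" s] s d by auto
  have "ennreal ((1 - exp (- 1 / 4)) / s) \<le> ennreal (enn2real (heat_integral s))"
    using heat_integral_lower[OF s(1)] heat_integral_finite[OF s] by (simp add: less_top)
  then have J: "(1 - exp (- 1 / 4)) / s \<le> enn2real (heat_integral s)"
    by (simp add: ennreal_le_iff)
  have "symbol_bound d / s = 2 * pi powr (real d / 2) * ((1 - exp (- 1 / 4)) / s) / (Gamma (real d / 2) + Gamma (real d / 2 + 1))"
    by (simp add: symbol_bound_def)
  also have "\<dots> \<le> 2 * pi powr (real d / 2) * enn2real (heat_integral s) / Gamma (real d / 2 + s)"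
    using G J s by (intro frac_le mult_left_mono mult_nonneg_nonneg) auto
  finally show ?thesis by (simp add: symbol_const_def)
qed

section \<open>Plancherel's identity\<close>

lemma (in pair_sigma_finite) integrable_integral_pair_mult:
  fixes a :: "'a \<Rightarrow> 'c::{real_normed_field, banach, second_countable_topology}" and b :: "'b \<Rightarrow> 'c"
  assumes a: "integrable M1 a" and b: "integrable M2 b"
  shows "integrable (M1 \<Otimes>\<^sub>M M2) (\<lambda>p. a (fst p) * b (snd p))"
    and "(LINT p|(M1 \<Otimes>\<^sub>M M2). a (fst p) * b (snd p)) = (LINT x|M1. a x) * (LINT y|M2. b y)"
proof -
  have [measurable]: "a \<in> borel_measurable M1" "b \<in> borel_measurable M2" using a b by auto
  show i: "integrable (M1 \<Otimes>\<^sub>M M2) (\<lambda>p. a (fst p) * b (snd p))"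
  proof (rule Fubini_integrable)
    have "integrable M1 (\<lambda>x. norm (a x) * (LINT y|M2. norm (b y)))"
      using a by (intro integrable_mult_left integrable_norm)
    then show "integrable M1 (\<lambda>x. LINT y|M2. norm (a (fst (x, y)) * b (snd (x, y))))"
      using b by (simp add: norm_mult)
    show "AE x in M1. integrable M2 (\<lambda>y. a (fst (x, y)) * b (snd (x, y)))"
      using b by simp
  qed measurable
  have "(LINT p|(M1 \<Otimes>\<^sub>M M2). a (fst p) * b (snd p)) = (LINT x|M1. LINT y|M2. a x * b y)"
    using integral_fst'[OF i] by simp
  also have "\<dots> = (LINT x|M1. a x) * (LINT y|M2. b y)"
    using a b by simp
  finally show "(LINT p|(M1 \<Otimes>\<^sub>M M2). a (fst p) * b (snd p)) = (LINT x|M1. a x) * (LINT y|M2. b y)" .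
qed

lemma lborel_integral_affine:
  fixes f :: "'a::euclidean_space \<Rightarrow> real"
  assumes [measurable]: "f \<in> borel_measurable borel" and c: "c > 0"
  shows "(LINT y|lborel. f y) = c ^ DIM('a) * (LINT w|lborel. f (t + c *\<^sub>R w))"
proof -
  have "(LINT y|lborel. f y) = (LINT y|density (distr lborel borel (\<lambda>x. t + c *\<^sub>R x)) (\<lambda>_. \<bar>c\<bar>^DIM('a)). f y)"
    using c by (subst lborel_affine[of c t]) auto
  also have "\<dots> = c ^ DIM('a) * (LINT w|lborel. f (t + c *\<^sub>R w))"
    using c by (subst integral_density) (auto simp: integral_distr)
  finally show ?thesis .
qed

text \<open>
  The Fourier integral without its normalising factor.
\<close>

definition ft :: "('a::euclidean_space \<Rightarrow> real) \<Rightarrow> 'a \<Rightarrow> complex" where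
  "ft v \<xi> = (LINT x|lborel. cis (- (\<xi> \<bullet> x)) * complex_of_real (v x))"

lemma ft_measurable:
  assumes [measurable]: "v \<in> borel_measurable borel"
  shows "ft v \<in> borel_measurable borel"
proof -
  have "(\<lambda>p::'a\<times>'a. cis (- (fst p \<bullet> snd p))) \<in> borel_measurable borel"
    by (intro borel_measurable_continuous_onI continuous_intros)
  then have [measurable]: "(\<lambda>p::'a\<times>'a. cis (- (fst p \<bullet> snd p))) \<in> borel_measurable borel2"
    by (simp only: borel_prod)
  have "(\<lambda>p::'a\<times>'a. cis (- (fst p \<bullet> snd p)) * complex_of_real (v (snd p))) \<in> borel_measurable (borel \<Otimes>\<^sub>M lborel)"
    by measurable
  then have "(\<lambda>(\<xi>, x). cis (- (\<xi> \<bullet> x)) * complex_of_real (v x)) \<in> borel_measurable (borel \<Otimes>\<^sub>M lborel)"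
    by (simp add: case_prod_unfold)
  from lborel.borel_measurable_lebesgue_integral[OF this] show ?thesis
    unfolding ft_def[abs_def] .
qed

lemma ft_square:
  fixes v :: "'a::euclidean_space \<Rightarrow> real"
  assumes v: "integrable lborel v"
  shows "(cmod (ft v \<xi>))\<^sup>2 = (LINT p|lborel2. v (fst p) * v (snd p) * cos (\<xi> \<bullet> (fst p - snd p)))"
proof -
  let ?f = "\<lambda>x. cis (- (\<xi> \<bullet> x)) * complex_of_real (v x)"
  have vm[measurable]: "v \<in> borel_measurable borel" using v by auto
  have [measurable]: "(\<lambda>x. cis (- (\<xi> \<bullet> x))) \<in> borel_measurable borel"
    by (intro borel_measurable_continuous_onI continuous_intros)
  have f: "integrable lborel ?f"
    by (rule Bochner_Integration.integrable_bound[OF v]) (auto simp: norm_mult)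
  have g: "integrable lborel (\<lambda>x. cnj (?f x))" by (rule integrable_cnj[OF f])
  have "complex_of_real ((cmod (ft v \<xi>))\<^sup>2) = ft v \<xi> * cnj (ft v \<xi>)"
    by (rule complex_norm_square)
  also have "cnj (ft v \<xi>) = (LINT x|lborel. cnj (?f x))"
    unfolding ft_def by (rule integral_bounded_linear[OF bounded_linear_cnj f, symmetric])
  also have "ft v \<xi> * \<dots> = (LINT p|lborel2. ?f (fst p) * cnj (?f (snd p)))"
    unfolding ft_def by (rule lborel_pair.integrable_integral_pair_mult(2)[OF f g, symmetric])
  finally have "(cmod (ft v \<xi>))\<^sup>2 = Re (LINT p|lborel2. ?f (fst p) * cnj (?f (snd p)))"
    by (metis Re_complex_of_real)
  also have "\<dots> = (LINT p|lborel2. Re (?f (fst p) * cnj (?f (snd p))))"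
    by (rule integral_bounded_linear[OF bounded_linear_Re lborel_pair.integrable_integral_pair_mult(1)[OF f g], symmetric])
  also have "\<dots> = (LINT p|lborel2. v (fst p) * v (snd p) * cos (\<xi> \<bullet> (fst p - snd p)))"
  proof (intro Bochner_Integration.integral_cong refl)
    fix p
    show "Re (?f (fst p) * cnj (?f (snd p))) = v (fst p) * v (snd p) * cos (\<xi> \<bullet> (fst p - snd p))"
      by (simp add: inner_diff_right cos_diff algebra_simps)
  qed
  finally show ?thesis .
qed

text \<open>
  The Gaussian weight makes the triple integral over \<open>\<xi>\<close>, \<open>x\<close> and \<open>y\<close> absolutely convergent, so that
  the integral over \<open>\<xi>\<close> may be evaluated first.
\<close>

lemma ft_gaussian_weight:
  fixes v :: "'a::euclidean_space \<Rightarrow> real"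
  assumes v: "integrable lborel v" and \<epsilon>: "\<epsilon> > 0"
  shows "(\<integral>\<^sup>+\<xi>. ennreal (exp (- \<epsilon> * (norm \<xi>)\<^sup>2) * (cmod (ft v \<xi>))\<^sup>2) \<partial>lborel) =
    ennreal (LINT p|lborel2. v (fst p) * v (snd p) * ((pi / \<epsilon>) powr (real DIM('a) / 2) * exp (- (norm (fst p - snd p))\<^sup>2 / (4 * \<epsilon>))))"
proof -
  let ?e = "\<lambda>\<xi>::'a. exp (- \<epsilon> * (norm \<xi>)\<^sup>2)"
  let ?F = "\<lambda>\<xi> p. ?e \<xi> * (v (fst p) * v (snd p) * cos (\<xi> \<bullet> (fst p - snd p)))"
  have [measurable]: "v \<in> borel_measurable borel" using v by auto
  interpret Q: pair_sigma_finite "lborel :: 'a measure" "lborel2 :: ('a\<times>'a) measure"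
    unfolding lborel_prod ..
  have e: "integrable lborel ?e" by (rule gaussian_fourier(1)[OF \<epsilon>])
  have vv: "integrable lborel2 (\<lambda>p. v (fst p) * v (snd p))"
    by (rule lborel_pair.integrable_integral_pair_mult(1)[OF v v])
  have m: "(\<lambda>z. ?F (fst z) (snd z)) \<in> borel_measurable (lborel \<Otimes>\<^sub>M lborel2)"
  proof -
    have "(\<lambda>z. ?F (fst z) (snd z)) \<in> borel_measurable (borel \<Otimes>\<^sub>M borel2)" by measurable
    also have "borel_measurable (borel \<Otimes>\<^sub>M borel2) = borel_measurable (lborel \<Otimes>\<^sub>M lborel2)"
      by (intro measurable_cong_sets sets_pair_measure_cong sets_lborel[symmetric] refl)
    finally show ?thesis .
  qed
  have F: "integrable (lborel \<Otimes>\<^sub>M lborel2) (\<lambda>z. ?F (fst z) (snd z))"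
  proof (rule Bochner_Integration.integrable_bound[OF Q.integrable_integral_pair_mult(1)[OF e vv] m], rule AE_I2)
    fix z
    have "\<bar>?F (fst z) (snd z)\<bar> = \<bar>?e (fst z)\<bar> * (\<bar>v (fst (snd z)) * v (snd (snd z))\<bar> * \<bar>cos (fst z \<bullet> (fst (snd z) - snd (snd z)))\<bar>)"
      by (simp only: abs_mult mult.assoc)
    also have "\<dots> \<le> \<bar>?e (fst z)\<bar> * (\<bar>v (fst (snd z)) * v (snd (snd z))\<bar> * 1)"
      by (intro mult_left_mono) auto
    finally show "norm (?F (fst z) (snd z)) \<le> norm (?e (fst z) * (v (fst (snd z)) * v (snd (snd z))))"
      by (simp add: abs_mult)
  qed
  have F': "integrable (lborel \<Otimes>\<^sub>M lborel2) (case_prod ?F)"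
    using F by (simp add: case_prod_unfold)
  have sq: "(LINT p|lborel2. ?F \<xi> p) = ?e \<xi> * (cmod (ft v \<xi>))\<^sup>2" for \<xi>
    unfolding ft_square[OF v] by simp
  have int: "integrable lborel (\<lambda>\<xi>. ?e \<xi> * (cmod (ft v \<xi>))\<^sup>2)"
    using Q.integrable_fst'[OF F] unfolding fst_conv snd_conv sq .
  have "(\<integral>\<^sup>+\<xi>. ennreal (?e \<xi> * (cmod (ft v \<xi>))\<^sup>2) \<partial>lborel) = ennreal (LINT \<xi>|lborel. ?e \<xi> * (cmod (ft v \<xi>))\<^sup>2)"
    by (rule nn_integral_eq_integral[OF int]) simp
  also have "(LINT \<xi>|lborel. ?e \<xi> * (cmod (ft v \<xi>))\<^sup>2) = (LINT \<xi>|lborel. LINT p|lborel2. ?F \<xi> p)"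
    unfolding sq ..
  also have "\<dots> = (LINT p|lborel2. LINT \<xi>|lborel. ?F \<xi> p)"
    by (rule Q.Fubini_integral[OF F', symmetric])
  also have "\<dots> = (LINT p|lborel2. v (fst p) * v (snd p) * ((pi / \<epsilon>) powr (real DIM('a) / 2) * exp (- (norm (fst p - snd p))\<^sup>2 / (4 * \<epsilon>))))"
  proof (intro Bochner_Integration.integral_cong refl)
    fix p :: "'a \<times> 'a"
    have "(LINT \<xi>|lborel. ?F \<xi> p) = (LINT \<xi>|lborel. v (fst p) * v (snd p) * (?e \<xi> * cos (\<xi> \<bullet> (fst p - snd p))))"
      by (intro Bochner_Integration.integral_cong refl) (simp add: mult_ac)
    also have "\<dots> = v (fst p) * v (snd p) * (LINT \<xi>|lborel. ?e \<xi> * cos (\<xi> \<bullet> (fst p - snd p)))"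
      by simp
    also have "(LINT \<xi>|lborel. ?e \<xi> * cos (\<xi> \<bullet> (fst p - snd p))) = (pi / \<epsilon>) powr (real DIM('a) / 2) * exp (- (norm (fst p - snd p))\<^sup>2 / (4 * \<epsilon>))"
      by (rule gaussian_fourier(2)[OF \<epsilon>])
    finally show "(LINT \<xi>|lborel. ?F \<xi> p) = v (fst p) * v (snd p) * ((pi / \<epsilon>) powr (real DIM('a) / 2) * exp (- (norm (fst p - snd p))\<^sup>2 / (4 * \<epsilon>)))" .
  qed
  finally show ?thesis .
qed

text \<open>
  The weights \<open>exp (- \<epsilon> * |\<xi>|\<^sup>2)\<close> increase to \<open>1\<close> as \<open>\<epsilon>\<close> decreases to \<open>0\<close>. After the substitution
  \<open>y = x + 2 * sqrt \<epsilon> * w\<close> the weighted integrals are, up to a constant, the integrals of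
  \<open>v x * v (x + 2 * sqrt \<epsilon> * w) * exp (- |w|\<^sup>2)\<close>, which converge by continuity of \<open>v\<close> and dominated
  convergence.
\<close>

lemma plancherel:
  fixes v :: "'a::euclidean_space \<Rightarrow> real"
  assumes cont: "continuous_on UNIV v" and supp: "\<And>x. R < norm x \<Longrightarrow> v x = 0"
  shows "(\<integral>\<^sup>+\<xi>. ennreal ((cmod (ft v \<xi>))\<^sup>2) \<partial>lborel) = ennreal ((2 * pi) ^ DIM('a)) * (\<integral>\<^sup>+x. ennreal ((v x)\<^sup>2) \<partial>lborel)"
proof -
  have vm[measurable]: "v \<in> borel_measurable borel" using cont by (rule borel_measurable_continuous_onI)
  obtain M where M: "\<And>x. \<bar>v x\<bar> \<le> M" "M \<ge> 0"
  proof -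
    have "compact (v ` cball 0 R)" by (intro compact_continuous_image continuous_on_subset[OF cont]) auto
    then have "bounded (v ` cball 0 R)" by (rule compact_imp_bounded)
    then obtain M where M: "\<forall>x\<in>cball 0 R. \<bar>v x\<bar> \<le> M" by (auto simp: bounded_iff)
    have "\<bar>v x\<bar> \<le> max M 0" for x
      using bspec[OF M, of x] supp[of x] by (cases "norm x \<le> R") auto
    then show thesis by (intro that[of "max M 0"]) auto
  qed
  have bi: "integrable lborel (indicator (cball 0 R) :: 'a \<Rightarrow> real)"
    using emeasure_lborel_cball_finite[of "0::'a" R] by (intro integrable_real_indicator) auto
  have vi: "integrable lborel v"
    by (rule Bochner_Integration.integrable_bound[OF integrable_mult_right[OF bi, of M]])
      (use M supp in \<open>auto simp: indicator_def abs_mult not_le\<close>)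
  have v2: "integrable lborel (\<lambda>x. (v x)\<^sup>2)"
  proof (rule Bochner_Integration.integrable_bound[OF integrable_mult_right[OF vi, of M]], measurable, rule AE_I2)
    fix x show "norm ((v x)\<^sup>2) \<le> norm (M * v x)"
      using mult_right_mono[OF M(1)[of x], of "\<bar>v x\<bar>"] M(2) by (simp add: power2_eq_square abs_mult)
  qed
  let ?d = "real DIM('a)"
  let ?g = "\<lambda>w::'a. exp (- 1 * (norm w)\<^sup>2)"
  have g: "integrable lborel ?g" by (rule gaussian_fourier(1)) simp
  have g1: "(LINT w|lborel. ?g w) = pi powr (?d / 2)"
    using gaussian_fourier(2)[of 1 "0::'a"] by simp
  define c where "c = (\<lambda>n. 1 / real (Suc n))"
  have c: "c n > 0" for n by (simp add: c_def)
  \<comment> \<open>Chosen such that \<open>2 * sqrt (\<epsilon> n) = c n\<close>.\<close>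
  define \<epsilon> where "\<epsilon> = (\<lambda>n. (c n)\<^sup>2 / 4)"
  have \<epsilon>: "\<epsilon> n > 0" for n using c[of n] by (simp add: \<epsilon>_def)
  define H where "H = (\<lambda>n (p::'a\<times>'a). v (fst p) * v (fst p + c n *\<^sub>R snd p) * ?g (snd p))"
  have Hm[measurable]: "H n \<in> borel_measurable borel2" for n unfolding H_def by measurable
  have dom: "integrable lborel2 (\<lambda>p. (M * v (fst p)) * ?g (snd p))"
    by (rule lborel_pair.integrable_integral_pair_mult(1)[OF integrable_mult_right[OF vi] g])
  have Hb: "norm (H n p) \<le> norm ((M * v (fst p)) * ?g (snd p))" for n p
  proof -
    have "\<bar>v (fst p)\<bar> * \<bar>v (fst p + c n *\<^sub>R snd p)\<bar> * ?g (snd p) \<le> \<bar>v (fst p)\<bar> * M * ?g (snd p)"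
      by (intro mult_right_mono mult_left_mono M) auto
    then show ?thesis using M(2) by (simp add: H_def abs_mult mult_ac)
  qed
  have Hi: "integrable lborel2 (H n)" for n
    by (rule Bochner_Integration.integrable_bound[OF dom]) (use Hb in \<open>auto simp: measurable_lborel2\<close>)
  have lim: "(\<lambda>n. LINT p|lborel2. H n p) \<longlonglongrightarrow> (LINT p|lborel2. (v (fst p))\<^sup>2 * ?g (snd p))"
  proof (rule integral_dominated_convergence[where w = "\<lambda>p. norm ((M * v (fst p)) * ?g (snd p))"])
    show "integrable lborel2 (\<lambda>p. norm ((M * v (fst p)) * ?g (snd p)))"
      by (rule integrable_norm[OF dom])
    show "AE p in lborel2. (\<lambda>n. H n p) \<longlonglongrightarrow> (v (fst p))\<^sup>2 * ?g (snd p)"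
    proof (rule AE_I2)
      fix p :: "'a \<times> 'a"
      have "c \<longlonglongrightarrow> 0" unfolding c_def by (rule LIMSEQ_Suc[OF lim_1_over_n])
      then have "(\<lambda>n. fst p + c n *\<^sub>R snd p) \<longlonglongrightarrow> fst p + 0 *\<^sub>R snd p" by (intro tendsto_intros)
      then have "(\<lambda>n. v (fst p + c n *\<^sub>R snd p)) \<longlonglongrightarrow> v (fst p + 0 *\<^sub>R snd p)"
        using cont by (intro isCont_tendsto_compose[of _ v]) (auto simp: continuous_on_eq_continuous_at)
      then have "(\<lambda>n. H n p) \<longlonglongrightarrow> v (fst p) * v (fst p + 0 *\<^sub>R snd p) * ?g (snd p)"
        unfolding H_def by (intro tendsto_intros)
      then show "(\<lambda>n. H n p) \<longlonglongrightarrow> (v (fst p))\<^sup>2 * ?g (snd p)" by (simp add: power2_eq_square)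
    qed
  qed (use Hb in \<open>auto simp: measurable_lborel2\<close>)
  have lim_val: "(LINT p|lborel2. (v (fst p))\<^sup>2 * ?g (snd p)) = (LINT x|lborel. (v x)\<^sup>2) * pi powr (?d / 2)"
    using lborel_pair.integrable_integral_pair_mult(2)[OF v2 g] g1 by simp
  have val: "(\<integral>\<^sup>+\<xi>. ennreal (exp (- \<epsilon> n * (norm \<xi>)\<^sup>2) * (cmod (ft v \<xi>))\<^sup>2) \<partial>lborel) =
     ennreal ((4 * pi) powr (?d / 2) * (LINT p|lborel2. H n p))" for n
  proof -
    let ?G = "\<lambda>z::'a. (pi / \<epsilon> n) powr (?d / 2) * exp (- (norm z)\<^sup>2 / (4 * \<epsilon> n))"
    have bound: "integrable lborel2 (\<lambda>p. v (fst p) * v (snd p) * ?G (fst p - snd p))"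
    proof (rule Bochner_Integration.integrable_bound[OF integrable_mult_right[OF lborel_pair.integrable_integral_pair_mult(1)[OF vi vi]], of _ "(pi / \<epsilon> n) powr (?d / 2)"])
      show "(\<lambda>p. v (fst p) * v (snd p) * ?G (fst p - snd p)) \<in> borel_measurable lborel2"
        unfolding measurable_lborel2 by measurable
      show "AE p in lborel2. norm (v (fst p) * v (snd p) * ?G (fst p - snd p)) \<le> norm ((pi / \<epsilon> n) powr (?d / 2) * (v (fst p) * v (snd p)))"
      proof (rule AE_I2)
        fix p :: "'a \<times> 'a"
        have "?G (fst p - snd p) \<le> (pi / \<epsilon> n) powr (?d / 2) * 1"
          using \<epsilon>[of n] by (intro mult_left_mono) auto
        then have "\<bar>v (fst p) * v (snd p)\<bar> * ?G (fst p - snd p) \<le> \<bar>v (fst p) * v (snd p)\<bar> * (pi / \<epsilon> n) powr (?d / 2)"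
          by (intro mult_left_mono) auto
        then show "norm (v (fst p) * v (snd p) * ?G (fst p - snd p)) \<le> norm ((pi / \<epsilon> n) powr (?d / 2) * (v (fst p) * v (snd p)))"
          by (simp add: abs_mult mult_ac)
      qed
    qed
    have "(LINT p|lborel2. v (fst p) * v (snd p) * ?G (fst p - snd p)) = (LINT x|lborel. LINT y|lborel. v x * v y * ?G (x - y))"
      using lborel_pair.integral_fst'[OF bound] by simp
    also have "\<dots> = (LINT x|lborel. LINT w|lborel. (4 * pi) powr (?d / 2) * H n (x, w))"
    proof (rule Bochner_Integration.integral_cong[OF refl])
      fix x :: 'a
      have "(LINT y|lborel. v x * v y * ?G (x - y)) = c n ^ DIM('a) * (LINT w|lborel. v x * v (x + c n *\<^sub>R w) * ?G (x - (x + c n *\<^sub>R w)))"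
        using c[of n] by (intro lborel_integral_affine) auto
      also have "\<dots> = (LINT w|lborel. c n ^ DIM('a) * (v x * v (x + c n *\<^sub>R w) * ?G (x - (x + c n *\<^sub>R w))))"
        by simp
      also have "\<dots> = (LINT w|lborel. (4 * pi) powr (?d / 2) * H n (x, w))"
      proof (intro Bochner_Integration.integral_cong refl)
        fix w :: 'a
        have "exp (- (norm (x - (x + c n *\<^sub>R w)))\<^sup>2 / (4 * \<epsilon> n)) = ?g w"
          using c[of n] by (simp add: \<epsilon>_def power_mult_distrib)
        moreover have "c n ^ DIM('a) * (pi / \<epsilon> n) powr (?d / 2) = (4 * pi) powr (?d / 2)"
        proof -
          have "c n ^ DIM('a) = ((c n)\<^sup>2) powr (?d / 2)"
            using c[of n] by (simp add: powr_powr powr_realpow[symmetric] flip: powr_numeral)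
          then have "c n ^ DIM('a) * (pi / \<epsilon> n) powr (?d / 2) = ((c n)\<^sup>2 * (pi / \<epsilon> n)) powr (?d / 2)"
            using \<epsilon>[of n] by (simp only: powr_mult zero_le_power2 divide_nonneg_pos pi_ge_zero)
          also have "(c n)\<^sup>2 * (pi / \<epsilon> n) = 4 * pi"
            using c[of n] by (simp add: \<epsilon>_def)
          finally show ?thesis .
        qed
        ultimately show "c n ^ DIM('a) * (v x * v (x + c n *\<^sub>R w) * ?G (x - (x + c n *\<^sub>R w))) = (4 * pi) powr (?d / 2) * H n (x, w)"
          unfolding H_def by (simp add: mult_ac)
      qed
      finally show "(LINT y|lborel. v x * v y * ?G (x - y)) = (LINT w|lborel. (4 * pi) powr (?d / 2) * H n (x, w))" .
    qed
    also have "\<dots> = (4 * pi) powr (?d / 2) * (LINT x|lborel. LINT w|lborel. H n (x, w))"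
      by simp
    also have "(LINT x|lborel. LINT w|lborel. H n (x, w)) = (LINT p|lborel2. H n p)"
      by (rule lborel_pair.integral_fst'[OF Hi])
    finally show ?thesis
      unfolding ft_gaussian_weight[OF vi \<epsilon>] by simp
  qed
  have ftm[measurable]: "ft v \<in> borel_measurable borel" by (rule ft_measurable) measurable
  let ?X = "\<lambda>n \<xi>. ennreal (exp (- \<epsilon> n * (norm \<xi>)\<^sup>2) * (cmod (ft v \<xi>))\<^sup>2)"
  have e0: "\<epsilon> \<longlonglongrightarrow> 0"
  proof -
    have "c \<longlonglongrightarrow> 0" unfolding c_def by (rule LIMSEQ_Suc[OF lim_1_over_n])
    then have "(\<lambda>n. (c n)\<^sup>2 / 4) \<longlonglongrightarrow> 0\<^sup>2 / 4" by (intro tendsto_intros) auto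
    then show ?thesis by (simp add: \<epsilon>_def[abs_def])
  qed
  have emono: "\<epsilon> m \<le> \<epsilon> n" if "n \<le> m" for m n
    unfolding \<epsilon>_def c_def using that by (intro divide_right_mono power_mono frac_le) auto
  have inc: "incseq ?X"
  proof (rule incseq_SucI, rule le_funI)
    fix n and \<xi> :: 'a
    have "\<epsilon> (Suc n) * (norm \<xi>)\<^sup>2 \<le> \<epsilon> n * (norm \<xi>)\<^sup>2" by (intro mult_right_mono emono) auto
    then show "?X n \<xi> \<le> ?X (Suc n) \<xi>" by (intro ennreal_leI mult_right_mono) auto
  qed
  have sup: "(SUP n. ?X n \<xi>) = ennreal ((cmod (ft v \<xi>))\<^sup>2)" for \<xi>
  proof (rule LIMSEQ_unique[OF LIMSEQ_SUP])
    show "incseq (\<lambda>n. ?X n \<xi>)" using inc by (auto simp: incseq_def le_fun_def)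
    have "(\<lambda>n. exp (- \<epsilon> n * (norm \<xi>)\<^sup>2) * (cmod (ft v \<xi>))\<^sup>2) \<longlonglongrightarrow> exp (- 0 * (norm \<xi>)\<^sup>2) * (cmod (ft v \<xi>))\<^sup>2"
      by (intro tendsto_intros e0)
    then show "(\<lambda>n. ?X n \<xi>) \<longlonglongrightarrow> ennreal ((cmod (ft v \<xi>))\<^sup>2)"
      by (intro tendsto_ennrealI) simp
  qed
  have "(\<integral>\<^sup>+\<xi>. ennreal ((cmod (ft v \<xi>))\<^sup>2) \<partial>lborel) = (\<integral>\<^sup>+\<xi>. (SUP n. ?X n \<xi>) \<partial>lborel)"
    unfolding sup ..
  also have "\<dots> = (SUP n. \<integral>\<^sup>+\<xi>. ?X n \<xi> \<partial>lborel)"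
    by (rule nn_integral_monotone_convergence_SUP[OF inc]) measurable
  also have "\<dots> = ennreal ((4 * pi) powr (?d / 2) * ((LINT x|lborel. (v x)\<^sup>2) * pi powr (?d / 2)))"
  proof (rule LIMSEQ_unique[OF LIMSEQ_SUP])
    show "incseq (\<lambda>n. \<integral>\<^sup>+\<xi>. ?X n \<xi> \<partial>lborel)"
      using inc by (auto simp: incseq_def le_fun_def intro!: nn_integral_mono)
    show "(\<lambda>n. \<integral>\<^sup>+\<xi>. ?X n \<xi> \<partial>lborel) \<longlonglongrightarrow> ennreal ((4 * pi) powr (?d / 2) * ((LINT x|lborel. (v x)\<^sup>2) * pi powr (?d / 2)))"
      unfolding val using lim unfolding lim_val by (intro tendsto_ennrealI tendsto_intros)
  qed
  also have "(4 * pi) powr (?d / 2) * ((LINT x|lborel. (v x)\<^sup>2) * pi powr (?d / 2)) = (2 * pi) ^ DIM('a) * (LINT x|lborel. (v x)\<^sup>2)"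
  proof -
    have "(4 * pi) powr (?d / 2) * pi powr (?d / 2) = ((2 * pi)\<^sup>2) powr (?d / 2)"
      by (simp add: powr_mult[symmetric] power2_eq_square mult.assoc)
    also have "\<dots> = ((2 * pi) powr 2) powr (?d / 2)" by simp
    also have "\<dots> = (2 * pi) powr ?d" by (simp only: powr_powr) simp
    also have "\<dots> = (2 * pi) ^ DIM('a)" by (rule powr_realpow) simp
    finally show ?thesis by (simp add: mult_ac)
  qed
  also have "ennreal \<dots> = ennreal ((2 * pi) ^ DIM('a)) * ennreal (LINT x|lborel. (v x)\<^sup>2)"
    by (intro ennreal_mult) auto
  also have "ennreal (LINT x|lborel. (v x)\<^sup>2) = (\<integral>\<^sup>+x. ennreal ((v x)\<^sup>2) \<partial>lborel)"
    by (rule nn_integral_eq_integral[OF v2, symmetric]) simp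
  finally show ?thesis .
qed

section \<open>The normalisation constant\<close>

lemma nn_integral_lborel_shift:
  fixes x :: "'a::euclidean_space"
  assumes "f \<in> borel_measurable borel"
  shows "(\<integral>\<^sup>+y. f y \<partial>lborel) = (\<integral>\<^sup>+h. f (x + h) \<partial>lborel)"
proof -
  have "(\<integral>\<^sup>+y. f y \<partial>lborel) = (\<integral>\<^sup>+y. f y \<partial>(distr lborel borel ((+) x)))"
    by (simp only: lborel_distr_plus)
  also have "\<dots> = (\<integral>\<^sup>+h. f (x + h) \<partial>lborel)"
    using assms by (intro nn_integral_distr) auto
  finally show ?thesis .
qed

text \<open>
  Translation multiplies the transform by \<open>cis (\<xi> \<bullet> h)\<close>, and \<open>|cis t - 1|\<^sup>2 = 2 - 2 * cos t\<close>.
\<close>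

lemma ft_difference:
  fixes u :: "'a::euclidean_space \<Rightarrow> real"
  assumes u: "integrable lborel u"
  shows "(cmod (ft (\<lambda>x. u (x + h) - u x) \<xi>))\<^sup>2 = (2 - 2 * cos (\<xi> \<bullet> h)) * (cmod (ft u \<xi>))\<^sup>2"
proof -
  let ?c = "\<lambda>x. cis (- (\<xi> \<bullet> x))"
  have [measurable]: "u \<in> borel_measurable borel" using u by auto
  have [measurable]: "?c \<in> borel_measurable borel"
    by (intro borel_measurable_continuous_onI continuous_intros)
  have fm: "(\<lambda>x. ?c x * complex_of_real (u x)) \<in> borel_measurable borel" by measurable
  have f: "integrable lborel (\<lambda>x. ?c x * complex_of_real (u x))"
    by (rule Bochner_Integration.integrable_bound[OF u]) (auto simp: norm_mult)
  have f': "integrable (distr lborel borel ((+) h)) (\<lambda>x. ?c x * complex_of_real (u x))"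
    using f by (simp only: lborel_distr_plus)
  have fh: "integrable lborel (\<lambda>x. ?c (h + x) * complex_of_real (u (h + x)))"
    using f' by (subst (asm) integrable_distr_eq) (auto intro: fm)
  have ft_h: "ft u \<xi> = (LINT x|lborel. ?c (h + x) * complex_of_real (u (h + x)))"
  proof -
    have "ft u \<xi> = (LINT x|distr lborel borel ((+) h). ?c x * complex_of_real (u x))"
      unfolding ft_def by (simp only: lborel_distr_plus)
    also have "\<dots> = (LINT x|lborel. ?c (h + x) * complex_of_real (u (h + x)))"
      by (rule integral_distr[OF _ fm]) simp
    finally show ?thesis .
  qed
  have split: "?c x * complex_of_real (u (x + h) - u x) = cis (\<xi> \<bullet> h) * (?c (h + x) * complex_of_real (u (h + x))) - ?c x * complex_of_real (u x)" for x
  proof -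
    have "cis (\<xi> \<bullet> h) * ?c (h + x) = ?c x"
      by (simp add: cis_mult inner_add_right)
    then have *: "cis (\<xi> \<bullet> h) * (?c (h + x) * complex_of_real (u (h + x))) = ?c x * complex_of_real (u (h + x))"
      by (simp only: mult.assoc[symmetric])
    show ?thesis unfolding * by (simp add: add.commute right_diff_distrib)
  qed
  have "ft (\<lambda>x. u (x + h) - u x) \<xi> = cis (\<xi> \<bullet> h) * ft u \<xi> - ft u \<xi>"
  proof -
    have "ft (\<lambda>x. u (x + h) - u x) \<xi> = (LINT x|lborel. cis (\<xi> \<bullet> h) * (?c (h + x) * complex_of_real (u (h + x)))) - (LINT x|lborel. ?c x * complex_of_real (u x))"
      unfolding ft_def split by (intro Bochner_Integration.integral_diff integrable_mult_right fh f)
    also have "\<dots> = cis (\<xi> \<bullet> h) * ft u \<xi> - ft u \<xi>"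
      unfolding ft_h[symmetric] integral_mult_right_zero by (simp only: ft_def)
    finally show ?thesis .
  qed
  also have "\<dots> = (cis (\<xi> \<bullet> h) - 1) * ft u \<xi>" by (simp add: algebra_simps)
  finally have "(cmod (ft (\<lambda>x. u (x + h) - u x) \<xi>))\<^sup>2 = (cmod (cis (\<xi> \<bullet> h) - 1))\<^sup>2 * (cmod (ft u \<xi>))\<^sup>2"
    by (simp add: norm_mult power_mult_distrib)
  also have "(cmod (cis (\<xi> \<bullet> h) - 1))\<^sup>2 = 2 - 2 * cos (\<xi> \<bullet> h)"
  proof -
    have "(cmod (cis t - 1))\<^sup>2 = 2 - 2 * cos t" for t
    proof -
      have "(cmod (cis t - 1))\<^sup>2 = (cos t - 1)\<^sup>2 + (sin t)\<^sup>2" by (simp add: cmod_power2)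
      also have "\<dots> = 2 - 2 * cos t"
        using sin_cos_squared_add[of t] by (simp add: power2_eq_square algebra_simps)
      finally show ?thesis .
    qed
    then show ?thesis .
  qed
  finally show ?thesis .
qed

definition gagliardo :: "real \<Rightarrow> ('a::euclidean_space \<Rightarrow> real) \<Rightarrow> ennreal" where
  "gagliardo s u = (\<integral>\<^sup>+p. ennreal ((u (fst p) - u (snd p))\<^sup>2 * norm (fst p - snd p) powr (- real DIM('a) - 2 * s)) \<partial>lborel2)"

lemma gagliardo_by_differences:
  fixes u :: "'a::euclidean_space \<Rightarrow> real"
  assumes [measurable]: "u \<in> borel_measurable borel"
  shows "gagliardo s u = (\<integral>\<^sup>+h. ennreal (norm h powr (- real DIM('a) - 2 * s)) * (\<integral>\<^sup>+x. ennreal ((u (x + h) - u x)\<^sup>2) \<partial>lborel) \<partial>lborel)"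
proof -
  let ?k = "\<lambda>h::'a. norm h powr (- real DIM('a) - 2 * s)"
  have "(\<lambda>p. ennreal ((u (fst p) - u (snd p))\<^sup>2 * ?k (fst p - snd p))) \<in> borel_measurable lborel2"
    unfolding measurable_lborel2 by measurable
  from lborel.nn_integral_fst[OF this]
  have "gagliardo s u = (\<integral>\<^sup>+x. \<integral>\<^sup>+y. ennreal ((u x - u y)\<^sup>2 * ?k (x - y)) \<partial>lborel \<partial>lborel)"
    unfolding gagliardo_def by simp
  also have "\<dots> = (\<integral>\<^sup>+x. \<integral>\<^sup>+h. ennreal (?k h * (u (x + h) - u x)\<^sup>2) \<partial>lborel \<partial>lborel)"
  proof (rule nn_integral_cong)
    fix x :: 'a
    have "(\<integral>\<^sup>+y. ennreal ((u x - u y)\<^sup>2 * ?k (x - y)) \<partial>lborel) = (\<integral>\<^sup>+h. ennreal ((u x - u (x + h))\<^sup>2 * ?k (x - (x + h))) \<partial>lborel)"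
      by (rule nn_integral_lborel_shift) measurable
    then show "(\<integral>\<^sup>+y. ennreal ((u x - u y)\<^sup>2 * ?k (x - y)) \<partial>lborel) = (\<integral>\<^sup>+h. ennreal (?k h * (u (x + h) - u x)\<^sup>2) \<partial>lborel)"
      by (simp add: power2_commute mult.commute)
  qed
  also have "\<dots> = (\<integral>\<^sup>+h. \<integral>\<^sup>+x. ennreal (?k h * (u (x + h) - u x)\<^sup>2) \<partial>lborel \<partial>lborel)"
  proof (rule lborel_pair.Fubini'[symmetric])
    show "(\<lambda>(x, h). ennreal (?k h * (u (x + h) - u x)\<^sup>2)) \<in> borel_measurable lborel2"
      unfolding measurable_lborel2 by measurable
  qed
  also have "\<dots> = (\<integral>\<^sup>+h. ennreal (?k h) * (\<integral>\<^sup>+x. ennreal ((u (x + h) - u x)\<^sup>2) \<partial>lborel) \<partial>lborel)"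
    by (intro nn_integral_cong) (simp add: ennreal_mult nn_integral_cmult)
  finally show ?thesis .
qed

text \<open>
  Exchanging the integrations over \<open>h\<close> and \<open>\<xi>\<close> leaves the symbol as inner integral.
\<close>

lemma symbol_tonelli:
  fixes W :: "'a::euclidean_space \<Rightarrow> ennreal"
  assumes W[measurable]: "W \<in> borel_measurable borel" and s: "0 < s" "s < 1"
  shows "(\<integral>\<^sup>+h. ennreal (norm h powr (- real DIM('a) - 2 * s)) * (\<integral>\<^sup>+\<xi>. W \<xi> * ennreal (2 - 2 * cos (\<xi> \<bullet> h)) \<partial>lborel) \<partial>lborel)
    = ennreal (symbol_const DIM('a) s) * (\<integral>\<^sup>+\<xi>. W \<xi> * ennreal (norm \<xi> powr (2 * s)) \<partial>lborel)"
proof -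
  let ?k = "\<lambda>h::'a. norm h powr (- real DIM('a) - 2 * s)" and ?c = "\<lambda>\<xi> h. 2 - 2 * cos (\<xi> \<bullet> h)"
  have "(\<integral>\<^sup>+h. ennreal (?k h) * (\<integral>\<^sup>+\<xi>. W \<xi> * ennreal (?c \<xi> h) \<partial>lborel) \<partial>lborel)
     = (\<integral>\<^sup>+h. \<integral>\<^sup>+\<xi>. ennreal (?k h) * (W \<xi> * ennreal (?c \<xi> h)) \<partial>lborel \<partial>lborel)"
    by (intro nn_integral_cong nn_integral_cmult[symmetric]) measurable
  also have "\<dots> = (\<integral>\<^sup>+\<xi>. \<integral>\<^sup>+h. ennreal (?k h) * (W \<xi> * ennreal (?c \<xi> h)) \<partial>lborel \<partial>lborel)"
    by (rule lborel_pair.Fubini'[symmetric]) (unfold measurable_lborel2, measurable)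
  also have "\<dots> = (\<integral>\<^sup>+\<xi>. \<integral>\<^sup>+h. W \<xi> * ennreal (?c \<xi> h * ?k h) \<partial>lborel \<partial>lborel)"
    by (intro nn_integral_cong) (simp add: ennreal_mult'' mult_ac)
  also have "\<dots> = (\<integral>\<^sup>+\<xi>. W \<xi> * ennreal (symbol_const DIM('a) s * norm \<xi> powr (2 * s)) \<partial>lborel)"
    unfolding symbol_integral[OF s, symmetric] by (intro nn_integral_cong nn_integral_cmult) measurable
  also have "\<dots> = (\<integral>\<^sup>+\<xi>. ennreal (symbol_const DIM('a) s) * (W \<xi> * ennreal (norm \<xi> powr (2 * s))) \<partial>lborel)"
    by (intro nn_integral_cong) (simp add: ennreal_mult'' mult_ac)
  also have "\<dots> = ennreal (symbol_const DIM('a) s) * (\<integral>\<^sup>+\<xi>. W \<xi> * ennreal (norm \<xi> powr (2 * s)) \<partial>lborel)"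
    by (intro nn_integral_cmult) measurable
  finally show ?thesis .
qed

text \<open>
  Plancherel's identity for each difference, integrated over \<open>h\<close> by lemma \<open>symbol_tonelli\<close>. All integrands are nonnegative, so the identity includes the case of
  infinite values.
\<close>

lemma gagliardo_fourier:
  fixes u :: "'a::euclidean_space \<Rightarrow> real"
  assumes cont: "continuous_on UNIV u" and supp: "\<And>x. R < norm x \<Longrightarrow> u x = 0"
    and s: "0 < s" "s < 1"
  shows "ennreal ((2 * pi) ^ DIM('a)) * gagliardo s u =
    ennreal (symbol_const DIM('a) s) * (\<integral>\<^sup>+\<xi>. ennreal ((cmod (ft u \<xi>))\<^sup>2 * norm \<xi> powr (2 * s)) \<partial>lborel)"
proof -
  have um[measurable]: "u \<in> borel_measurable borel" using cont by (rule borel_measurable_continuous_onI)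
  have ftm[measurable]: "ft u \<in> borel_measurable borel" by (rule ft_measurable[OF um])
  have ui: "integrable lborel u"
  proof -
    have "integrable lborel (\<lambda>x. indicator (cball 0 R) x *\<^sub>R u x)"
      by (intro borel_integrable_compact continuous_on_subset[OF cont]) auto
    moreover have "(\<lambda>x. indicator (cball 0 R) x *\<^sub>R u x) = u"
      using supp by (auto simp: fun_eq_iff indicator_def not_le)
    ultimately show ?thesis by (simp only:)
  qed
  let ?k = "\<lambda>h::'a. norm h powr (- real DIM('a) - 2 * s)"
  have diff: "ennreal ((2 * pi) ^ DIM('a)) * (\<integral>\<^sup>+x. ennreal ((u (x + h) - u x)\<^sup>2) \<partial>lborel) =
     (\<integral>\<^sup>+\<xi>. ennreal ((cmod (ft u \<xi>))\<^sup>2) * ennreal (2 - 2 * cos (\<xi> \<bullet> h)) \<partial>lborel)" for h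
  proof -
    have "(\<integral>\<^sup>+\<xi>. ennreal ((cmod (ft (\<lambda>x. u (x + h) - u x) \<xi>))\<^sup>2) \<partial>lborel) = ennreal ((2 * pi) ^ DIM('a)) * (\<integral>\<^sup>+x. ennreal ((u (x + h) - u x)\<^sup>2) \<partial>lborel)"
    proof (rule plancherel[where R = "\<bar>R\<bar> + norm h"])
      show "continuous_on UNIV (\<lambda>x. u (x + h) - u x)"
        by (intro continuous_intros continuous_on_compose2[OF cont]) auto
      fix x :: 'a assume x: "\<bar>R\<bar> + norm h < norm x"
      moreover have "norm x \<le> norm (x + h) + norm h" using norm_triangle_ineq4[of "x + h" h] by simp
      ultimately have "R < norm (x + h)" "R < norm x" using norm_ge_zero[of h] by linarith+
      then show "u (x + h) - u x = 0" by (simp add: supp)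
    qed
    then show ?thesis unfolding ft_difference[OF ui] by (simp add: ennreal_mult' mult.commute)
  qed
  have "ennreal ((2 * pi) ^ DIM('a)) * gagliardo s u = (\<integral>\<^sup>+h. ennreal ((2 * pi) ^ DIM('a)) * (ennreal (?k h) * (\<integral>\<^sup>+x. ennreal ((u (x + h) - u x)\<^sup>2) \<partial>lborel)) \<partial>lborel)"
    unfolding gagliardo_by_differences[OF um]
  proof (rule nn_integral_cmult[symmetric])
    have "(\<lambda>p. ennreal ((u (snd p + fst p) - u (snd p))\<^sup>2)) \<in> borel_measurable (borel \<Otimes>\<^sub>M lborel)" by measurable
    from lborel.borel_measurable_nn_integral_fst[OF this]
    have [measurable]: "(\<lambda>h. \<integral>\<^sup>+x. ennreal ((u (x + h) - u x)\<^sup>2) \<partial>lborel) \<in> borel_measurable borel" by simp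
    show "(\<lambda>h. ennreal (?k h) * (\<integral>\<^sup>+x. ennreal ((u (x + h) - u x)\<^sup>2) \<partial>lborel)) \<in> borel_measurable lborel" by measurable
  qed
  also have "\<dots> = (\<integral>\<^sup>+h. ennreal (?k h) * (\<integral>\<^sup>+\<xi>. ennreal ((cmod (ft u \<xi>))\<^sup>2) * ennreal (2 - 2 * cos (\<xi> \<bullet> h)) \<partial>lborel) \<partial>lborel)"
    unfolding diff[symmetric] by (simp only: mult.left_commute)
  also have "\<dots> = ennreal (symbol_const DIM('a) s) * (\<integral>\<^sup>+\<xi>. ennreal ((cmod (ft u \<xi>))\<^sup>2) * ennreal (norm \<xi> powr (2 * s)) \<partial>lborel)"
    by (rule symbol_tonelli[OF _ s]) measurable
  finally show ?thesis by (simp add: ennreal_mult')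
qed

text \<open>
  A function with finite and nonzero double integral, which pins down the normalisation constant.
\<close>

definition tent :: "'a::euclidean_space \<Rightarrow> real" where
  "tent x = max 0 (1 - norm x)"

lemma tent_continuous: "continuous_on UNIV tent"
  unfolding tent_def[abs_def] by (intro continuous_intros)

lemma tent_measurable [measurable]: "tent \<in> borel_measurable borel"
  by (rule borel_measurable_continuous_onI[OF tent_continuous])

lemma min_le_exp:
  assumes "0 \<le> (x::real)"
  shows "min 1 x \<le> 5 * (1 - exp (- x / 4))"
proof -
  \<comment> \<open>On \<open>y \<le> 1 / 4\<close> one has \<open>1 - exp (- y) \<ge> y / (1 + y) \<ge> 4 / 5 * y\<close>.\<close>
  define y where "y = min 1 x / 4"
  have y: "0 \<le> y" "y \<le> 1/4" "y \<le> x / 4" using assms by (auto simp: y_def)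
  have "exp (- x / 4) \<le> exp (- y)" using y by simp
  also have "exp (- y) \<le> 1 / (1 + y)"
    using exp_ge_add_one_self[of y] y by (simp add: exp_minus field_simps)
  finally have "1 - 1 / (1 + y) \<le> 1 - exp (- x / 4)" by simp
  moreover have "4/5 * y \<le> 1 - 1 / (1 + y)"
  proof -
    have "4/5 * y * (1 + y) \<le> 4/5 * y * (5/4)" using y by (intro mult_left_mono) auto
    then show ?thesis using y by (simp add: field_simps)
  qed
  ultimately show ?thesis by (simp add: y_def)
qed

text \<open>
  The difference is at most \<open>min 1 |h|\<close> and vanishes outside two unit balls. The bound is written with a
  Gaussian because \<open>1 - exp (- |h|\<^sup>2 / 4)\<close> is itself an integral of \<open>2 - 2 * cos (\<xi> \<bullet> h)\<close> over \<open>\<xi>\<close>.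
\<close>

lemma tent_difference:
  fixes h :: "'a::euclidean_space"
  shows "(\<integral>\<^sup>+x. ennreal ((tent (x + h) - tent x)\<^sup>2) \<partial>lborel)
    \<le> ennreal (10 * unit_ball_vol DIM('a) * (1 - exp (- (norm h)\<^sup>2 / 4)))"
proof -
  let ?m = "min 1 ((norm h)\<^sup>2)"
  have "(\<integral>\<^sup>+x. ennreal ((tent (x + h) - tent x)\<^sup>2) \<partial>lborel) \<le> (\<integral>\<^sup>+x. ennreal ?m * indicator (ball 0 1) x + ennreal ?m * indicator (ball (- h) 1) x \<partial>lborel)"
  proof (intro nn_integral_mono)
    fix x :: 'a
    show "ennreal ((tent (x + h) - tent x)\<^sup>2) \<le> ennreal ?m * indicator (ball 0 1) x + ennreal ?m * indicator (ball (- h) 1) x"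
    proof (cases "x \<in> ball 0 1 \<or> x \<in> ball (- h) 1")
      case True
      have "\<bar>tent (x + h) - tent x\<bar> \<le> \<bar>norm (x + h) - norm x\<bar>" by (auto simp: tent_def)
      also have "\<dots> \<le> norm h" using norm_triangle_ineq3[of "x + h" x] by simp
      finally have "\<bar>tent (x + h) - tent x\<bar>\<^sup>2 \<le> (norm h)\<^sup>2" by (intro power_mono) auto
      moreover have "\<bar>tent (x + h) - tent x\<bar>\<^sup>2 \<le> 1\<^sup>2"
      proof (intro power_mono)
        have "0 \<le> tent z" "tent z \<le> 1" for z :: 'a by (auto simp: tent_def)
        from this[of x] this[of "x + h"] show "\<bar>tent (x + h) - tent x\<bar> \<le> 1" by linarith
      qed auto
      ultimately have "(tent (x + h) - tent x)\<^sup>2 \<le> ?m" by simp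
      then have "ennreal ((tent (x + h) - tent x)\<^sup>2) \<le> ennreal ?m" by (rule ennreal_leI)
      also have "\<dots> \<le> ennreal ?m * indicator (ball 0 1) x + ennreal ?m * indicator (ball (- h) 1) x"
        using True by (elim disjE) (simp_all add: indicator_def)
      finally show ?thesis .
    next
      case False
      then have "1 \<le> norm x" "1 \<le> norm (x + h)"
        by (auto simp: dist_norm norm_minus_commute add.commute)
      then show ?thesis by (simp add: tent_def)
    qed
  qed
  also have "\<dots> = ennreal ?m * emeasure lborel (ball (0::'a) 1) + ennreal ?m * emeasure lborel (ball (- h) 1)"
    by (subst nn_integral_add) (auto simp: nn_integral_cmult)
  also have "\<dots> = ennreal (2 * unit_ball_vol DIM('a) * ?m)"
    by (simp add: emeasure_ball ennreal_mult'[symmetric] ennreal_plus[symmetric] del: ennreal_plus)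
  also have "\<dots> \<le> ennreal (2 * unit_ball_vol DIM('a) * (5 * (1 - exp (- (norm h)\<^sup>2 / 4))))"
    by (intro ennreal_leI mult_left_mono min_le_exp) auto
  also have "2 * unit_ball_vol DIM('a) * (5 * (1 - exp (- (norm h)\<^sup>2 / 4))) = 10 * unit_ball_vol DIM('a) * (1 - exp (- (norm h)\<^sup>2 / 4))"
    by simp
  finally show ?thesis .
qed

text \<open>
  By lemmas \<open>tent_difference\<close> and \<open>symbol_tonelli\<close> the double integral is at most a multiple of
  \<open>\<integral> exp (- |\<xi>|\<^sup>2) * |\<xi>| powr (2 * s)\<close>: the finiteness of the symbol controls both the singularity
  of the kernel and its tail.
\<close>

lemma gagliardo_tent_finite:
  assumes s: "0 < s" "s < 1"
  shows "gagliardo s (tent :: 'a::euclidean_space \<Rightarrow> real) < \<infinity>"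
proof -
  let ?d = "DIM('a)"
  let ?k = "\<lambda>h::'a. norm h powr (- real DIM('a) - 2 * s)"
  \<comment> \<open>The constant which turns the bound of lemma \<open>tent_difference\<close> into the Gaussian integral with \<open>\<tau> = 1\<close>.\<close>
  let ?C = "5 * unit_ball_vol ?d / pi powr (real ?d / 2)"
  have C: "?C \<ge> 0" by simp
  define A where "A = symbol_const ?d s"
  let ?e = "\<lambda>\<xi>::'a. exp (- 1 * (norm \<xi>)\<^sup>2)"
  have "gagliardo s (tent :: 'a \<Rightarrow> real) \<le> (\<integral>\<^sup>+h. ennreal (?k h) * (\<integral>\<^sup>+\<xi>. ennreal (?C * ?e \<xi>) * ennreal (2 - 2 * cos (\<xi> \<bullet> h)) \<partial>lborel) \<partial>lborel)"
    unfolding gagliardo_by_differences[OF tent_measurable]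
  proof (rule nn_integral_mono, rule mult_left_mono)
    fix h :: 'a
    have "(\<integral>\<^sup>+\<xi>. ennreal (?C * ?e \<xi>) * ennreal (2 - 2 * cos (\<xi> \<bullet> h)) \<partial>lborel) = (\<integral>\<^sup>+\<xi>. ennreal ?C * ennreal (?e \<xi> * (2 - 2 * cos (\<xi> \<bullet> h))) \<partial>lborel)"
      by (simp only: ennreal_mult'[OF C] ennreal_mult'[OF exp_ge_zero] mult.assoc)
    also have "\<dots> = ennreal ?C * (\<integral>\<^sup>+\<xi>. ennreal (?e \<xi> * (2 - 2 * cos (\<xi> \<bullet> h))) \<partial>lborel)"
      by (intro nn_integral_cmult) measurable
    also have "\<dots> = ennreal (?C * (2 * (pi / 1) powr (real ?d / 2) * (1 - exp (- (norm h)\<^sup>2 / (4 * 1)))))"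
      unfolding gaussian_fourier_nn[OF zero_less_one] by (rule ennreal_mult'[OF C, symmetric])
    also have "?C * (2 * (pi / 1) powr (real ?d / 2) * (1 - exp (- (norm h)\<^sup>2 / (4 * 1)))) = 10 * unit_ball_vol ?d * (1 - exp (- (norm h)\<^sup>2 / 4))"
      by simp
    finally show "(\<integral>\<^sup>+x. ennreal ((tent (x + h) - tent x)\<^sup>2) \<partial>lborel) \<le> (\<integral>\<^sup>+\<xi>. ennreal (?C * ?e \<xi>) * ennreal (2 - 2 * cos (\<xi> \<bullet> h)) \<partial>lborel)"
      using tent_difference[of h] by simp
  qed simp
  also have "\<dots> = ennreal A * (\<integral>\<^sup>+\<xi>. ennreal (?C * ?e \<xi>) * ennreal (norm \<xi> powr (2 * s)) \<partial>(lborel :: 'a measure))"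
    unfolding A_def by (rule symbol_tonelli[OF _ s]) measurable
  also have "\<dots> \<le> ennreal A * (\<integral>\<^sup>+\<xi>. ennreal (2 * ?C) * ennreal (exp (- (1/2) * (norm \<xi>)\<^sup>2)) \<partial>(lborel :: 'a measure))"
  proof (intro mult_left_mono nn_integral_mono)
    fix \<xi> :: 'a
    define x where "x = (norm \<xi>)\<^sup>2"
    have x: "x \<ge> 0" by (simp add: x_def)
    have "norm \<xi> powr (2 * s) \<le> 1 + x"
    proof (cases "norm \<xi> \<le> 1")
      case True
      then have "norm \<xi> powr (2 * s) \<le> 1" using s by (intro powr_le1) auto
      then show ?thesis using x by simp
    next
      case False
      then have "norm \<xi> powr (2 * s) \<le> norm \<xi> powr 2" using s by (intro powr_mono) auto
      also have "\<dots> = x" using False by (simp add: x_def)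
      finally show ?thesis by simp
    qed
    also have "1 + x \<le> 2 * exp (x / 2)" using exp_ge_add_one_self[of "x / 2"] x by linarith
    finally have "exp (- x) * norm \<xi> powr (2 * s) \<le> exp (- x) * (2 * exp (x / 2))" by (intro mult_left_mono) auto
    also have "\<dots> = 2 * exp (- (1/2) * x)" by (simp add: exp_add[symmetric])
    finally have "?C * (exp (- x) * norm \<xi> powr (2 * s)) \<le> ?C * (2 * exp (- (1/2) * x))"
      by (rule mult_left_mono[OF _ C])
    then have "ennreal (?C * exp (- x) * norm \<xi> powr (2 * s)) \<le> ennreal (2 * ?C * exp (- (1/2) * x))"
      by (intro ennreal_leI) (simp only: mult_ac)
    then show "ennreal (?C * ?e \<xi>) * ennreal (norm \<xi> powr (2 * s)) \<le> ennreal (2 * ?C) * ennreal (exp (- (1/2) * (norm \<xi>)\<^sup>2))"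
      unfolding x_def by (simp add: ennreal_mult''[symmetric])
  qed simp
  also have "(\<integral>\<^sup>+\<xi>. ennreal (2 * ?C) * ennreal (exp (- (1/2) * (norm \<xi>)\<^sup>2)) \<partial>(lborel :: 'a measure)) = ennreal (2 * ?C) * (\<integral>\<^sup>+\<xi>. ennreal (exp (- (1/2) * (norm \<xi>)\<^sup>2)) \<partial>(lborel :: 'a measure))"
    by (intro nn_integral_cmult) measurable
  also have "(\<integral>\<^sup>+\<xi>. ennreal (exp (- (1/2) * (norm \<xi>)\<^sup>2)) \<partial>(lborel :: 'a measure)) = ennreal (LINT \<xi>|lborel. exp (- (1/2) * (norm (\<xi>::'a))\<^sup>2))"
    by (rule nn_integral_eq_integral[OF gaussian_fourier(1)]) auto
  also have "ennreal A * (ennreal (2 * ?C) * \<dots>) < \<infinity>" by (simp add: ennreal_mult_less_top)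
  finally show ?thesis .
qed

lemma gagliardo_tent_positive:
  shows "gagliardo s (tent :: 'a::euclidean_space \<Rightarrow> real) \<noteq> 0"
proof
  obtain b :: 'a where b: "b \<in> Basis" using nonempty_Basis by blast
  let ?P = "ball (0::'a) (1/2)" and ?Q = "ball (3 *\<^sub>R b) 1"
  let ?F = "\<lambda>p::'a\<times>'a. ennreal ((tent (fst p) - tent (snd p))\<^sup>2 * norm (fst p - snd p) powr (- real DIM('a) - 2 * s))"
  assume "gagliardo s (tent :: 'a \<Rightarrow> real) = 0"
  moreover have "?F \<in> borel_measurable lborel2"
    unfolding measurable_lborel2 by measurable
  ultimately have "AE p in lborel2. ?F p = 0"
    unfolding gagliardo_def by (subst (asm) nn_integral_0_iff_AE) auto
  then have "AE p in lborel2. p \<notin> ?P \<times> ?Q"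
  proof eventually_elim
    fix p :: "'a \<times> 'a" assume F: "?F p = 0"
    show "p \<notin> ?P \<times> ?Q"
    proof
      assume "p \<in> ?P \<times> ?Q"
      then have 1: "norm (fst p) < 1/2" and 2: "norm (snd p - 3 *\<^sub>R b) < 1"
        by (auto simp: mem_Times_iff dist_norm norm_minus_commute)
      have "norm (3 *\<^sub>R b) \<le> norm (snd p) + norm (3 *\<^sub>R b - snd p)" by (rule norm_triangle_sub)
      then have "norm (snd p) > 2" using 2 b by (simp add: norm_minus_commute)
      then have "tent (fst p) - tent (snd p) > 0" using 1 by (simp add: tent_def)
      moreover have "fst p \<noteq> snd p" using 1 \<open>norm (snd p) > 2\<close> by auto
      ultimately have "(tent (fst p) - tent (snd p))\<^sup>2 * norm (fst p - snd p) powr (- real DIM('a) - 2 * s) > 0"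
        by (intro mult_pos_pos) auto
      then show False using F by (simp add: ennreal_eq_0_iff)
    qed
  qed
  then have "?P \<times> ?Q \<in> null_sets lborel2"
    by (subst AE_iff_null_sets) auto
  then have "emeasure lborel ?P * emeasure lborel ?Q = 0"
    using lborel.emeasure_pair_measure_Times[of ?P lborel ?Q] by (simp add: null_sets_def)
  moreover have "emeasure lborel (ball c r :: 'a set) \<noteq> 0" if "r > 0" for c r
  proof -
    have "unit_ball_vol (real DIM('a)) * r ^ DIM('a) > 0" using that by simp
    then show ?thesis using that by (simp add: emeasure_ball ennreal_eq_0_iff not_le)
  qed
  ultimately show False by auto
qed

lemma double_integral_Hs_eq: "double_integral_Hs s u = gagliardo s u"
  unfolding double_integral_Hs_def gagliardo_def
  by (simp add: nn_integral_completion lborel_prod case_prod_unfold)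

text \<open>
  Existence is lemma \<open>gagliardo_fourier\<close>; uniqueness follows by testing with \<open>tent\<close>.
\<close>

lemma Hs_const_eq:
  assumes s: "0 < s" "s < 1"
  shows "Hs_const TYPE('n::finite) s = 1 / symbol_const CARD('n) s"
proof -
  let ?d = "CARD('n)"
  define A where "A = symbol_const ?d s"
  have A: "A > 0"
    using symbol_const_lower[OF s, of ?d] symbol_bound_pos[of ?d] s unfolding A_def
    by (smt (verit) divide_pos_pos zero_less_card_finite)
  let ?rhs = "\<lambda>u :: real ^ 'n \<Rightarrow> real. \<integral>\<^sup>+ \<xi>. ennreal ((cmod (fourier_transform u \<xi>))\<^sup>2 * norm \<xi> powr (2 * s)) \<partial>lebesgue"
  have id: "ennreal (1 / A) * double_integral_Hs s u = ?rhs u"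
    if cont: "continuous_on UNIV u" and comp: "compact (closure {x. u x \<noteq> 0})" for u :: "real ^ 'n \<Rightarrow> real"
  proof -
    have um[measurable]: "u \<in> borel_measurable borel" using cont by (rule borel_measurable_continuous_onI)
    have "bounded {x. u x \<noteq> 0}"
      using compact_imp_bounded[OF comp] closure_subset bounded_subset by blast
    then obtain R where R: "\<forall>x\<in>{x. u x \<noteq> 0}. norm x \<le> R" by (auto simp: bounded_iff)
    have supp: "u x = 0" if "R < norm x" for x using R that by force
    have ftm[measurable]: "ft u \<in> borel_measurable borel" by (rule ft_measurable[OF um])
    define P where "P = (2 * pi) ^ ?d"
    have P: "P > 0" by (simp add: P_def)
    have F: "(cmod (fourier_transform u \<xi>))\<^sup>2 = 1 / P * (cmod (ft u \<xi>))\<^sup>2" for \<xi>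
    proof -
      have "(\<lambda>x. cis (- (\<xi> \<bullet> x)) * complex_of_real (u x)) \<in> borel_measurable lborel"
      proof -
        have [measurable]: "(\<lambda>x. cis (- (\<xi> \<bullet> x))) \<in> borel_measurable borel"
          by (intro borel_measurable_continuous_onI continuous_intros)
        show ?thesis by measurable
      qed
      then have "fourier_transform u \<xi> = complex_of_real ((2 * pi) powr (- real ?d / 2)) * ft u \<xi>"
        unfolding fourier_transform_def ft_def by (subst integral_completion) auto
      then have "(cmod (fourier_transform u \<xi>))\<^sup>2 = ((2 * pi) powr (- real ?d / 2))\<^sup>2 * (cmod (ft u \<xi>))\<^sup>2"
        by (simp add: norm_mult power_mult_distrib)
      also have "((2 * pi) powr (- real ?d / 2))\<^sup>2 = (2 * pi) powr (- real ?d)"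
        by (simp add: power2_eq_square powr_add[symmetric])
      also have "\<dots> = 1 / P" by (simp add: P_def powr_minus powr_realpow divide_inverse)
      finally show ?thesis .
    qed
    let ?S = "\<integral>\<^sup>+ \<xi>. ennreal ((cmod (ft u \<xi>))\<^sup>2 * norm \<xi> powr (2 * s)) \<partial>lborel"
    have "?rhs u = (\<integral>\<^sup>+ \<xi>. ennreal (1 / P) * ennreal ((cmod (ft u \<xi>))\<^sup>2 * norm \<xi> powr (2 * s)) \<partial>lborel)"
      unfolding F nn_integral_completion using P
      by (intro nn_integral_cong) (simp add: ennreal_mult'[symmetric])
    also have "\<dots> = ennreal (1 / P) * ?S" by (intro nn_integral_cmult) measurable
    finally have rhs: "?rhs u = ennreal (1 / P) * ?S" .
    have "ennreal P * gagliardo s u = ennreal A * ?S"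
      using gagliardo_fourier[OF cont supp s] by (simp add: P_def A_def)
    then have "ennreal (1 / A * (1 / P)) * (ennreal P * gagliardo s u) = ennreal (1 / A * (1 / P)) * (ennreal A * ?S)"
      by simp
    moreover have "ennreal (1 / A * (1 / P)) * (ennreal P * X) = ennreal (1 / A) * X" for X
      using A P by (simp add: mult.assoc[symmetric] ennreal_mult'[symmetric])
    moreover have "ennreal (1 / A * (1 / P)) * (ennreal A * X) = ennreal (1 / P) * X" for X
      using A P by (simp add: mult.assoc[symmetric] ennreal_mult'[symmetric])
    ultimately show ?thesis unfolding rhs double_integral_Hs_eq by simp
  qed
  show ?thesis
    unfolding Hs_const_def A_def[symmetric]
  proof (rule the_equality)
    show "1 / A > 0 \<and> (\<forall>u :: real ^ 'n \<Rightarrow> real. continuous_on UNIV u \<and> compact (closure {x. u x \<noteq> 0}) \<longrightarrow>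
          ennreal (1 / A) * double_integral_Hs s u = ?rhs u)"
      using A id by simp
  next
    fix c
    assume c: "c > 0 \<and> (\<forall>u :: real ^ 'n \<Rightarrow> real. continuous_on UNIV u \<and> compact (closure {x. u x \<noteq> 0}) \<longrightarrow>
          ennreal c * double_integral_Hs s u = ?rhs u)"
    let ?t = "tent :: real ^ 'n \<Rightarrow> real"
    have comp: "compact (closure {x. ?t x \<noteq> 0})"
    proof -
      have "{x. ?t x \<noteq> 0} \<subseteq> ball 0 1" by (auto simp: tent_def)
      then have "bounded {x. ?t x \<noteq> 0}" using bounded_ball bounded_subset by blast
      then show ?thesis by simp
    qed
    have "ennreal c * double_integral_Hs s ?t = ?rhs ?t"
      by (rule conjunct2[OF c, THEN spec, THEN mp]) (intro conjI tent_continuous comp)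
    also have "\<dots> = ennreal (1 / A) * double_integral_Hs s ?t"
      by (rule id[OF tent_continuous comp, symmetric])
    finally have "ennreal c * gagliardo s ?t = ennreal (1 / A) * gagliardo s ?t"
      unfolding double_integral_Hs_eq .
    moreover obtain g where g: "gagliardo s ?t = ennreal g" "g > 0"
    proof -
      have "gagliardo s ?t < \<infinity>" "gagliardo s ?t \<noteq> 0"
        by (rule gagliardo_tent_finite[OF s], rule gagliardo_tent_positive)
      then show thesis using that by (cases "gagliardo s ?t") (auto simp: less_le)
    qed
    ultimately have "ennreal (c * g) = ennreal (1 / A * g)"
      using c A by (simp add: ennreal_mult'[symmetric])
    then have "c * g = 1 / A * g" using c A g by (subst (asm) ennreal_inj) auto
    then show "c = 1 / A" using g(2) by (simp only: mult_cancel_right) simp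
  qed
qed

lemma coercivity_const_pos:
  assumes "0 < \<mu>" "d > 0"
  shows "coercivity_const d \<mu> > 0"
proof -
  define K where "K = 4 * 5 ^ d / \<mu>"
  have K: "K > 0" using assms by (simp add: K_def)
  have "sqrt (2 * K / (2 * K + 1)) < 1" using K by (simp add: real_sqrt_lt_1_iff)
  then have "poincare_const d \<mu> > 0"
    using assms K unfolding poincare_const_def Let_def K_def[symmetric]
    by (intro divide_pos_pos mult_pos_pos) auto
  then show ?thesis by (simp add: coercivity_const_def)
qed

text \<open>
  The loss \<open>1 / s\<close> in lemma \<open>coercivity_lebesgue\<close> cancels against \<open>Hs_const TYPE('n) s \<le> s / symbol_bound CARD('n)\<close>, so
  that the quotient of the two constants, which depend on \<open>\<mu>\<close> and the dimension only, is
  admissible for all \<open>s\<close>.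
\<close>

theorem theorem1p2:
  fixes \<mu> :: real
  assumes "0 < \<mu>" and "\<mu> < 1"
  shows "\<exists>c::real. c > 0 \<and>
    (\<forall>(s::real) (lam::real) (K :: real ^ 'n \<Rightarrow> real ^ 'n \<Rightarrow> real).
       0 < s \<and> s < 1 \<and> 0 < lam \<and>
       (\<forall>x y. 0 \<le> K x y) \<and>
       (\<lambda>(x, y). K x y) \<in> borel_measurable lebesgue \<and>
       (\<forall>a r x. 0 < r \<and> x \<in> ball a r \<longrightarrow>
          measure lebesgue
            {z \<in> ball a r. K x z \<ge> lam * norm (x - z) powr (- real CARD('n) - 2 * s)}
          \<ge> \<mu> * measure lebesgue (ball a r)) \<longrightarrow>
       (\<forall>u :: real ^ 'n \<Rightarrow> real. u \<in> borel_measurable lebesgue \<longrightarrow>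
          (\<integral>\<^sup>+ x. (\<integral>\<^sup>+ y. ennreal ((u x - u y)\<^sup>2 * K x y) \<partial>lebesgue) \<partial>lebesgue)
          \<ge> ennreal (c * lam) * Hs_seminorm_sq s u))"
proof -
  let ?d = "CARD('n)"
  define C where "C = coercivity_const ?d \<mu>"
  define B where "B = symbol_bound ?d"
  have C: "C > 0" unfolding C_def using assms by (intro coercivity_const_pos) auto
  have B: "B > 0" unfolding B_def by (intro symbol_bound_pos) auto
  show ?thesis
  proof (intro exI[of _ "B / C"] conjI allI impI)
    show "B / C > 0" using B C by simp
  next
    fix s lam :: real and K :: "real ^ 'n \<Rightarrow> real ^ 'n \<Rightarrow> real" and u :: "real ^ 'n \<Rightarrow> real"
    assume H: "0 < s \<and> s < 1 \<and> 0 < lam \<and>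
       (\<forall>x y. 0 \<le> K x y) \<and>
       (\<lambda>(x, y). K x y) \<in> borel_measurable lebesgue \<and>
       (\<forall>a r x. 0 < r \<and> x \<in> ball a r \<longrightarrow>
          measure lebesgue
            {z \<in> ball a r. K x z \<ge> lam * norm (x - z) powr (- real CARD('n) - 2 * s)}
          \<ge> \<mu> * measure lebesgue (ball a r))"
      and u: "u \<in> borel_measurable lebesgue"
    have s: "0 < s" "s < 1" by (rule conjunct1[OF H], rule conjunct1[OF conjunct2[OF H]])
    have lam: "0 < lam" by (rule conjunct1[OF conjunct2[OF conjunct2[OF H]]])
    have Km: "(\<lambda>(x, y). K x y) \<in> borel_measurable lebesgue" using H by (elim conjE)
    have dens: "\<mu> * measure lebesgue (ball a r) \<le>
       measure lebesgue {z \<in> ball a r. lam * norm (x - z) powr (- real DIM(real ^ 'n) - 2 * s) \<le> K x z}"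
      if "0 < r" "x \<in> ball a r" for a r x
    proof -
      have dim: "real DIM(real ^ 'n) = real CARD('n)" by simp
      have "\<forall>a r x. 0 < r \<and> x \<in> ball a r \<longrightarrow> \<mu> * measure lebesgue (ball a r) \<le>
          measure lebesgue {z \<in> ball a r. lam * norm (x - z) powr (- real CARD('n) - 2 * s) \<le> K x z}"
        using H by (elim conjE)
      from this[rule_format, OF conjI[OF that]] show ?thesis unfolding dim .
    qed
    let ?L = "\<integral>\<^sup>+ x. (\<integral>\<^sup>+ y. ennreal ((u x - u y)\<^sup>2 * K x y) \<partial>lebesgue) \<partial>lebesgue"
    have main: "ennreal lam * double_integral_Hs s u \<le> ennreal (C / s) * ?L"
      using coercivity_lebesgue[OF assms s lam Km dens u] unfolding C_def double_integral_Hs_def by simp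
    have hs: "(B / C * lam) * Hs_const TYPE('n) s \<le> s / C * lam"
    proof -
      have "B / s \<le> symbol_const ?d s" unfolding B_def using s by (intro symbol_const_lower) auto
      moreover have "0 < B / s" using B s by simp
      ultimately have "1 / symbol_const ?d s \<le> 1 / (B / s)" by (intro frac_le) auto
      then have "(B / C * lam) * Hs_const TYPE('n) s \<le> (B / C * lam) * (1 / (B / s))"
        unfolding Hs_const_eq[OF s] using B C lam by (intro mult_left_mono) auto
      also have "\<dots> = s / C * lam" using B by simp
      finally show ?thesis .
    qed
    have "ennreal (B / C * lam) * Hs_seminorm_sq s u = ennreal (B / C * lam * Hs_const TYPE('n) s) * double_integral_Hs s u"
      unfolding Hs_seminorm_sq_def using B C lam by (subst ennreal_mult') (auto simp: mult.assoc)
    also have "\<dots> \<le> ennreal (s / C * lam) * double_integral_Hs s u"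
      using hs by (intro mult_right_mono ennreal_leI) auto
    also have "\<dots> = ennreal (s / C) * (ennreal lam * double_integral_Hs s u)"
      using s C by (subst ennreal_mult') (auto simp: mult.assoc)
    also have "\<dots> \<le> ennreal (s / C) * (ennreal (C / s) * ?L)"
      by (intro mult_left_mono main) auto
    also have "\<dots> = ?L"
      using s C by (simp add: mult.assoc[symmetric] ennreal_mult'[symmetric])
    finally show "?L \<ge> ennreal (B / C * lam) * Hs_seminorm_sq s u" .
  qed
qed

end
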